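(* Let $k$ be a field and let $Q$ be a quiver whose underlying graph is a Dynkin diagram. Then the assignment $X\mapsto \dim X$ induces a bijection between the isomorphism classes of (finite dimensional) indecomposable representations of $Q$ over $k$ and the positive roots corresponding to the diagram of $Q$. In particular, there are only finitely many isomorphism classes of indecomposable representations.
   Context: A quiver $Q=(Q_0,Q_1,s,t)$ consists of a finite set $Q_0$ of vertices, a finite set $Q_1$ of arrows and maps $s,t\colon Q_1\to Q_0$ (start and terminus). Its underlying graph is obtained by forgetting the orientation of the arrows. A representation $X$ of $Q$ over $k$ consists of a $k$-vector space $X_i$ for each $i\in Q_0$ and a linear map $X_\alpha\colon X_{s(\alpha)}\to X_{t(\alpha)}$ for each $\alpha\in Q_1$; a morphism $\phi\colon X\to Y$ is a family of linear maps $\phi_i\colon X_i\to Y_i$ with $Y_\alpha\phi_{s(\alpha)}=\phi_{t(\alpha)}X_\alpha$ for all $\alpha$. Direct sums are taken vertexwise. $X$ is finite dimensional if all $X_i$ are, and then $\dim X=(\dim_k X_i)_{i\in Q_0}\in\mathbb Z^{Q_0}$. $X$ is indecomposable if $X\ne 0$ and $X=X_1\oplus X_2$ implies $X_1=0$ or $X_2=0$. Dynkin diagrams: $A_n$ ($n\ge1$): a path with $n$ vertices; $D_n$ ($n\ge4$): the tree with one branching vertex and three arms with $1,1,n-3$ further vertices; $E_6,E_7,E_8$: the trees with one branching vertex and three arms with $1,2,2$, respectively $1,2,3$, respectively $1,2,4$ further vertices. For a finite graph with vertices $1,\dots,n$ and $d_{ij}=d_{ji}$ edges joining $i$ and $j$,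 let $q\colon\mathbb Z^n\to\mathbb Z$, $q(x)=\sum_i x_i^2-\sum_{i\le j}d_{ij}x_ix_j$. A root is a non-zero $x\in\mathbb Z^n$ with $q(x)\le 1$; it is positive if $x_i\ge 0$ for all $i$. *)

theory Defs
  imports
    "HOL-Library.FuncSet"
    "Graph_Theory.Digraph"
    "Jordan_Normal_Form.Missing_VectorSpace"
begin

section \<open>Graphs and Dynkin diagrams\<close>

text \<open>A quiver is a \<open>fin_digraph\<close>: parallel arcs and loops are allowed there, and
  \<open>verts\<close>, \<open>arcs\<close>, \<open>tail\<close>, \<open>head\<close> are $Q_0$, $Q_1$, $s$, $t$.

  In an undirected multigraph, \<open>gmult G {i, j}\<close> is the number $d_{ij}$ of edges joining
  \<open>i\<close> and \<open>j\<close>; in particular \<open>gmult G {i}\<close> is the number of loops at \<open>i\<close>.\<close>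

record 'a multigraph =
  gverts :: "'a set"
  gmult :: "'a set \<Rightarrow> nat"

definition underlying_graph :: "('a, 'b) pre_digraph \<Rightarrow> 'a multigraph" where
  "underlying_graph Q =
     \<lparr>gverts = verts Q, gmult = (\<lambda>e. card {a \<in> arcs Q. {tail Q a, head Q a} = e})\<rparr>"

definition graph_isomorphic :: "'a multigraph \<Rightarrow> 'b multigraph \<Rightarrow> bool" where
  "graph_isomorphic G H \<longleftrightarrow>
     (\<exists>f. bij_betw f (gverts G) (gverts H) \<and>
          (\<forall>i\<in>gverts G. \<forall>j\<in>gverts G. gmult H {f i, f j} = gmult G {i, j}))"

definition simple_graph :: "'a set \<Rightarrow> 'a set set \<Rightarrow> 'a multigraph" where
  "simple_graph V E = \<lparr>gverts = V, gmult = (\<lambda>e. if e \<in> E then 1 else 0)\<rparr>"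

definition path_graph :: "nat \<Rightarrow> nat multigraph" where
  "path_graph n = simple_graph {1..n} {{i, Suc i} | i. 1 \<le> i \<and> i < n}"

text \<open>\<open>star_graph ls\<close> has a central vertex and, for each \<open>j < length ls\<close>, an arm of
  \<open>ls ! j\<close> further vertices; \<open>Arm j 0\<close> is the one adjacent to the centre.\<close>

datatype star_vertex = Centre | Arm nat nat

definition star_graph :: "nat list \<Rightarrow> star_vertex multigraph" where
  "star_graph ls = simple_graph
     (insert Centre {Arm j k | j k. j < length ls \<and> k < ls ! j})
     ({{Centre, Arm j 0} | j. j < length ls \<and> 0 < ls ! j} \<union>
      {{Arm j k, Arm j (Suc k)} | j k. j < length ls \<and> Suc k < ls ! j})"

definition dynkin_diagram :: "'a multigraph \<Rightarrow> bool" where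
  "dynkin_diagram G \<longleftrightarrow>
     (\<exists>n\<ge>1. graph_isomorphic (path_graph n) G) \<or>
     (\<exists>n\<ge>4. graph_isomorphic (star_graph [1, 1, n - 3]) G) \<or>
     (\<exists>m\<in>{2, 3, 4}. graph_isomorphic (star_graph [1, 2, m]) G)"

section \<open>The quadratic form and its roots\<close>

text \<open>The sum $\sum_{i\le j} d_{ij}x_ix_j$ runs over unordered pairs; it is split into the
  pairs with $i=j$ and the two-element subsets $\{i,j\}$, so that no ordering of the
  vertices is needed (see \<open>quadratic_form_ordered\<close> below).\<close>

definition quadratic_form :: "'a multigraph \<Rightarrow> ('a \<Rightarrow> int) \<Rightarrow> int" where
  "quadratic_form G x =
     (\<Sum>i\<in>gverts G. (x i)\<^sup>2) -
     ((\<Sum>i\<in>gverts G. int (gmult G {i}) * (x i)\<^sup>2) +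
      (\<Sum>e | e \<subseteq> gverts G \<and> card e = 2. int (gmult G e) * (\<Prod>i\<in>e. x i)))"

lemma quadratic_form_ordered:
  fixes G :: "'a::linorder multigraph"
  assumes "finite (gverts G)"
  shows "quadratic_form G x =
    (\<Sum>i\<in>gverts G. (x i)\<^sup>2) -
    (\<Sum>i\<in>gverts G. \<Sum>j | j \<in> gverts G \<and> i \<le> j. int (gmult G {i, j}) * x i * x j)"
proof -
  let ?V = "gverts G"
  let ?P = "Sigma ?V (\<lambda>i. {j \<in> ?V. i < j})"
  let ?h = "\<lambda>i j. int (gmult G {i, j}) * x i * x j"
  have "bij_betw (\<lambda>(i, j). {i, j}) ?P {e. e \<subseteq> ?V \<and> card e = 2}"
    unfolding bij_betw_def
  proof
    show "inj_on (\<lambda>(i, j). {i, j}) ?P"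
      by (auto simp: inj_on_def doubleton_eq_iff)
    show "(\<lambda>(i, j). {i, j}) ` ?P = {e. e \<subseteq> ?V \<and> card e = 2}" (is "?f ` _ = ?E")
    proof
      show "?f ` ?P \<subseteq> ?E" by auto
      show "?E \<subseteq> ?f ` ?P"
      proof
        fix e assume e: "e \<in> ?E"
        then obtain a b where ab: "e = {a, b}" "a \<noteq> b" by (auto simp: card_2_iff)
        have "e = ?f (min a b, max a b)" "(min a b, max a b) \<in> ?P"
          using ab e by (auto simp: min_def max_def)
        then show "e \<in> ?f ` ?P" by blast
      qed
    qed
  qed
  then have "(\<Sum>e | e \<subseteq> ?V \<and> card e = 2. int (gmult G e) * (\<Prod>i\<in>e. x i)) =
      (\<Sum>p\<in>?P. int (gmult G ((\<lambda>(i, j). {i, j}) p)) * (\<Prod>i\<in>(\<lambda>(i, j). {i, j}) p. x i))"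
    by (rule sum.reindex_bij_betw[symmetric])
  also have "\<dots> = (\<Sum>(i, j)\<in>?P. ?h i j)"
    by (rule sum.cong) (auto simp: algebra_simps)
  also have "\<dots> = (\<Sum>i\<in>?V. \<Sum>j | j \<in> ?V \<and> i < j. ?h i j)"
    using assms by (simp add: sum.Sigma)
  finally have off: "(\<Sum>e | e \<subseteq> ?V \<and> card e = 2. int (gmult G e) * (\<Prod>i\<in>e. x i)) =
    (\<Sum>i\<in>?V. \<Sum>j | j \<in> ?V \<and> i < j. ?h i j)" .
  have "(\<Sum>j | j \<in> ?V \<and> i \<le> j. ?h i j) = ?h i i + (\<Sum>j | j \<in> ?V \<and> i < j. ?h i j)"
    if "i \<in> ?V" for i
  proof -
    have "{j \<in> ?V. i \<le> j} = insert i {j \<in> ?V. i < j}" using that by auto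
    then show ?thesis using assms by simp
  qed
  then show ?thesis
    unfolding quadratic_form_def off
    by (simp add: sum.distrib power2_eq_square mult.assoc)
qed

text \<open>$\mathbb Z^{V}$ is rendered by the extensional functions on \<open>V\<close>.\<close>

definition roots :: "'a multigraph \<Rightarrow> ('a \<Rightarrow> int) set" where
  "roots G = {x \<in> gverts G \<rightarrow>\<^sub>E UNIV. x \<noteq> (\<lambda>i\<in>gverts G. 0) \<and> quadratic_form G x \<le> 1}"

definition positive_roots :: "'a multigraph \<Rightarrow> ('a \<Rightarrow> int) set" where
  "positive_roots G = {x \<in> roots G. \<forall>i\<in>gverts G. 0 \<le> x i}"

section \<open>Representations of quivers\<close>

record ('a, 'b, 'k, 'v) quiver_rep =
  rep_space :: "'a \<Rightarrow> ('k, 'v) module"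
  rep_map :: "'b \<Rightarrow> 'v \<Rightarrow> 'v"

definition representation ::
  "('k, 'm) ring_scheme \<Rightarrow> ('a, 'b) pre_digraph \<Rightarrow> ('a, 'b, 'k, 'v) quiver_rep \<Rightarrow> bool" where
  "representation K Q X \<longleftrightarrow>
     (\<forall>i\<in>verts Q. vectorspace K (rep_space X i)) \<and>
     (\<forall>a\<in>arcs Q. linear_map K (rep_space X (tail Q a)) (rep_space X (head Q a)) (rep_map X a))"

definition finite_dimensional ::
  "('k, 'm) ring_scheme \<Rightarrow> ('a, 'b) pre_digraph \<Rightarrow> ('a, 'b, 'k, 'v) quiver_rep \<Rightarrow> bool" where
  "finite_dimensional K Q X \<longleftrightarrow> (\<forall>i\<in>verts Q. vectorspace.fin_dim K (rep_space X i))"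

definition dim_vector ::
  "('k, 'm) ring_scheme \<Rightarrow> ('a, 'b) pre_digraph \<Rightarrow> ('a, 'b, 'k, 'v) quiver_rep \<Rightarrow> 'a \<Rightarrow> int" where
  "dim_vector K Q X = (\<lambda>i\<in>verts Q. int (vectorspace.dim K (rep_space X i)))"

definition rep_morphism ::
  "('k, 'm) ring_scheme \<Rightarrow> ('a, 'b) pre_digraph \<Rightarrow> ('a, 'b, 'k, 'v) quiver_rep \<Rightarrow>
   ('a, 'b, 'k, 'w) quiver_rep \<Rightarrow> ('a \<Rightarrow> 'v \<Rightarrow> 'w) \<Rightarrow> bool" where
  "rep_morphism K Q X Y \<phi> \<longleftrightarrow>
     (\<forall>i\<in>verts Q. linear_map K (rep_space X i) (rep_space Y i) (\<phi> i)) \<and>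
     (\<forall>a\<in>arcs Q. \<forall>v\<in>carrier (rep_space X (tail Q a)).
        rep_map Y a (\<phi> (tail Q a) v) = \<phi> (head Q a) (rep_map X a v))"

definition rep_isomorphic ::
  "('k, 'm) ring_scheme \<Rightarrow> ('a, 'b) pre_digraph \<Rightarrow> ('a, 'b, 'k, 'v) quiver_rep \<Rightarrow>
   ('a, 'b, 'k, 'w) quiver_rep \<Rightarrow> bool" where
  "rep_isomorphic K Q X Y \<longleftrightarrow>
     (\<exists>\<phi>. rep_morphism K Q X Y \<phi> \<and>
          (\<forall>i\<in>verts Q. bij_betw (\<phi> i) (carrier (rep_space X i)) (carrier (rep_space Y i))))"

definition rep_zero :: "('a, 'b) pre_digraph \<Rightarrow> ('a, 'b, 'k, 'v) quiver_rep \<Rightarrow> bool" where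
  "rep_zero Q X \<longleftrightarrow> (\<forall>i\<in>verts Q. carrier (rep_space X i) = {\<zero>\<^bsub>rep_space X i\<^esub>})"

definition rep_sum ::
  "('a, 'b, 'k, 'v) quiver_rep \<Rightarrow> ('a, 'b, 'k, 'w) quiver_rep \<Rightarrow>
   ('a, 'b, 'k, 'v \<times> 'w) quiver_rep" where
  "rep_sum X Y =
     \<lparr>rep_space = (\<lambda>i. direct_sum (rep_space X i) (rep_space Y i)),
      rep_map = (\<lambda>a. map_prod (rep_map X a) (rep_map Y a))\<rparr>"

text \<open>Decompositions are taken up to isomorphism. It is no restriction that the summands live
  on the same type \<open>'v\<close> as \<open>X\<close>: they embed into \<open>X\<close>.\<close>

definition indecomposable ::
  "('k, 'm) ring_scheme \<Rightarrow> ('a, 'b) pre_digraph \<Rightarrow> ('a, 'b, 'k, 'v) quiver_rep \<Rightarrow> bool" where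
  "indecomposable K Q X \<longleftrightarrow>
     \<not> rep_zero Q X \<and>
     (\<forall>(X\<^sub>1 :: ('a, 'b, 'k, 'v) quiver_rep) (X\<^sub>2 :: ('a, 'b, 'k, 'v) quiver_rep).
        representation K Q X\<^sub>1 \<and> representation K Q X\<^sub>2 \<and> rep_isomorphic K Q X (rep_sum X\<^sub>1 X\<^sub>2) \<longrightarrow>
        rep_zero Q X\<^sub>1 \<or> rep_zero Q X\<^sub>2)"

definition indecomposables ::
  "('k, 'm) ring_scheme \<Rightarrow> ('a, 'b) pre_digraph \<Rightarrow> ('a, 'b, 'k, 'v) quiver_rep set" where
  "indecomposables K Q =
     {X. representation K Q X \<and> finite_dimensional K Q X \<and> indecomposable K Q X}"

definition iso_rel ::
  "('k, 'm) ring_scheme \<Rightarrow> ('a, 'b) pre_digraph \<Rightarrow>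
   (('a, 'b, 'k, 'v) quiver_rep \<times> ('a, 'b, 'k, 'v) quiver_rep) set" where
  "iso_rel K Q = {(X, Y). X \<in> indecomposables K Q \<and> Y \<in> indecomposables K Q \<and>
                          rep_isomorphic K Q X Y}"

lemma rep_isomorphic_refl: "representation K Q X \<Longrightarrow> rep_isomorphic K Q X X"
  unfolding rep_isomorphic_def rep_morphism_def representation_def
  by (intro exI[of _ "\<lambda>i. id"])
    (auto simp: linear_map_def mod_hom_def mod_hom_axioms_def vectorspace_def module_hom_def)

lemma rep_isomorphic_trans:
  assumes "rep_isomorphic K Q X Y" "rep_isomorphic K Q Y Z" and Q: "wf_digraph Q"
  shows "rep_isomorphic K Q X Z"
proof -
  from assms obtain \<phi> \<psi> where
    \<phi>: "rep_morphism K Q X Y \<phi>"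
       "\<And>i. i \<in> verts Q \<Longrightarrow> bij_betw (\<phi> i) (carrier (rep_space X i)) (carrier (rep_space Y i))"
    and \<psi>: "rep_morphism K Q Y Z \<psi>"
       "\<And>i. i \<in> verts Q \<Longrightarrow> bij_betw (\<psi> i) (carrier (rep_space Y i)) (carrier (rep_space Z i))"
    by (auto simp: rep_isomorphic_def)
  have "linear_map K (rep_space X i) (rep_space Z i) (\<psi> i \<circ> \<phi> i)" if "i \<in> verts Q" for i
    using \<phi>(1) \<psi>(1) that unfolding rep_morphism_def
    by (auto simp: linear_map_def mod_hom_def mod_hom_axioms_def vectorspace_def module_hom_def
        Pi_iff)
  moreover have "rep_map Z a ((\<psi> (tail Q a) \<circ> \<phi> (tail Q a)) v) =
      (\<psi> (head Q a) \<circ> \<phi> (head Q a)) (rep_map X a v)"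
    if a: "a \<in> arcs Q" and v: "v \<in> carrier (rep_space X (tail Q a))" for a v
  proof -
    have "\<phi> (tail Q a) v \<in> carrier (rep_space Y (tail Q a))"
      using \<phi>(2) v wf_digraph.tail_in_verts[OF Q a] by (meson bij_betwE)
    then show ?thesis using \<phi>(1) \<psi>(1) a v by (simp add: rep_morphism_def)
  qed
  ultimately have "rep_morphism K Q X Z (\<lambda>i. \<psi> i \<circ> \<phi> i)"
    by (simp add: rep_morphism_def)
  moreover have "bij_betw (\<psi> i \<circ> \<phi> i) (carrier (rep_space X i)) (carrier (rep_space Z i))"
    if "i \<in> verts Q" for i
    using \<phi>(2) \<psi>(2) that by (blast intro: bij_betw_trans)
  ultimately show ?thesis unfolding rep_isomorphic_def
    by (intro exI[of _ "\<lambda>i. \<psi> i \<circ> \<phi> i"]) simp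
qed

lemma linear_map_inv_into:
  assumes f: "linear_map K V W f" and b: "bij_betw f (carrier V) (carrier W)"
  shows "linear_map K W V (inv_into (carrier V) f)"
proof -
  interpret linear_map K V W f by (rule f)
  let ?g = "inv_into (carrier V) f"
  have g: "?g w \<in> carrier V" "f (?g w) = w" if "w \<in> carrier W" for w
    using b that by (auto simp: bij_betw_def inv_into_into f_inv_into_f)
  have gf: "?g (f v) = v" if "v \<in> carrier V" for v
    using b that by (simp add: bij_betw_def)
  have "?g (x \<oplus>\<^bsub>W\<^esub> y) = ?g x \<oplus>\<^bsub>V\<^esub> ?g y" if "x \<in> carrier W" "y \<in> carrier W" for x y
    using gf[of "?g x \<oplus>\<^bsub>V\<^esub> ?g y"] that by (simp add: g)
  moreover have "?g (r \<odot>\<^bsub>W\<^esub> x) = r \<odot>\<^bsub>V\<^esub> ?g x" if "r \<in> carrier K" "x \<in> carrier W" for r x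
    using gf[of "r \<odot>\<^bsub>V\<^esub> ?g x"] that by (simp add: g)
  ultimately have "?g \<in> module_hom K W V"
    by (auto simp: module_hom_def g)
  then show ?thesis
    using f by (auto simp: linear_map_def mod_hom_def mod_hom_axioms_def)
qed

lemma rep_isomorphic_sym:
  assumes "rep_isomorphic K Q X Y" and Q: "wf_digraph Q" and X: "representation K Q X"
  shows "rep_isomorphic K Q Y X"
proof -
  from assms obtain \<phi> where
    \<phi>: "rep_morphism K Q X Y \<phi>"
    and b: "\<And>i. i \<in> verts Q \<Longrightarrow> bij_betw (\<phi> i) (carrier (rep_space X i)) (carrier (rep_space Y i))"
    by (auto simp: rep_isomorphic_def)
  define \<psi> where "\<psi> = (\<lambda>i. inv_into (carrier (rep_space X i)) (\<phi> i))"
  have "rep_map X a (\<psi> (tail Q a) w) = \<psi> (head Q a) (rep_map Y a w)"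
    if a: "a \<in> arcs Q" and w: "w \<in> carrier (rep_space Y (tail Q a))" for a w
  proof -
    have t: "tail Q a \<in> verts Q" and h: "head Q a \<in> verts Q"
      using Q a by (auto simp: wf_digraph_def)
    define v where "v = \<psi> (tail Q a) w"
    have v: "v \<in> carrier (rep_space X (tail Q a))" and wv: "w = \<phi> (tail Q a) v"
      using b[OF t] w by (auto simp: v_def \<psi>_def bij_betw_def inv_into_into f_inv_into_f)
    have "rep_map X a v \<in> carrier (rep_space X (head Q a))"
      using X a v
      by (auto simp: representation_def linear_map_def mod_hom_def mod_hom_axioms_def module_hom_def)
    then have "\<psi> (head Q a) (\<phi> (head Q a) (rep_map X a v)) = rep_map X a v"
      using b[OF h] by (simp add: \<psi>_def bij_betw_def)
    moreover have "rep_map Y a w = \<phi> (head Q a) (rep_map X a v)"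
      using \<phi> a v wv by (simp add: rep_morphism_def)
    ultimately show ?thesis by (simp add: v_def)
  qed
  moreover have "linear_map K (rep_space Y i) (rep_space X i) (\<psi> i)" if "i \<in> verts Q" for i
    using \<phi> b that unfolding \<psi>_def rep_morphism_def by (blast intro: linear_map_inv_into)
  ultimately have "rep_morphism K Q Y X \<psi>" by (simp add: rep_morphism_def)
  then show ?thesis unfolding rep_isomorphic_def
    using b by (auto simp: \<psi>_def intro!: exI[of _ \<psi>] bij_betw_inv_into)
qed

lemma equiv_iso_rel:
  assumes "wf_digraph Q"
  shows "equiv (indecomposables K Q) (iso_rel K Q)"
proof (rule equivI)
  show "iso_rel K Q \<subseteq> indecomposables K Q \<times> indecomposables K Q"
    by (auto simp: iso_rel_def)
  show "refl_on (indecomposables K Q) (iso_rel K Q)"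
    by (auto simp: refl_on_def iso_rel_def indecomposables_def rep_isomorphic_refl)
  show "sym (iso_rel K Q)"
    using assms by (auto simp: sym_def iso_rel_def indecomposables_def intro: rep_isomorphic_sym)
  show "trans (iso_rel K Q)"
    using assms by (auto simp: trans_def iso_rel_def intro: rep_isomorphic_trans)
qed

text \<open>A type \<open>'v\<close> contains a copy of every finite-dimensional vector space over \<open>K\<close> iff it
  contains a copy of every $K^n$. Some such condition is needed for the fixed type \<open>'v\<close>
  from which the vectors are drawn; \<open>'k list\<close> and \<open>nat \<Rightarrow> 'k\<close>, for instance, satisfy it
  for every \<open>K\<close>.\<close>

definition contains_coordinate_spaces ::
  "'v itself \<Rightarrow> ('k, 'm) ring_scheme \<Rightarrow> bool" where
  "contains_coordinate_spaces (_ :: 'v itself) K \<longleftrightarrow>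
     (\<forall>n. \<exists>f :: 'k list \<Rightarrow> 'v. inj_on f {xs. set xs \<subseteq> carrier K \<and> length xs = n})"

lemma contains_coordinate_spaces_list:
  "contains_coordinate_spaces TYPE('k list) (K :: ('k, 'm) ring_scheme)"
  unfolding contains_coordinate_spaces_def by (blast intro: inj_on_id)

lemma contains_coordinate_spaces_fun:
  "contains_coordinate_spaces TYPE(nat \<Rightarrow> 'k) (K :: ('k, 'm) ring_scheme)"
  unfolding contains_coordinate_spaces_def
proof
  fix n
  have "inj_on (\<lambda>xs i. xs ! i) {xs. set xs \<subseteq> carrier K \<and> length xs = n}"
    by (rule inj_onI) (auto intro: nth_equalityI dest: fun_cong)
  then show "\<exists>f :: 'k list \<Rightarrow> nat \<Rightarrow> 'k. inj_on f {xs. set xs \<subseteq> carrier K \<and> length xs = n}"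
    by blast
qed

end

theory Submission
  imports Defs Complex_Main
begin

text \<open>The proof uses the reflections of Bernstein, Gelfand and Ponomarev. Let \<open>i\<close> be a sink of \<open>Q\<close> and
let \<open>flip i Q\<close> be \<open>Q\<close> with the arrows at \<open>i\<close> reversed. A representation \<open>X\<close> of \<open>Q\<close> and a
representation \<open>Y\<close> of \<open>flip i Q\<close> are reflections of each other (\<open>reflected\<close>) if they coincide away
from \<open>i\<close> and there is an exact sequence
$0 \to Y_i \to \bigoplus_{a\colon j\to i} X_j \to X_i \to 0$ made of their structure maps. This
relation has three properties.

\<^item> Maps between kernels, or between cokernels, are induced by maps between the middle terms, so
  morphisms \<open>X \<rightarrow> X'\<close> and \<open>Y \<rightarrow> Y'\<close> correspond to each other bijectively, each being determined by
  its components away from \<open>i\<close>. Hence \<open>X \<cong> X'\<close> iff \<open>Y \<cong> Y'\<close> (\<open>reflected_isomorphic_iff\<close>). Since a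
  non-zero representation is indecomposable iff its only idempotent endomorphisms are 0 and 1,
  \<open>X\<close> is indecomposable iff \<open>Y\<close> is (\<open>reflected_trivial_idempotents_iff\<close>).
\<^item> Dimension vectors are related by the simple reflection $s_i$ (\<open>reflected_dim_vector\<close>), which
  preserves the quadratic form.
\<^item> An indecomposable representation has a reflection unless it is the simple representation at
  \<open>i\<close>: were $\bigoplus X_j \to X_i$ not onto, or $Y_i \to \bigoplus X_j$ not injective, a direct
  summand concentrated at \<open>i\<close> would split off and so be everything (\<open>exists_reflected_of_sink\<close>,
  \<open>exists_reflected_of_source\<close>).

So let $x \ge 0$ be given and apply simple reflections at successive sinks. As long as the vector
stays non-negative, the question whether there is an indecomposable representation of dimension
\<open>x\<close>, whether it is unique and whether $q(x) \le 1$, is carried unchanged to the next quiver. When the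
vector stops being non-negative, the last indecomposable representation can only have been simple,
and if $q \le 1$, then the last non-negative vector was indeed a coordinate vector. This is
\<open>classification_along_admissible\<close>.

That the vector does stop being non-negative is where the diagram enters. Completing squares along
the arms shows that \<open>q\<close> is positive definite with a bound on the coordinates
(\<open>coercive_dynkin\<close>). Hence only finitely many integral vectors have a given bound on \<open>q\<close>, and \<open>Q\<close>
has no oriented cycles, so that its vertices can be enumerated such that each becomes a sink when
its turn comes; after one round the orientation is the original one. The product of the simple
reflections in this order is the Coxeter transformation \<open>c\<close>. All its orbits are finite, and the
sum over a period is fixed by \<open>c\<close>, hence by every $s_i$, hence orthogonal to everything, hence
zero. So no non-zero vector has only non-negative images under the powers of \<open>c\<close>
(\<open>exists_admissible_negative\<close>).\<close>

section \<open>Linear maps, complements and copies of vector spaces\<close>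

lemma linear_mapI:
  assumes "vectorspace K V" "vectorspace K W"
    and "\<And>x. x \<in> carrier V \<Longrightarrow> T x \<in> carrier W"
    and "\<And>x y. \<lbrakk>x \<in> carrier V; y \<in> carrier V\<rbrakk> \<Longrightarrow> T (x \<oplus>\<^bsub>V\<^esub> y) = T x \<oplus>\<^bsub>W\<^esub> T y"
    and "\<And>r x. \<lbrakk>r \<in> carrier K; x \<in> carrier V\<rbrakk> \<Longrightarrow> T (r \<odot>\<^bsub>V\<^esub> x) = r \<odot>\<^bsub>W\<^esub> T x"
  shows "linear_map K V W T"
  using assms
  by (auto simp: linear_map_def mod_hom_def mod_hom_axioms_def module_hom_def vectorspace_def)

lemma linear_mapD:
  assumes "linear_map K V W T"
  shows "vectorspace K V" "vectorspace K W"
    and "\<And>x. x \<in> carrier V \<Longrightarrow> T x \<in> carrier W"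
    and "\<And>x y. \<lbrakk>x \<in> carrier V; y \<in> carrier V\<rbrakk> \<Longrightarrow> T (x \<oplus>\<^bsub>V\<^esub> y) = T x \<oplus>\<^bsub>W\<^esub> T y"
    and "\<And>r x. \<lbrakk>r \<in> carrier K; x \<in> carrier V\<rbrakk> \<Longrightarrow> T (r \<odot>\<^bsub>V\<^esub> x) = r \<odot>\<^bsub>W\<^esub> T x"
    and "\<And>x y. \<lbrakk>x \<in> carrier V; y \<in> carrier V\<rbrakk> \<Longrightarrow> T (x \<ominus>\<^bsub>V\<^esub> y) = T x \<ominus>\<^bsub>W\<^esub> T y"
    and "T \<zero>\<^bsub>V\<^esub> = \<zero>\<^bsub>W\<^esub>"
proof -
  interpret linear_map K V W T by fact
  show "vectorspace K V" "vectorspace K W" by unfold_locales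
qed (use assms in \<open>auto simp: linear_map_def mod_hom.f_minus mod_hom.f0_is_0
        mod_hom.f_im dest: mod_hom.f_hom[THEN module_hom_add] mod_hom.f_hom[THEN module_hom_smult]\<close>)

lemma linear_map_comp:
  assumes "linear_map K U V S" "linear_map K V W T"
  shows "linear_map K U W (T \<circ> S)"
  by (rule linear_mapI) (simp_all add: linear_mapD[OF assms(1)] linear_mapD[OF assms(2)])

lemma linear_map_zero:
  assumes "vectorspace K V" "vectorspace K W"
  shows "linear_map K V W (\<lambda>x. \<zero>\<^bsub>W\<^esub>)"
proof -
  interpret V: vectorspace K V by fact
  interpret W: vectorspace K W by fact
  show ?thesis by (rule linear_mapI) (auto intro: V.vectorspace_axioms W.vectorspace_axioms)
qed

lemma linear_map_id:
  assumes "vectorspace K V"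
  shows "linear_map K V V (\<lambda>x. x)"
  by (rule linear_mapI) (auto simp: assms)

lemma linear_map_id_minus:
  assumes "linear_map K V V p"
  shows "linear_map K V V (\<lambda>x. x \<ominus>\<^bsub>V\<^esub> p x)"
proof -
  interpret linear_map K V V p by fact
  show ?thesis
  proof (rule linear_mapI)
    fix x y assume [simp]: "x \<in> carrier V" "y \<in> carrier V"
    have "p x \<in> carrier V" "p y \<in> carrier V" by auto
    then show "x \<oplus>\<^bsub>V\<^esub> y \<ominus>\<^bsub>V\<^esub> p (x \<oplus>\<^bsub>V\<^esub> y) = x \<ominus>\<^bsub>V\<^esub> p x \<oplus>\<^bsub>V\<^esub> (y \<ominus>\<^bsub>V\<^esub> p y)"
      by (simp add: V.module.M.minus_eq V.module.M.minus_add V.module.M.add.m_ac)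
  next
    fix r x assume [simp]: "r \<in> carrier K" "x \<in> carrier V"
    have "p x \<in> carrier V" by auto
    then show "r \<odot>\<^bsub>V\<^esub> x \<ominus>\<^bsub>V\<^esub> p (r \<odot>\<^bsub>V\<^esub> x) = r \<odot>\<^bsub>V\<^esub> (x \<ominus>\<^bsub>V\<^esub> p x)"
      by (simp add: V.module.M.minus_eq V.module.smult_r_distr V.module.smult_r_minus)
  qed (auto intro: V.vectorspace_axioms)
qed

lemma linear_map_to_subspace:
  assumes "linear_map K V W T" "submodule K N W" "\<And>x. x \<in> carrier V \<Longrightarrow> T x \<in> N"
  shows "linear_map K V (W\<lparr>carrier := N\<rparr>) T"
proof -
  interpret linear_map K V W T by fact
  have "vectorspace K (W\<lparr>carrier := N\<rparr>)"
    using W.subspace_is_vs assms(2) by (simp add: subspace_def W.vectorspace_axioms)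
  then show ?thesis
    by (intro linear_mapI) (use assms(3) in \<open>auto intro: V.vectorspace_axioms\<close>)
qed

lemma linear_map_from_subspace:
  assumes "linear_map K V W T" "submodule K N V"
  shows "linear_map K (V\<lparr>carrier := N\<rparr>) W T"
proof -
  interpret linear_map K V W T by fact
  have "vectorspace K (V\<lparr>carrier := N\<rparr>)"
    using V.subspace_is_vs assms(2) by (simp add: subspace_def V.vectorspace_axioms)
  then show ?thesis
    using submodule.subset[OF assms(2)]
    by (intro linear_mapI) (auto intro: W.vectorspace_axioms dest: subsetD
        simp: subset_iff)
qed

text \<open>The generators are treated one by one. If a generator \<open>v\<close> is not in \<open>N + C\<close>, then \<open>C\<close> may be
enlarged by the line through \<open>v\<close>: a relation \<open>c + r v \<in> N\<close> with \<open>r \<noteq> 0\<close> could be solved for \<open>v\<close>.\<close>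

lemma (in vectorspace) subspace_complement_of_finite:
  assumes "submodule K N V" "finite A" "A \<subseteq> carrier V"
  shows "\<exists>C. submodule K C V \<and> C \<inter> N = {\<zero>\<^bsub>V\<^esub>} \<and> A \<subseteq> submodule_sum N C"
  using assms(2,3)
proof (induction A rule: finite_induct)
  case empty
  have "submodule K {\<zero>\<^bsub>V\<^esub>} V" by (rule submodule.intro) (auto intro: module_axioms)
  then show ?case using submodule.zero_closed[OF assms(1)] by (intro exI[of _ "{\<zero>\<^bsub>V\<^esub>}"]) auto
next
  case (insert v A)
  have sumI: "n \<oplus>\<^bsub>V\<^esub> c \<in> submodule_sum N C" if "n \<in> N" "c \<in> C" for n c C
    using that by (auto simp: submodule_sum_def)
  from insert obtain C where C: "submodule K C V" "C \<inter> N = {\<zero>\<^bsub>V\<^esub>}" "A \<subseteq> submodule_sum N C" by auto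
  interpret N: submodule K N V by fact
  interpret C: submodule K C V by fact
  show ?case
  proof (cases "v \<in> submodule_sum N C")
    case True with C show ?thesis by (intro exI[of _ C]) auto
  next
    case False
    have v: "v \<in> carrier V" using insert by auto
    define D where "D = {c \<oplus>\<^bsub>V\<^esub> r \<odot>\<^bsub>V\<^esub> v | c r. c \<in> C \<and> r \<in> carrier K}"
    have DI: "c \<oplus>\<^bsub>V\<^esub> r \<odot>\<^bsub>V\<^esub> v \<in> D" if "c \<in> C" "r \<in> carrier K" for c r
      using that by (auto simp: D_def)
    have Cc: "c \<in> carrier V" if "c \<in> C" for c using that C.subset by auto
    have Nc: "c \<in> carrier V" if "c \<in> N" for c using that N.subset by auto
    have D: "submodule K D V"
    proof (rule submodule.intro)
      show "module K V" by (rule module_axioms)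
      show "D \<subseteq> carrier V" using v Cc by (auto simp: D_def)
      show "\<zero>\<^bsub>V\<^esub> \<in> D" using DI[of "\<zero>\<^bsub>V\<^esub>" "\<zero>\<^bsub>K\<^esub>"] v by (simp add: lmult_0)
      fix x y assume "x \<in> D" "y \<in> D"
      then obtain c r d s where x: "x = c \<oplus>\<^bsub>V\<^esub> r \<odot>\<^bsub>V\<^esub> v" "c \<in> C" "r \<in> carrier K"
        and y: "y = d \<oplus>\<^bsub>V\<^esub> s \<odot>\<^bsub>V\<^esub> v" "d \<in> C" "s \<in> carrier K" by (auto simp: D_def)
      have "x \<oplus>\<^bsub>V\<^esub> y = (c \<oplus>\<^bsub>V\<^esub> d) \<oplus>\<^bsub>V\<^esub> (r \<oplus>\<^bsub>K\<^esub> s) \<odot>\<^bsub>V\<^esub> v"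
        using x y v Cc by (simp add: smult_l_distr M.add.m_ac)
      then show "x \<oplus>\<^bsub>V\<^esub> y \<in> D" using DI x y by auto
    next
      fix t x assume t: "t \<in> carrier K" and "x \<in> D"
      then obtain c r where x: "x = c \<oplus>\<^bsub>V\<^esub> r \<odot>\<^bsub>V\<^esub> v" "c \<in> C" "r \<in> carrier K"
        by (auto simp: D_def)
      have "t \<odot>\<^bsub>V\<^esub> x = t \<odot>\<^bsub>V\<^esub> c \<oplus>\<^bsub>V\<^esub> (t \<otimes>\<^bsub>K\<^esub> r) \<odot>\<^bsub>V\<^esub> v"
        using x t v Cc by (simp add: smult_r_distr smult_assoc1)
      then show "t \<odot>\<^bsub>V\<^esub> x \<in> D" using DI x t by auto
    qed
    have CD: "C \<subseteq> D" using DI[of _ "\<zero>\<^bsub>K\<^esub>"] v Cc by (fastforce simp: lmult_0)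
    have vD: "v \<in> D" using DI[of "\<zero>\<^bsub>V\<^esub>" "\<one>\<^bsub>K\<^esub>"] v by simp
    have "x = \<zero>\<^bsub>V\<^esub>" if xD: "x \<in> D" "x \<in> N" for x
    proof -
      obtain c r where x: "x = c \<oplus>\<^bsub>V\<^esub> r \<odot>\<^bsub>V\<^esub> v" "c \<in> C" "r \<in> carrier K"
        using xD(1) unfolding D_def by blast
      show ?thesis
      proof (cases "r = \<zero>\<^bsub>K\<^esub>")
        case True
        then have "x = c" using x(1) v Cc[OF x(2)] by (simp add: lmult_0)
        then show ?thesis using C(2) xD(2) x(2) by blast
      next
        case False
        then have inv: "inv\<^bsub>K\<^esub> r \<in> carrier K" "inv\<^bsub>K\<^esub> r \<otimes>\<^bsub>K\<^esub> r = \<one>\<^bsub>K\<^esub>"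
          using x(3) by (simp_all add: field_Units)
        have "r \<odot>\<^bsub>V\<^esub> v = x \<oplus>\<^bsub>V\<^esub> (\<ominus>\<^bsub>K\<^esub> \<one>\<^bsub>K\<^esub>) \<odot>\<^bsub>V\<^esub> c"
          unfolding x(1) using x(2,3) v Cc[OF x(2)]
          by (simp add: smult_minus_1 M.add.m_comm[of c "r \<odot>\<^bsub>V\<^esub> v"] M.add.m_assoc M.r_neg)
        then have "inv\<^bsub>K\<^esub> r \<odot>\<^bsub>V\<^esub> (r \<odot>\<^bsub>V\<^esub> v) = inv\<^bsub>K\<^esub> r \<odot>\<^bsub>V\<^esub> x \<oplus>\<^bsub>V\<^esub> inv\<^bsub>K\<^esub> r \<odot>\<^bsub>V\<^esub> ((\<ominus>\<^bsub>K\<^esub> \<one>\<^bsub>K\<^esub>) \<odot>\<^bsub>V\<^esub> c)"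
          using inv(1) Cc[OF x(2)] Nc[OF xD(2)] by (simp add: smult_r_distr)
        then have "v = inv\<^bsub>K\<^esub> r \<odot>\<^bsub>V\<^esub> x \<oplus>\<^bsub>V\<^esub> inv\<^bsub>K\<^esub> r \<odot>\<^bsub>V\<^esub> ((\<ominus>\<^bsub>K\<^esub> \<one>\<^bsub>K\<^esub>) \<odot>\<^bsub>V\<^esub> c)"
          using inv v x(3) by (simp flip: smult_assoc1)
        moreover have "inv\<^bsub>K\<^esub> r \<odot>\<^bsub>V\<^esub> x \<in> N" using inv xD by auto
        moreover have "inv\<^bsub>K\<^esub> r \<odot>\<^bsub>V\<^esub> ((\<ominus>\<^bsub>K\<^esub> \<one>\<^bsub>K\<^esub>) \<odot>\<^bsub>V\<^esub> c) \<in> C" using inv x by auto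
        ultimately have "v \<in> submodule_sum N C" by (metis sumI)
        with False \<open>v \<notin> submodule_sum N C\<close> show ?thesis by blast
      qed
    qed
    then have "D \<inter> N = {\<zero>\<^bsub>V\<^esub>}" using submodule.zero_closed[OF D] N.zero_closed by blast
    moreover have "v \<in> submodule_sum N D"
      using sumI[OF N.zero_closed vD] v by simp
    moreover have "A \<subseteq> submodule_sum N D" using C(3) CD by (auto simp: submodule_sum_def)
    ultimately show ?thesis using D by auto
  qed
qed

text \<open>Idempotent endomorphisms take the place of direct sum decompositions below. At a single vertex they
are obtained as projections along a complement.\<close>

lemma (in vectorspace) projection_onto_subspace:
  assumes "fin_dim" "submodule K N V"
  obtains p where "linear_map K V V p" "\<And>v. v \<in> carrier V \<Longrightarrow> p v \<in> N" "\<And>n. n \<in> N \<Longrightarrow> p n = n"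
proof -
  interpret N: submodule K N V by fact
  obtain A where A: "finite A" "A \<subseteq> carrier V" "gen_set A" using assms(1) by (auto simp: fin_dim_def)
  obtain C where C: "submodule K C V" "C \<inter> N = {\<zero>\<^bsub>V\<^esub>}" "A \<subseteq> submodule_sum N C"
    using subspace_complement_of_finite[OF assms(2) A(1,2)] by auto
  interpret C: submodule K C V by fact
  have Cc: "c \<in> carrier V" if "c \<in> C" for c using that C.subset by auto
  have Nc: "c \<in> carrier V" if "c \<in> N" for c using that N.subset by auto
  have ex: "\<exists>n. n \<in> N \<and> (\<exists>c\<in>C. v = n \<oplus>\<^bsub>V\<^esub> c)" if "v \<in> carrier V" for v
  proof -
    have "span A \<subseteq> submodule_sum N C"
      by (rule span_is_subset[OF C(3) sum_is_submodule[OF assms(2) C(1)]])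
    then have "v \<in> submodule_sum N C" using A(3) that by auto
    then show ?thesis by (auto simp: submodule_sum_def)
  qed
  have uniq: "n = m" if "n \<in> N" "m \<in> N" "c \<in> C" "d \<in> C" "n \<oplus>\<^bsub>V\<^esub> c = m \<oplus>\<^bsub>V\<^esub> d" for n m c d
  proof -
    have neg: "\<ominus>\<^bsub>V\<^esub> x = (\<ominus>\<^bsub>K\<^esub> \<one>\<^bsub>K\<^esub>) \<odot>\<^bsub>V\<^esub> x" if "x \<in> carrier V" for x
      using that by (simp add: smult_minus_1)
    have "n \<oplus>\<^bsub>V\<^esub> \<ominus>\<^bsub>V\<^esub> m = d \<oplus>\<^bsub>V\<^esub> \<ominus>\<^bsub>V\<^esub> c"
      using that(5) Nc[OF that(1)] Nc[OF that(2)] Cc[OF that(3)] Cc[OF that(4)]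
      by (smt (verit) M.add.inv_solve_right M.add.inv_closed M.add.m_assoc M.add.m_closed M.add.m_comm)
    moreover have "n \<oplus>\<^bsub>V\<^esub> \<ominus>\<^bsub>V\<^esub> m \<in> N" using that(1,2) Nc by (auto simp: neg)
    moreover have "d \<oplus>\<^bsub>V\<^esub> \<ominus>\<^bsub>V\<^esub> c \<in> C" using that(3,4) Cc by (auto simp: neg)
    ultimately have "n \<oplus>\<^bsub>V\<^esub> \<ominus>\<^bsub>V\<^esub> m = \<zero>\<^bsub>V\<^esub>" using C(2) by auto
    then show ?thesis using that(1,2) Nc by (metis M.minus_equality M.add.inv_closed M.minus_minus)
  qed
  define p where "p v = (SOME n. n \<in> N \<and> (\<exists>c\<in>C. v = n \<oplus>\<^bsub>V\<^esub> c))" for v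
  have p1: "p v \<in> N" "\<exists>c\<in>C. v = p v \<oplus>\<^bsub>V\<^esub> c" if "v \<in> carrier V" for v
    using someI_ex[OF ex[OF that]] by (auto simp: p_def)
  have p2: "p v = n" if "n \<in> N" "c \<in> C" "v = n \<oplus>\<^bsub>V\<^esub> c" for v n c
  proof -
    have "v \<in> carrier V" using that Nc Cc by auto
    from p1[OF this] obtain d where "p v \<in> N" "d \<in> C" "v = p v \<oplus>\<^bsub>V\<^esub> d" by auto
    then show ?thesis using uniq[of "p v" n d c] that by auto
  qed
  show thesis
  proof
    show "linear_map K V V p"
    proof (rule linear_mapI)
      show "p x \<in> carrier V" if "x \<in> carrier V" for x using p1[OF that] Nc by auto
      fix x y assume "x \<in> carrier V" "y \<in> carrier V"
      then obtain c d where c: "c \<in> C" "x = p x \<oplus>\<^bsub>V\<^esub> c" and d: "d \<in> C" "y = p y \<oplus>\<^bsub>V\<^esub> d"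
        and n: "p x \<in> N" "p y \<in> N"
        using p1 by meson
      have "x \<oplus>\<^bsub>V\<^esub> y = (p x \<oplus>\<^bsub>V\<^esub> p y) \<oplus>\<^bsub>V\<^esub> (c \<oplus>\<^bsub>V\<^esub> d)"
        by (subst c(2), subst d(2)) (use c(1) d(1) n Nc Cc in \<open>simp add: M.add.m_ac\<close>)
      then show "p (x \<oplus>\<^bsub>V\<^esub> y) = p x \<oplus>\<^bsub>V\<^esub> p y"
        by (intro p2[of _ "c \<oplus>\<^bsub>V\<^esub> d"]) (use n c(1) d(1) in auto)
    next
      fix r x assume r: "r \<in> carrier K" and "x \<in> carrier V"
      then obtain c where c: "c \<in> C" "x = p x \<oplus>\<^bsub>V\<^esub> c" and n: "p x \<in> N"
        using p1 by meson
      have "r \<odot>\<^bsub>V\<^esub> x = r \<odot>\<^bsub>V\<^esub> p x \<oplus>\<^bsub>V\<^esub> r \<odot>\<^bsub>V\<^esub> c"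
        by (subst c(2)) (use c(1) n Nc Cc r in \<open>simp add: smult_r_distr\<close>)
      then show "p (r \<odot>\<^bsub>V\<^esub> x) = r \<odot>\<^bsub>V\<^esub> p x"
        by (intro p2[of _ "r \<odot>\<^bsub>V\<^esub> c"]) (use n c(1) r in auto)
    qed (auto intro: vectorspace_axioms)
    show "p v \<in> N" if "v \<in> carrier V" for v using p1[OF that] by auto
    show "p n = n" if "n \<in> N" for n using p2[of n "\<zero>\<^bsub>V\<^esub>" n] that Nc by auto
  qed
qed


text \<open>Kernels and quotients of spaces of tuples do not consist of elements of the type of vectors that
a representation is built from. They have to be copied to that type.\<close>

lemma transport_vectorspace:
  fixes V :: "('k, 'u) module" and g :: "'u \<Rightarrow> 'v"
  assumes "vectorspace K V" "inj_on g (carrier V)"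
  obtains W :: "('k, 'v) module"
  where "linear_map K V W g" "bij_betw g (carrier V) (carrier W)"
proof -
  interpret vectorspace K V by fact
  let ?h = "inv_into (carrier V) g"
  define W where "W = \<lparr>carrier = g ` carrier V, mult = (\<lambda>x y. g \<zero>\<^bsub>V\<^esub>), one = g \<zero>\<^bsub>V\<^esub>,
    zero = g \<zero>\<^bsub>V\<^esub>, add = (\<lambda>x y. g (?h x \<oplus>\<^bsub>V\<^esub> ?h y)), smult = (\<lambda>r x. g (r \<odot>\<^bsub>V\<^esub> ?h x))\<rparr>"
  have h[simp]: "?h (g x) = x" if "x \<in> carrier V" for x using assms(2) that by simp
  have [simp]: "g x \<oplus>\<^bsub>W\<^esub> g y = g (x \<oplus>\<^bsub>V\<^esub> y)" if "x \<in> carrier V" "y \<in> carrier V" for x y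
    using that by (simp add: W_def)
  have [simp]: "r \<odot>\<^bsub>W\<^esub> g x = g (r \<odot>\<^bsub>V\<^esub> x)" if "x \<in> carrier V" for x r
    using that by (simp add: W_def)
  have cW[simp]: "carrier W = g ` carrier V" "\<zero>\<^bsub>W\<^esub> = g \<zero>\<^bsub>V\<^esub>" by (simp_all add: W_def)
  have "vectorspace K W"
  proof (rule vs_criteria)
    show "field K" by unfold_locales
    show "\<forall>v\<in>carrier W. \<exists>w\<in>carrier W. v \<oplus>\<^bsub>W\<^esub> w = \<zero>\<^bsub>W\<^esub>"
    proof
      fix v assume "v \<in> carrier W"
      then obtain x where x: "x \<in> carrier V" "v = g x" by auto
      then have "v \<oplus>\<^bsub>W\<^esub> g (\<ominus>\<^bsub>V\<^esub> x) = \<zero>\<^bsub>W\<^esub>" by (simp add: M.r_neg)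
      then show "\<exists>w\<in>carrier W. v \<oplus>\<^bsub>W\<^esub> w = \<zero>\<^bsub>W\<^esub>" using x by force
    qed
  qed (auto simp: M.add.m_ac smult_l_distr smult_r_distr smult_assoc1)
  then have "linear_map K V W g"
    by (intro linear_mapI) (auto intro: vectorspace_axioms)
  then show thesis using assms(2) that by (auto simp: bij_betw_def)
qed

text \<open>Choosing for every vector one list of coefficients with respect to a finite generating set
embeds the space into a coordinate space.\<close>

lemma transport_fin_dim:
  fixes V :: "('k, 'u) module"
  assumes "vectorspace K V" "vectorspace.fin_dim K V"
    and "contains_coordinate_spaces TYPE('v) K"
  obtains W :: "('k, 'v) module" and g
  where "linear_map K V W g" "bij_betw g (carrier V) (carrier W)"
proof -
  interpret vectorspace K V by fact
  obtain A where A: "finite A" "A \<subseteq> carrier V" "gen_set A" using assms(2) by (auto simp: fin_dim_def)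
  obtain as where as: "set as = A" "distinct as" using finite_distinct_list[OF A(1)] by auto
  obtain f :: "'k list \<Rightarrow> 'v" where f: "inj_on f {xs. set xs \<subseteq> carrier K \<and> length xs = length as}"
    using assms(3) by (auto simp: contains_coordinate_spaces_def)
  have "\<exists>a. a \<in> A \<rightarrow> carrier K \<and> lincomb a A = v" if "v \<in> carrier V" for v
    using finite_in_span[OF A(1,2)] A(3) that by auto
  then obtain a where a: "\<And>v. v \<in> carrier V \<Longrightarrow> a v \<in> A \<rightarrow> carrier K \<and> lincomb (a v) A = v"
    by metis
  have "inj_on (\<lambda>v. f (map (a v) as)) (carrier V)"
  proof (rule inj_onI)
    fix v w assume v: "v \<in> carrier V" and w: "w \<in> carrier V" and eq: "f (map (a v) as) = f (map (a w) as)"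
    have "map (a v) as = map (a w) as"
      by (rule inj_onD[OF f eq]) (use a[OF v] a[OF w] as in auto)
    then have "a v x = a w x" if "x \<in> A" for x using that as by auto
    then have "lincomb (a v) A = lincomb (a w) A"
      using lincomb_cong[of A A "a v" "a w"] A(2) a[OF w] by auto
    then show "v = w" using a v w by auto
  qed
  from transport_vectorspace[OF assms(1) this] show thesis using that by metis
qed

section \<open>Exact sequences\<close>

lemma linear_map_image_submodule:
  assumes "linear_map K V W T" "submodule K N V"
  shows "submodule K (T ` N) W"
proof -
  interpret linear_map K V W T by fact
  interpret N: submodule K N V by fact
  show ?thesis
  proof (rule submodule.intro)
    show "module K W" by unfold_locales
    show "T ` N \<subseteq> carrier W" using N.subset by auto
    show "\<zero>\<^bsub>W\<^esub> \<in> T ` N" using N.zero_closed T0_is_0 by (metis imageI)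
    fix x y assume "x \<in> T ` N" "y \<in> T ` N"
    then obtain v w where "x = T v" "v \<in> N" "y = T w" "w \<in> N" by auto
    moreover have "T (v \<oplus>\<^bsub>V\<^esub> w) = T v \<oplus>\<^bsub>W\<^esub> T w"
      using calculation N.subset by (auto simp: subset_iff)
    ultimately show "x \<oplus>\<^bsub>W\<^esub> y \<in> T ` N" by (metis N.m_closed imageI)
  next
    fix r x assume "r \<in> carrier K" "x \<in> T ` N"
    moreover then obtain v where "x = T v" "v \<in> N" by auto
    moreover have "T (r \<odot>\<^bsub>V\<^esub> v) = r \<odot>\<^bsub>W\<^esub> T v"
      using calculation N.subset by (auto simp: subset_iff)
    ultimately show "r \<odot>\<^bsub>W\<^esub> x \<in> T ` N" by (metis N.smult_closed imageI)
  qed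
qed

text \<open>Generators of \<open>U\<close> together with preimages of generators of \<open>W\<close> generate \<open>V\<close>.\<close>

lemma exact_sequence_fin_dim:
  assumes i: "linear_map K U V i" and p: "linear_map K V W p"
    and surj: "p ` carrier V = carrier W"
    and exact: "\<And>v. v \<in> carrier V \<Longrightarrow> p v = \<zero>\<^bsub>W\<^esub> \<Longrightarrow> v \<in> i ` carrier U"
    and "vectorspace.fin_dim K U" "vectorspace.fin_dim K W"
  shows "vectorspace.fin_dim K V"
proof -
  interpret i: linear_map K U V i by fact
  interpret p: linear_map K V W p by fact
  have Um: "module K U" and Vm: "module K V" and Wm: "module K W" by unfold_locales
  obtain A where A: "finite A" "A \<subseteq> carrier U" "module.span K U A = carrier U"
    using assms by (auto simp: i.V.fin_dim_def)
  obtain B' where B': "finite B'" "B' \<subseteq> carrier W" "module.span K W B' = carrier W"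
    using assms by (auto simp: p.W.fin_dim_def)
  obtain B where B: "finite B" "B \<subseteq> carrier V" "p ` B = B'"
    using finite_subset_image[OF B'(1), of p "carrier V"] B'(2) surj by metis
  define S where "S = module.span K V (i ` A \<union> B)"
  have sub: "i ` A \<union> B \<subseteq> carrier V" using A B by auto
  have S: "submodule K S V" unfolding S_def by (rule module.span_is_submodule[OF Vm sub])
  interpret S: submodule K S V by fact
  have SV: "S \<subseteq> carrier V" by (rule S.subset)
  have AB: "i ` A \<union> B \<subseteq> S" unfolding S_def by (rule module.in_own_span[OF Vm sub])
  have "submodule K {u \<in> carrier U. i u \<in> S} U"
    by (rule submodule.intro) (auto intro: Um)
  then have "module.span K U A \<subseteq> {u \<in> carrier U. i u \<in> S}"
    by (rule module.span_is_subset[OF Um, rotated]) (use A AB in auto)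
  then have iS: "i u \<in> S" if "u \<in> carrier U" for u using A(3) that by auto
  have "module.span K W B' \<subseteq> p ` S"
    by (rule module.span_is_subset[OF Wm _ linear_map_image_submodule[OF p S]]) (use B AB in auto)
  then have pS: "\<exists>s\<in>S. w = p s" if "w \<in> carrier W" for w using B'(3) that by auto
  have "carrier V \<subseteq> S"
  proof
    fix v assume v: "v \<in> carrier V"
    then obtain s where s: "s \<in> S" "p v = p s" using pS[of "p v"] by auto
    have sV: "s \<in> carrier V" using s SV by auto
    have "p (v \<ominus>\<^bsub>V\<^esub> s) = \<zero>\<^bsub>W\<^esub>" using v sV s by (simp add: p.W.module.M.r_neg p.W.module.M.minus_eq)
    then obtain u where u: "u \<in> carrier U" "v \<ominus>\<^bsub>V\<^esub> s = i u" using exact[of "v \<ominus>\<^bsub>V\<^esub> s"] v sV by auto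
    have "v = i u \<oplus>\<^bsub>V\<^esub> s"
      unfolding u(2)[symmetric] using v sV
      by (simp add: i.W.module.M.minus_eq i.W.module.M.add.m_assoc i.W.module.M.l_neg)
    then show "v \<in> S" using iS[OF u(1)] s by auto
  qed
  then show ?thesis
    unfolding i.W.fin_dim_def using A B sub SV by (intro exI[of _ "i ` A \<union> B"]) (auto simp: S_def)
qed

lemma exact_sequence_dim:
  assumes i: "linear_map K U V i" and p: "linear_map K V W p"
    and inj: "inj_on i (carrier U)" and surj: "p ` carrier V = carrier W"
    and exact: "\<And>v. v \<in> carrier V \<Longrightarrow> p v = \<zero>\<^bsub>W\<^esub> \<longleftrightarrow> v \<in> i ` carrier U"
    and fin: "vectorspace.fin_dim K U" "vectorspace.fin_dim K V"
  shows "vectorspace.dim K V = vectorspace.dim K U + vectorspace.dim K W"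
proof -
  interpret i: linear_map K U V i by fact
  interpret p: linear_map K V W p by fact
  have ker: "p.kerT = i ` carrier U" using exact i.T_im by (auto simp: p.ker_def)
  have "linear_map K U (V\<lparr>carrier := p.kerT\<rparr>) i"
    by (rule linear_map_to_subspace[OF i p.ker_is_submodule]) (simp add: ker)
  then interpret j: linear_map K U "V\<lparr>carrier := p.kerT\<rparr>" i .
  have "vectorspace.dim K U = vectorspace.dim K (V\<lparr>carrier := p.kerT\<rparr>)"
    by (rule j.dim_eq[OF fin(1) inj]) (simp add: ker)
  then show ?thesis using p.rank_nullity[OF fin(2)] surj by (simp add: p.im_def)
qed

text \<open>A subspace is also an image, namely of a projection, and images inherit finite generation.\<close>

lemma exact_sequence_kernel_fin_dim:
  assumes i: "linear_map K U V i" and inj: "inj_on i (carrier U)"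
    and fin: "vectorspace.fin_dim K V"
  shows "vectorspace.fin_dim K U"
proof -
  interpret i: linear_map K U V i by fact
  have N: "submodule K i.imT V" by (rule i.im_is_submodule)
  obtain p where p: "linear_map K V V p" "\<And>v. v \<in> carrier V \<Longrightarrow> p v \<in> i.imT" "\<And>n. n \<in> i.imT \<Longrightarrow> p n = n"
    using i.W.projection_onto_subspace[OF fin N] by metis
  interpret p: linear_map K V "V\<lparr>carrier := i.imT\<rparr>" p
    by (rule linear_map_to_subspace[OF p(1) N p(2)])
  have "p ` carrier V = carrier (V\<lparr>carrier := i.imT\<rparr>)"
    using p(2,3) submodule.subset[OF N] by (auto simp: image_iff) (metis subsetD)
  then have fin': "p.W.fin_dim" by (rule p.surj_fin_dim[OF fin])
  have j: "linear_map K U (V\<lparr>carrier := i.imT\<rparr>) i"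
    by (rule linear_map_to_subspace[OF i N]) (auto simp: i.im_def)
  have b: "bij_betw i (carrier U) (carrier (V\<lparr>carrier := i.imT\<rparr>))"
    using inj by (auto simp: bij_betw_def i.im_def)
  interpret q: linear_map K "V\<lparr>carrier := i.imT\<rparr>" U "inv_into (carrier U) i"
    by (rule linear_map_inv_into[OF j b])
  show ?thesis
    by (rule q.surj_fin_dim[OF fin']) (use bij_betw_inv_into[OF b] in \<open>auto simp: bij_betw_def\<close>)
qed

section \<open>Finite products of vector spaces\<close>

text \<open>The fields \<open>mult\<close> and \<open>one\<close> exist because modules are records that extend rings.\<close>

definition prod_space :: "'b set \<Rightarrow> ('b \<Rightarrow> ('k, 'v) module) \<Rightarrow> ('k, 'b \<Rightarrow> 'v) module" where
  "prod_space A V = \<lparr>carrier = (\<Pi>\<^sub>E a\<in>A. carrier (V a)),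
     mult = (\<lambda>f g. \<lambda>a\<in>A. \<zero>\<^bsub>V a\<^esub>), one = (\<lambda>a\<in>A. \<zero>\<^bsub>V a\<^esub>), zero = (\<lambda>a\<in>A. \<zero>\<^bsub>V a\<^esub>),
     add = (\<lambda>f g. \<lambda>a\<in>A. f a \<oplus>\<^bsub>V a\<^esub> g a), smult = (\<lambda>r f. \<lambda>a\<in>A. r \<odot>\<^bsub>V a\<^esub> f a)\<rparr>"

lemma prod_space_simps [simp]:
  "carrier (prod_space A V) = (\<Pi>\<^sub>E a\<in>A. carrier (V a))"
  "\<zero>\<^bsub>prod_space A V\<^esub> = (\<lambda>a\<in>A. \<zero>\<^bsub>V a\<^esub>)"
  "f \<oplus>\<^bsub>prod_space A V\<^esub> g = (\<lambda>a\<in>A. f a \<oplus>\<^bsub>V a\<^esub> g a)"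
  "r \<odot>\<^bsub>prod_space A V\<^esub> f = (\<lambda>a\<in>A. r \<odot>\<^bsub>V a\<^esub> f a)"
  by (simp_all add: prod_space_def)

lemma vectorspace_prod_space:
  assumes "field K" "\<And>a. a \<in> A \<Longrightarrow> vectorspace K (V a)"
  shows "vectorspace K (prod_space A V)"
proof -
  have mod: "module K (V a)" and ab: "abelian_group (V a)" if "a \<in> A" for a
    using assms(2)[OF that] by (auto simp: vectorspace_def module_def)
  note am = abelian_group.axioms(1)[OF ab]
  note rules = module.smult_closed[OF mod] abelian_monoid.a_closed[OF am]
    abelian_monoid.zero_closed[OF am] abelian_monoid.a_assoc[OF am] abelian_monoid.r_zero[OF am]
    module.smult_l_distr[OF mod] module.smult_r_distr[OF mod] module.smult_assoc1[OF mod]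
    module.smult_one[OF mod] abelian_group.r_neg[OF ab] abelian_group.a_inv_closed[OF ab]
  show ?thesis
  proof (rule vs_criteria)
  show "field K" by fact
  show "\<forall>v\<in>carrier (prod_space A V). \<exists>w\<in>carrier (prod_space A V).
      v \<oplus>\<^bsub>prod_space A V\<^esub> w = \<zero>\<^bsub>prod_space A V\<^esub>"
  proof
    fix v assume v: "v \<in> carrier (prod_space A V)"
    show "\<exists>w\<in>carrier (prod_space A V). v \<oplus>\<^bsub>prod_space A V\<^esub> w = \<zero>\<^bsub>prod_space A V\<^esub>"
      by (rule bexI[of _ "\<lambda>a\<in>A. \<ominus>\<^bsub>V a\<^esub> v a"])
        (use v in \<open>auto simp: PiE_iff rules intro!: restrict_ext\<close>)
  qed
qed (auto simp: PiE_iff rules extensional_def fun_eq_iff intro: abelian_monoid.a_comm[OF am])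
qed

lemma (in vectorspace) dim_trivial:
  assumes "carrier V = {\<zero>\<^bsub>V\<^esub>}"
  shows "dim = 0" "fin_dim"
proof -
  have "span {\<zero>\<^bsub>V\<^esub>} = carrier V"
    using in_own_span[of "{\<zero>\<^bsub>V\<^esub>}"] span_is_subset2[of "{\<zero>\<^bsub>V\<^esub>}"] by (simp only: assms) blast
  then have g: "gen_set {\<zero>\<^bsub>V\<^esub>}" .
  then show "dim = 0" by (rule dim0I)
  show "fin_dim" unfolding fin_dim_def
    using g M.zero_closed by (intro exI[of _ "{\<zero>\<^bsub>V\<^esub>}"] conjI) (blast | rule finite.intros)+
qed

text \<open>The evaluation at one index is onto, and its kernel is the product of the remaining factors.\<close>

lemma prod_space_fin_dim_dim:
  assumes "field K" "finite A" "\<And>a. a \<in> A \<Longrightarrow> vectorspace K (V a)"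
    "\<And>a. a \<in> A \<Longrightarrow> vectorspace.fin_dim K (V a)"
  shows "vectorspace.fin_dim K (prod_space A V) \<and>
    vectorspace.dim K (prod_space A V) = (\<Sum>a\<in>A. vectorspace.dim K (V a))"
  using assms(2-4)
proof (induction A rule: finite_induct)
  case empty
  interpret vectorspace K "prod_space {} V" by (rule vectorspace_prod_space[OF assms(1)]) auto
  have "carrier (prod_space {} V) = {\<zero>\<^bsub>prod_space {} V\<^esub>}" by (auto simp: restrict_def)
  then show ?case using dim_trivial by simp
next
  case (insert b A)
  let ?P = "prod_space (insert b A) V"
  interpret P: vectorspace K ?P by (rule vectorspace_prod_space[OF assms(1)]) (use insert in auto)
  interpret A: vectorspace K "prod_space A V" by (rule vectorspace_prod_space[OF assms(1)]) (use insert in auto)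
  interpret b: vectorspace K "V b" using insert by auto
  let ?i = "\<lambda>f. \<lambda>a\<in>insert b A. if a = b then \<zero>\<^bsub>V b\<^esub> else f a"
  have i: "linear_map K (prod_space A V) ?P ?i"
    by (rule linear_mapI)
      (use insert.hyps in \<open>auto intro: A.vectorspace_axioms P.vectorspace_axioms simp: PiE_iff intro!: restrict_ext\<close>)
  have p: "linear_map K ?P (V b) (\<lambda>f. f b)"
    by (rule linear_mapI) (auto intro: P.vectorspace_axioms b.vectorspace_axioms)
  have surj: "(\<lambda>f. f b) ` carrier ?P = carrier (V b)"
  proof safe
    fix x assume x: "x \<in> carrier (V b)"
    have "\<zero>\<^bsub>?P\<^esub> \<in> carrier ?P" by (rule P.M.zero_closed)
    then have "\<zero>\<^bsub>?P\<^esub>(b := x) \<in> carrier ?P" using x by (auto simp: PiE_iff extensional_def)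
    then show "x \<in> (\<lambda>f. f b) ` carrier ?P" by (rule rev_image_eqI) simp
  qed auto
  have inj: "inj_on ?i (carrier (prod_space A V))"
  proof (rule inj_onI)
    fix f g assume f: "f \<in> carrier (prod_space A V)" and g: "g \<in> carrier (prod_space A V)" and eq: "?i f = ?i g"
    have "f a = g a" if "a \<in> A" for a
      using fun_cong[OF eq, of a] that insert.hyps by (auto split: if_splits)
    then show "f = g" using f g by (auto intro: PiE_ext)
  qed
  have exact: "f b = \<zero>\<^bsub>V b\<^esub> \<longleftrightarrow> f \<in> ?i ` carrier (prod_space A V)" if f: "f \<in> carrier ?P" for f
  proof
    assume "f b = \<zero>\<^bsub>V b\<^esub>"
    then have "f = ?i (restrict f A)" using f by (auto simp: PiE_iff extensional_def fun_eq_iff)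
    moreover have "restrict f A \<in> carrier (prod_space A V)" using f by auto
    ultimately show "f \<in> ?i ` carrier (prod_space A V)" by blast
  qed auto
  have finA: "vectorspace.fin_dim K (prod_space A V)" using insert by auto
  have fin: "vectorspace.fin_dim K ?P"
    by (rule exact_sequence_fin_dim[OF i p surj _ finA]) (use insert exact in auto)
  then show ?case
    using exact_sequence_dim[OF i p inj surj exact finA fin] insert by auto
qed

lemma linear_map_finsum:
  assumes T: "linear_map K V W T" and "finite A" "g \<in> A \<rightarrow> carrier V"
  shows "T (finsum V g A) = finsum W (\<lambda>a. T (g a)) A"
  using assms(2,3)
proof (induction A rule: finite_induct)
  case empty
  interpret linear_map K V W T by (rule T)
  show ?case by (simp add: V.module.M.finsum_empty W.module.M.finsum_empty)
next
  case (insert a A)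
  interpret linear_map K V W T by (rule T)
  have "finsum V g A \<in> carrier V" using insert by (intro V.module.M.finsum_closed) auto
  moreover have "(\<lambda>a. T (g a)) \<in> A \<rightarrow> carrier W" "T (g a) \<in> carrier W" using insert.prems by auto
  ultimately show ?case using insert by (simp add: V.module.M.finsum_insert W.module.M.finsum_insert)
qed

lemma prod_space_cong:
  "(\<And>a. a \<in> A \<Longrightarrow> V a = W a) \<Longrightarrow> prod_space A V = prod_space A W"
  by (auto simp: prod_space_def fun_eq_iff restrict_def intro!: PiE_cong)

lemma linear_map_prod_space:
  assumes "field K" "\<And>a. a \<in> A \<Longrightarrow> linear_map K (V a) (W a) (g a)"
  shows "linear_map K (prod_space A V) (prod_space A W) (\<lambda>f. \<lambda>a\<in>A. g a (f a))"
proof (rule linear_mapI)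
  show "vectorspace K (prod_space A V)" "vectorspace K (prod_space A W)"
    using assms linear_mapD(1,2) by (blast intro: vectorspace_prod_space)+
qed (auto simp: PiE_iff linear_mapD[OF assms(2)] intro!: restrict_ext)

lemma linear_map_into_prod_space:
  assumes "vectorspace K U" "\<And>a. a \<in> A \<Longrightarrow> linear_map K U (W a) (g a)"
  shows "linear_map K U (prod_space A W) (\<lambda>u. \<lambda>a\<in>A. g a u)"
proof (rule linear_mapI)
  have "field K" using assms(1) by (simp add: vectorspace_def)
  then show "vectorspace K (prod_space A W)"
    using assms linear_mapD(2) by (blast intro: vectorspace_prod_space)
qed (auto simp: PiE_iff linear_mapD[OF assms(2)] assms(1) intro!: restrict_ext)

lemma linear_map_sum_prod_space:
  assumes W: "vectorspace K W" and "finite A" and g: "\<And>a. a \<in> A \<Longrightarrow> linear_map K (V a) W (g a)"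
  shows "linear_map K (prod_space A V) W (\<lambda>f. finsum W (\<lambda>a. g a (f a)) A)"
proof -
  interpret vectorspace K W by fact
  have c: "(\<lambda>a. g a (f a)) \<in> A \<rightarrow> carrier W" if "f \<in> (\<Pi>\<^sub>E a\<in>A. carrier (V a))" for f
    using that by (auto simp: PiE_iff linear_mapD(3)[OF g])
  show ?thesis
  proof (rule linear_mapI)
    have "field K" by unfold_locales
    then show "vectorspace K (prod_space A V)"
      using g linear_mapD(1) by (blast intro: vectorspace_prod_space)
    fix f h assume f: "f \<in> carrier (prod_space A V)" and h: "h \<in> carrier (prod_space A V)"
    have "finsum W (\<lambda>a. g a ((f \<oplus>\<^bsub>prod_space A V\<^esub> h) a)) A = finsum W (\<lambda>a. g a (f a) \<oplus>\<^bsub>W\<^esub> g a (h a)) A"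
      using c f h by (intro M.finsum_cong') (auto simp: PiE_iff linear_mapD[OF g])
    then show "finsum W (\<lambda>a. g a ((f \<oplus>\<^bsub>prod_space A V\<^esub> h) a)) A =
        finsum W (\<lambda>a. g a (f a)) A \<oplus>\<^bsub>W\<^esub> finsum W (\<lambda>a. g a (h a)) A"
      using c f h by (simp add: M.finsum_addf)
  next
    fix r f assume r: "r \<in> carrier K" and f: "f \<in> carrier (prod_space A V)"
    have "finsum W (\<lambda>a. g a ((r \<odot>\<^bsub>prod_space A V\<^esub> f) a)) A = finsum W (\<lambda>a. r \<odot>\<^bsub>W\<^esub> g a (f a)) A"
      using c f r by (intro M.finsum_cong') (auto simp: PiE_iff linear_mapD[OF g])
    then show "finsum W (\<lambda>a. g a ((r \<odot>\<^bsub>prod_space A V\<^esub> f) a)) A = r \<odot>\<^bsub>W\<^esub> finsum W (\<lambda>a. g a (f a)) A"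
      using c f r \<open>finite A\<close> by (simp add: finsum_smult)
  qed (use c in \<open>auto intro!: M.finsum_closed vectorspace_axioms\<close>)
qed

lemma linear_map_eval:
  assumes "field K" "\<And>a. a \<in> A \<Longrightarrow> vectorspace K (V a)" "a \<in> A"
  shows "linear_map K (prod_space A V) (V a) (\<lambda>f. f a)"
  by (rule linear_mapI) (use assms in \<open>auto intro: vectorspace_prod_space\<close>)

section \<open>Factoring linear maps\<close>

text \<open>The universal properties of cokernels (here) and kernels (next) carry morphisms across a
reflection.\<close>

lemma factor_through_surjection:
  assumes p: "linear_map K V W p" and g: "linear_map K V U g"
    and surj: "p ` carrier V = carrier W"
    and ker: "\<And>v. v \<in> carrier V \<Longrightarrow> p v = \<zero>\<^bsub>W\<^esub> \<Longrightarrow> g v = \<zero>\<^bsub>U\<^esub>"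
  obtains h where "linear_map K W U h" "\<And>v. v \<in> carrier V \<Longrightarrow> h (p v) = g v"
proof -
  interpret p: linear_map K V W p by fact
  interpret g: linear_map K V U g by fact
  have well: "g v = g w" if "v \<in> carrier V" "w \<in> carrier V" "p v = p w" for v w
  proof -
    have "p (v \<ominus>\<^bsub>V\<^esub> w) = \<zero>\<^bsub>W\<^esub>" using that by (simp add: p.W.module.M.r_neg p.W.module.M.minus_eq)
    then have "g v \<ominus>\<^bsub>U\<^esub> g w = \<zero>\<^bsub>U\<^esub>" using ker[of "v \<ominus>\<^bsub>V\<^esub> w"] that by simp
    then show ?thesis using that by (simp add: g.W.module.M.minus_other_side)
  qed
  define h where "h w = g (SOME v. v \<in> carrier V \<and> p v = w)" for w
  have hp: "h (p v) = g v" if "v \<in> carrier V" for v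
  proof -
    have "(SOME u. u \<in> carrier V \<and> p u = p v) \<in> carrier V \<and> p (SOME u. u \<in> carrier V \<and> p u = p v) = p v"
      by (rule someI[of _ v]) (use that in auto)
    then show ?thesis unfolding h_def using well that by blast
  qed
  have "linear_map K W U h"
  proof (rule linear_mapI)
    show "h x \<in> carrier U" if "x \<in> carrier W" for x using that hp by (auto simp flip: surj)
    fix x y assume "x \<in> carrier W" "y \<in> carrier W"
    then obtain v w where "v \<in> carrier V" "w \<in> carrier V" "x = p v" "y = p w" using surj by blast
    then show "h (x \<oplus>\<^bsub>W\<^esub> y) = h x \<oplus>\<^bsub>U\<^esub> h y" using hp[of "v \<oplus>\<^bsub>V\<^esub> w"] by (simp add: hp)
  next
    fix r x assume "r \<in> carrier K" "x \<in> carrier W"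
    moreover then obtain v where "v \<in> carrier V" "x = p v" using surj by blast
    ultimately show "h (r \<odot>\<^bsub>W\<^esub> x) = r \<odot>\<^bsub>U\<^esub> h x" using hp[of "r \<odot>\<^bsub>V\<^esub> v"] by (simp add: hp)
  qed (auto intro: p.W.vectorspace_axioms g.W.vectorspace_axioms)
  then show thesis using hp that by blast
qed

lemma factor_through_injection:
  assumes i: "linear_map K U V i" and g: "linear_map K W V g"
    and inj: "inj_on i (carrier U)" and im: "g ` carrier W \<subseteq> i ` carrier U"
  obtains h where "linear_map K W U h" "\<And>w. w \<in> carrier W \<Longrightarrow> i (h w) = g w"
proof -
  interpret i: linear_map K U V i by fact
  interpret g: linear_map K W V g by fact
  define h where "h = inv_into (carrier U) i \<circ> g"
  have hc: "h w \<in> carrier U" and ih: "i (h w) = g w" if "w \<in> carrier W" for w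
    using im that by (auto simp: h_def inv_into_into f_inv_into_f image_subset_iff)
  have "linear_map K W U h"
  proof (rule linear_mapI)
    fix x y assume "x \<in> carrier W" "y \<in> carrier W"
    then have "i (h (x \<oplus>\<^bsub>W\<^esub> y)) = i (h x \<oplus>\<^bsub>U\<^esub> h y)" by (simp add: ih hc)
    then show "h (x \<oplus>\<^bsub>W\<^esub> y) = h x \<oplus>\<^bsub>U\<^esub> h y"
      by (rule inj_onD[OF inj]) (use \<open>x \<in> carrier W\<close> \<open>y \<in> carrier W\<close> hc in auto)
  next
    fix r x assume "r \<in> carrier K" "x \<in> carrier W"
    then have "i (h (r \<odot>\<^bsub>W\<^esub> x)) = i (r \<odot>\<^bsub>U\<^esub> h x)" by (simp add: ih hc)
    then show "h (r \<odot>\<^bsub>W\<^esub> x) = r \<odot>\<^bsub>U\<^esub> h x"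
      by (rule inj_onD[OF inj]) (use \<open>r \<in> carrier K\<close> \<open>x \<in> carrier W\<close> hc in auto)
  qed (auto intro: i.V.vectorspace_axioms g.V.vectorspace_axioms hc)
  then show thesis using ih that by blast
qed

lemma linear_inj_iff:
  assumes "linear_map K V W T"
  shows "inj_on T (carrier V) \<longleftrightarrow> (\<forall>x\<in>carrier V. T x = \<zero>\<^bsub>W\<^esub> \<longrightarrow> x = \<zero>\<^bsub>V\<^esub>)"
proof -
  interpret linear_map K V W T by fact
  show ?thesis unfolding Ke0_iff_inj by (auto simp: ker_def)
qed

section \<open>The quadratic form of a Dynkin diagram\<close>

text \<open>The quadratic form of the underlying graph as a sum over arcs. It treats loops and parallel arcs
uniformly and visibly does not change when an arc is reversed.\<close>

definition tits_form :: "('a, 'b) pre_digraph \<Rightarrow> ('a \<Rightarrow> int) \<Rightarrow> int" where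
  "tits_form Q x = (\<Sum>v\<in>verts Q. (x v)\<^sup>2) - (\<Sum>a\<in>arcs Q. x (tail Q a) * x (head Q a))"

text \<open>The arcs are grouped by their sets of end points: a singleton for a loop, a two-element set
otherwise.\<close>

lemma quadratic_form_underlying_graph:
  assumes "fin_digraph Q"
  shows "quadratic_form (underlying_graph Q) x = tits_form Q x"
proof -
  interpret fin_digraph Q by fact
  let ?ends = "\<lambda>a. {tail Q a, head Q a}"
  let ?g = "\<lambda>a. x (tail Q a) * x (head Q a)"
  let ?L = "(\<lambda>v. {v}) ` verts Q" and ?E = "{e. e \<subseteq> verts Q \<and> card e = 2}"
  have fE: "finite ?E" by (rule finite_subset[of _ "Pow (verts Q)"]) auto
  have "?ends ` arcs Q \<subseteq> ?L \<union> ?E" using wellformed by (auto simp: card_insert_if)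
  then have "sum ?g (arcs Q) = (\<Sum>e\<in>?L \<union> ?E. \<Sum>a | a \<in> arcs Q \<and> ?ends a = e. ?g a)"
    using fE by (intro sum.group[symmetric]) auto
  also have "\<dots> = (\<Sum>e\<in>?L. \<Sum>a | a \<in> arcs Q \<and> ?ends a = e. ?g a) +
      (\<Sum>e\<in>?E. \<Sum>a | a \<in> arcs Q \<and> ?ends a = e. ?g a)"
    using fE by (intro sum.union_disjoint) auto
  also have "(\<Sum>e\<in>?L. \<Sum>a | a \<in> arcs Q \<and> ?ends a = e. ?g a) =
      (\<Sum>v\<in>verts Q. int (card {a \<in> arcs Q. ?ends a = {v}}) * (x v)\<^sup>2)"
  proof (subst sum.reindex)
    show "inj_on (\<lambda>v. {v}) (verts Q)" by simp
    have "(\<Sum>a | a \<in> arcs Q \<and> ?ends a = {v}. ?g a) = (\<Sum>a | a \<in> arcs Q \<and> ?ends a = {v}. (x v)\<^sup>2)" for v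
      by (rule sum.cong) (auto simp: power2_eq_square)
    then show "sum ((\<lambda>e. \<Sum>a | a \<in> arcs Q \<and> ?ends a = e. ?g a) \<circ> (\<lambda>v. {v})) (verts Q) =
      (\<Sum>v\<in>verts Q. int (card {a \<in> arcs Q. ?ends a = {v}}) * (x v)\<^sup>2)"
      by (simp only: o_def sum_constant of_nat_id)
  qed
  also have "(\<Sum>e\<in>?E. \<Sum>a | a \<in> arcs Q \<and> ?ends a = e. ?g a) =
      (\<Sum>e\<in>?E. int (card {a \<in> arcs Q. ?ends a = e}) * (\<Prod>i\<in>e. x i))"
  proof (rule sum.cong[OF refl])
    fix e assume e: "e \<in> ?E"
    have "(\<Sum>a | a \<in> arcs Q \<and> ?ends a = e. ?g a) = (\<Sum>a | a \<in> arcs Q \<and> ?ends a = e. \<Prod>i\<in>e. x i)"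
    proof (rule sum.cong[OF refl])
      fix a assume "a \<in> {a \<in> arcs Q. ?ends a = e}"
      then have a: "?ends a = e" by simp
      then have "tail Q a \<noteq> head Q a" using e by auto
      then show "?g a = (\<Prod>i\<in>e. x i)" by (simp flip: a)
    qed
    then show "(\<Sum>a | a \<in> arcs Q \<and> ?ends a = e. ?g a) =
        int (card {a \<in> arcs Q. ?ends a = e}) * (\<Prod>i\<in>e. x i)" by simp
  qed
  finally show ?thesis
    by (simp add: tits_form_def quadratic_form_def underlying_graph_def)
qed

text \<open>Positive definiteness in a quantitative form, from which both positivity and the finiteness of
the set of integral vectors with bounded form can be read off.\<close>

definition coercive :: "'a multigraph \<Rightarrow> bool" where
  "coercive G \<longleftrightarrow> (\<exists>c::real. 0 < c \<and>
     (\<forall>x. \<forall>v\<in>gverts G. (real_of_int (x v))\<^sup>2 \<le> c * real_of_int (quadratic_form G x)))"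

lemma quadratic_form_transfer:
  assumes "bij_betw f (gverts G) (gverts H)"
    and "\<And>i j. \<lbrakk>i \<in> gverts G; j \<in> gverts G\<rbrakk> \<Longrightarrow> gmult H {f i, f j} = gmult G {i, j}"
  shows "quadratic_form H x = quadratic_form G (x \<circ> f)"
proof -
  let ?E = "\<lambda>V. {e. e \<subseteq> V \<and> card e = 2}"
  have inj: "inj_on f (gverts G)" and im: "f ` gverts G = gverts H"
    using assms(1) by (auto simp: bij_betw_def)
  have "(\<Sum>e\<in>?E (gverts H). int (gmult H e) * (\<Prod>i\<in>e. x i)) =
      (\<Sum>e\<in>(`) f ` ?E (gverts G). int (gmult H e) * (\<Prod>i\<in>e. x i))"
  proof (rule sum.cong)
    show "?E (gverts H) = (`) f ` ?E (gverts G)"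
    proof (intro equalityI subsetI)
      fix e assume "e \<in> ?E (gverts H)"
      then obtain d where "d \<subseteq> gverts G" "e = f ` d" "card e = 2"
        unfolding im[symmetric] by (auto simp: subset_image_iff)
      moreover have "card d = 2" using card_image[OF inj_on_subset[OF inj]] calculation by metis
      ultimately show "e \<in> (`) f ` ?E (gverts G)" by blast
    next
      fix e assume "e \<in> (`) f ` ?E (gverts G)"
      then obtain d where "d \<subseteq> gverts G" "e = f ` d" "card d = 2" by auto
      then show "e \<in> ?E (gverts H)" using card_image[OF inj_on_subset[OF inj]] im by auto
    qed
  qed auto
  also have "\<dots> = (\<Sum>e\<in>?E (gverts G). int (gmult H (f ` e)) * (\<Prod>i\<in>f ` e. x i))"
    by (subst sum.reindex) (auto intro: inj_on_subset[OF inj_on_image_Pow[OF inj]])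
  also have "\<dots> = (\<Sum>e\<in>?E (gverts G). int (gmult G e) * (\<Prod>i\<in>e. (x \<circ> f) i))"
  proof (rule sum.cong[OF refl])
    fix e assume e: "e \<in> ?E (gverts G)"
    then obtain a b where ab: "e = {a, b}" "a \<noteq> b" by (auto simp: card_2_iff)
    then show "int (gmult H (f ` e)) * (\<Prod>i\<in>f ` e. x i) = int (gmult G e) * (\<Prod>i\<in>e. (x \<circ> f) i)"
      using e assms(2) inj by (subst prod.reindex) (auto simp: inj_on_def)
  qed
  finally have off: "(\<Sum>e\<in>?E (gverts H). int (gmult H e) * (\<Prod>i\<in>e. x i)) =
    (\<Sum>e\<in>?E (gverts G). int (gmult G e) * (\<Prod>i\<in>e. (x \<circ> f) i))" .
  have loop: "gmult H {f i} = gmult G {i}" if "i \<in> gverts G" for i using assms(2)[OF that that] by simp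
  have "(\<Sum>i\<in>gverts H. (x i)\<^sup>2) = (\<Sum>i\<in>gverts G. ((x \<circ> f) i)\<^sup>2)"
    by (subst im[symmetric], subst sum.reindex[OF inj]) simp
  moreover have "(\<Sum>i\<in>gverts H. int (gmult H {i}) * (x i)\<^sup>2) =
      (\<Sum>i\<in>gverts G. int (gmult G {i}) * ((x \<circ> f) i)\<^sup>2)"
    by (subst im[symmetric], subst sum.reindex[OF inj]) (simp add: loop)
  ultimately show ?thesis unfolding quadratic_form_def off by simp
qed

lemma coercive_isomorphic:
  assumes "graph_isomorphic G H" "coercive G"
  shows "coercive H"
proof -
  obtain f where f: "bij_betw f (gverts G) (gverts H)"
    "\<And>i j. \<lbrakk>i \<in> gverts G; j \<in> gverts G\<rbrakk> \<Longrightarrow> gmult H {f i, f j} = gmult G {i, j}"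
    using assms(1) by (auto simp: graph_isomorphic_def)
  obtain c :: real where c0: "0 < c" and c: "\<And>x v. v \<in> gverts G \<Longrightarrow> (real_of_int (x v))\<^sup>2 \<le> c * quadratic_form G x"
    using assms(2) by (auto simp: coercive_def)
  have "(real_of_int (x v))\<^sup>2 \<le> c * quadratic_form H x" if v: "v \<in> gverts H" for x v
  proof -
    obtain w where w: "w \<in> gverts G" "v = f w" using f(1) v by (auto simp: bij_betw_def)
    show ?thesis using c[OF w(1), of "x \<circ> f"] w(2) by (simp add: quadratic_form_transfer[OF f])
  qed
  then show ?thesis using c0 by (auto simp: coercive_def)
qed

lemma quadratic_form_simple_graph:
  assumes "finite V" "\<And>e. e \<in> E \<Longrightarrow> e \<subseteq> V \<and> card e = 2"
  shows "quadratic_form (simple_graph V E) x = (\<Sum>v\<in>V. (x v)\<^sup>2) - (\<Sum>e\<in>E. \<Prod>i\<in>e. x i)"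
proof -
  have "{v} \<notin> E" for v using assms(2)[of "{v}"] by auto
  moreover have "(\<Sum>e | e \<subseteq> V \<and> card e = 2. int (if e \<in> E then 1 else 0) * (\<Prod>i\<in>e. x i)) =
      (\<Sum>e\<in>E. \<Prod>i\<in>e. x i)"
    using assms by (intro sum.mono_neutral_cong_right) auto
  ultimately show ?thesis by (simp add: quadratic_form_def simple_graph_def)
qed

text \<open>The part of the quadratic form due to an arm of \<open>l\<close> vertices with values \<open>y 0, y 1, \<dots>\<close> that is
attached to a vertex of value \<open>c\<close>.\<close>

definition arm_form :: "nat \<Rightarrow> real \<Rightarrow> (nat \<Rightarrow> real) \<Rightarrow> real" where
  "arm_form l c y = (\<Sum>k<l. (y k)\<^sup>2 - (case k of 0 \<Rightarrow> c | Suc k' \<Rightarrow> y k') * y k)"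

lemma arm_form_Suc:
  "arm_form (Suc l) c y = (y 0)\<^sup>2 - c * y 0 + arm_form l (y 0) (\<lambda>k. y (Suc k))"
  unfolding arm_form_def sum.lessThan_Suc_shift
  by (auto intro!: sum.cong split: nat.splits)

text \<open>Completing the square in \<open>y 0\<close>. If \<open>- m l * c\<^sup>2\<close> is the minimum of \<open>arm_form l c y\<close>
over \<open>y\<close>, this gives \<open>m (Suc l) = 1 / (4 * (1 - m l))\<close> and \<open>m 0 = 0\<close>, which is solved by
\<open>m l = l / (2 * (l + 1))\<close>.\<close>

lemma arm_form_complete_square:
  "arm_form (Suc l) c y + real (Suc l) / (2 * (real (Suc l) + 1)) * c\<^sup>2 =
    arm_form l (y 0) (\<lambda>k. y (Suc k)) + real l / (2 * (real l + 1)) * (y 0)\<^sup>2 +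
    (real l + 2) / (2 * (real l + 1)) * (y 0 - (real l + 1) / (real l + 2) * c)\<^sup>2"
proof -
  define u where "u = (real l + 1) / (real l + 2)"
  have u: "u \<noteq> 0" "(real l + 2) / (2 * (real l + 1)) = 1 / (2 * u)"
    "real l / (2 * (real l + 1)) = 1 - 1 / (2 * u)" "real (Suc l) / (2 * (real (Suc l) + 1)) = u / 2"
    by (simp_all add: u_def field_simps)
  have "1 / (2 * u) * (y 0 - u * c)\<^sup>2 = 1 / (2 * u) * (y 0)\<^sup>2 - c * y 0 + u / 2 * c\<^sup>2"
    using u(1) by (simp add: power2_eq_square field_simps)
  then show ?thesis
    unfolding u(2-4) u_def[symmetric] arm_form_Suc by (simp add: algebra_simps)
qed

lemma arm_form_nonneg: "0 \<le> arm_form l c y + real l / (2 * (real l + 1)) * c\<^sup>2"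
proof (induction l arbitrary: c y)
  case 0
  show ?case by (simp add: arm_form_def)
next
  case (Suc l)
  show ?case unfolding arm_form_complete_square by (rule add_nonneg_nonneg[OF Suc.IH]) simp
qed

text \<open>If the completed form of the arm and \<open>c\<close> are small, then so is \<open>y 0\<close>, up to a factor 4; the same
argument applies to the rest of the arm, which hangs on \<open>y 0\<close>.\<close>

lemma arm_form_coercive:
  "k < l \<Longrightarrow> (y k)\<^sup>2 / 4 ^ l \<le> arm_form l c y + real l / (2 * (real l + 1)) * c\<^sup>2 + c\<^sup>2"
proof (induction l arbitrary: c y k)
  case (Suc l)
  let ?g = "arm_form l (y 0) (\<lambda>k. y (Suc k)) + real l / (2 * (real l + 1)) * (y 0)\<^sup>2"
  let ?t = "(real l + 2) / (2 * (real l + 1)) * (y 0 - (real l + 1) / (real l + 2) * c)\<^sup>2"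
  let ?u = "(real l + 1) / (real l + 2) * c"
  have g: "0 \<le> ?g" by (rule arm_form_nonneg)
  have "((real l + 1) / (real l + 2))\<^sup>2 \<le> (1::real)" by (intro power_le_one) auto
  then have u: "?u\<^sup>2 \<le> c\<^sup>2" unfolding power_mult_distrib by (intro mult_left_le_one_le) auto
  have t: "?t \<ge> 1/2 * (y 0 - ?u)\<^sup>2" by (intro mult_right_mono) (auto simp: field_simps)
  have "2 * (y 0 - ?u)\<^sup>2 + 2 * ?u\<^sup>2 - (y 0)\<^sup>2 = (y 0 - 2 * ?u)\<^sup>2"
    by (simp add: power2_eq_square algebra_simps)
  then have "(y 0)\<^sup>2 \<le> 2 * (y 0 - ?u)\<^sup>2 + 2 * ?u\<^sup>2"
    using zero_le_power2[of "y 0 - 2 * ?u"] by linarith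
  then have y0: "(y 0)\<^sup>2 / 4 \<le> ?t + c\<^sup>2"
    using t u zero_le_power2[of "y 0 - ?u"] zero_le_power2[of c] by linarith
  have "(y k)\<^sup>2 / 4 ^ Suc l \<le> ?g + ?t + c\<^sup>2"
  proof (cases k)
    case 0
    have "(y 0)\<^sup>2 / 4 ^ Suc l \<le> (y 0)\<^sup>2 / 4" by (intro divide_left_mono) auto
    moreover have "b \<le> a \<Longrightarrow> a \<le> T + C \<Longrightarrow> 0 \<le> G \<Longrightarrow> b \<le> G + T + C" for a b G T C :: real
      by linarith
    ultimately show ?thesis using y0 g unfolding 0 by blast
  next
    case (Suc k')
    then have "(y k)\<^sup>2 / 4 ^ l \<le> ?g + (y 0)\<^sup>2" using Suc.IH[of k' "\<lambda>k. y (Suc k)" "y 0"] Suc.prems by simp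
    moreover have "(y k)\<^sup>2 / 4 ^ Suc l = (y k)\<^sup>2 / 4 ^ l / 4" by simp
    moreover have "a \<le> G + Y \<Longrightarrow> b = a / 4 \<Longrightarrow> Y / 4 \<le> T + C \<Longrightarrow> 0 \<le> G \<Longrightarrow> b \<le> G + T + C"
      for a b G Y T C :: real by linarith
    ultimately show ?thesis using y0 g by blast
  qed
  then show ?case unfolding arm_form_complete_square .
qed simp

text \<open>When the squares along the arms are completed, the centre is left with the coefficient
\<open>1 - (\<Sum>j<m. l j / (2 * (l j + 1)))\<close>. For three arms with \<open>p j = l j + 1\<close> this is half of
\<open>1/p 0 + 1/p 1 + 1/p 2 - 1\<close>, so that its positivity is the classical condition for the Dynkin
diagrams. Stated for an arbitrary labelling of the vertices, the lemma covers paths as well: they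
are stars with one arm.\<close>

lemma coercive_star_shaped:
  fixes vtx :: "nat \<Rightarrow> nat \<Rightarrow> 'a" and l :: "nat \<Rightarrow> nat" and m :: nat and r :: 'a
  defines "I \<equiv> SIGMA j:{..<m}. {..<l j}"
  defines "prev \<equiv> \<lambda>j k. case k of 0 \<Rightarrow> r | Suc k' \<Rightarrow> vtx j k'"
  assumes inj: "inj_on (\<lambda>(j, k). vtx j k) I" and r: "r \<notin> (\<lambda>(j, k). vtx j k) ` I"
    and V: "V = insert r ((\<lambda>(j, k). vtx j k) ` I)"
    and E: "E = (\<lambda>(j, k). {prev j k, vtx j k}) ` I"
    and lt: "(\<Sum>j<m. real (l j) / (2 * (real (l j) + 1))) < (1::real)"
  shows "coercive (simple_graph V E)"
proof -
  have finI: "finite I" by (simp add: I_def)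
  have injD: "j = j' \<and> k = k'" if "vtx j k = vtx j' k'" "(j, k) \<in> I" "(j', k') \<in> I" for j k j' k'
    using inj_onD[OF inj, of "(j, k)" "(j', k')"] that by auto
  have down: "(j, k) \<in> I" if "(j, Suc k) \<in> I" for j k using that by (auto simp: I_def)
  have prev_ne: "prev j k \<noteq> vtx j k" if "(j, k) \<in> I" for j k
    using that r injD[of j "k - 1" j k] down[of j "k - 1"] by (auto simp: prev_def split: nat.splits)
  have prevV: "prev j k \<in> V" if "(j, k) \<in> I" for j k
    using that down[of j "k - 1"] by (force simp: prev_def V split: nat.splits)
  \<comment> \<open>Edges with equal ends in exchanged roles would each have to lie further out than the other.\<close>
  have no_swap: "vtx j k \<noteq> prev j' k' \<or> prev j k \<noteq> vtx j' k'" if jk: "(j, k) \<in> I" "(j', k') \<in> I" for j k j' k'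
  proof (rule ccontr)
    assume "\<not> ?thesis"
    then have *: "vtx j k = prev j' k'" "prev j k = vtx j' k'" by auto
    obtain n where n: "k' = Suc n" "vtx j k = vtx j' n"
      using *(1) r jk(1) by (force simp: prev_def split: nat.splits)
    obtain n' where n': "k = Suc n'" "vtx j n' = vtx j' k'"
      using *(2) r jk(2) by (force simp: prev_def split: nat.splits)
    have "(j', n) \<in> I" "(j, n') \<in> I" using down jk n(1) n'(1) by blast+
    then have "k = n" "n' = k'" using injD[OF n(2) jk(1)] injD[OF n'(2) _ jk(2)] by blast+
    then show False using n(1) n'(1) by simp
  qed
  have injE: "inj_on (\<lambda>(j, k). {prev j k, vtx j k}) I"
    using injD no_swap by (fastforce simp: inj_on_def doubleton_eq_iff)
  have E2: "e \<subseteq> V \<and> card e = 2" if "e \<in> E" for e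
    using that prevV prev_ne by (fastforce simp: E V)
  define d where "d = 1 - (\<Sum>j<m. real (l j) / (2 * (real (l j) + 1)) :: real)"
  have d: "d > 0" using lt by (simp add: d_def)
  define L where "L = (\<Sum>j<m. l j)"
  \<comment> \<open>The square of the value is at most \<open>q / d\<close> at the centre and \<open>4 ^ l j * (q + q / d)\<close> on the arm \<open>j\<close>.\<close>
  define c where "c = 4 ^ L * (1 + 1 / d)"
  have "(real_of_int (x v))\<^sup>2 \<le> c * quadratic_form (simple_graph V E) x" if v: "v \<in> V" for x v
  proof -
    let ?q = "real_of_int (quadratic_form (simple_graph V E) x)"
    let ?y = "\<lambda>j k. real_of_int (x (vtx j k))"
    let ?g = "\<lambda>j. arm_form (l j) (x r) (?y j) + real (l j) / (2 * (real (l j) + 1)) * (real_of_int (x r))\<^sup>2"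
    have "quadratic_form (simple_graph V E) x = (x r)\<^sup>2 + (\<Sum>(j, k)\<in>I. (x (vtx j k))\<^sup>2) -
        (\<Sum>(j, k)\<in>I. x (prev j k) * x (vtx j k))"
    proof -
      have "(\<Sum>e\<in>E. \<Prod>i\<in>e. x i) = (\<Sum>(j, k)\<in>I. x (prev j k) * x (vtx j k))"
        unfolding E by (subst sum.reindex[OF injE]) (auto intro!: sum.cong simp: prev_ne)
      moreover have "(\<Sum>v\<in>V. (x v)\<^sup>2) = (x r)\<^sup>2 + (\<Sum>(j, k)\<in>I. (x (vtx j k))\<^sup>2)"
        unfolding V using finI r by (simp add: sum.reindex[OF inj]) (auto intro!: sum.cong)
      moreover have "finite V" using finI by (simp add: V)
      ultimately show ?thesis by (simp add: quadratic_form_simple_graph[OF _ E2])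
    qed
    also have "\<dots> = (x r)\<^sup>2 + (\<Sum>j<m. \<Sum>k<l j. (x (vtx j k))\<^sup>2 - x (prev j k) * x (vtx j k))"
      unfolding I_def by (simp add: sum.Sigma sum_subtractf)
    finally have "?q = (real_of_int (x r))\<^sup>2 + (\<Sum>j<m. arm_form (l j) (x r) (?y j))"
      by (auto simp: arm_form_def prev_def intro!: sum.cong split: nat.splits)
    then have q: "?q = d * (real_of_int (x r))\<^sup>2 + (\<Sum>j<m. ?g j)"
      by (simp only: d_def sum.distrib left_diff_distrib sum_distrib_right[symmetric])
    have g0: "0 \<le> ?g j" for j by (rule arm_form_nonneg)
    have c: "d * (real_of_int (x r))\<^sup>2 \<le> ?q" unfolding q using sum_nonneg[of "{..<m}" ?g] g0 by simp
    then have cr: "(real_of_int (x r))\<^sup>2 \<le> ?q / d" using d by (simp add: field_simps)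
    have q0: "0 \<le> ?q" using c d by (smt (verit) mult_nonneg_nonneg zero_le_power2)
    show ?thesis
    proof (cases "v = r")
      case True
      have "1 / d \<le> c" unfolding c_def using d by (smt (verit) one_le_power mult_le_cancel_right1 zero_le_divide_1_iff)
      then have "?q * (1 / d) \<le> ?q * c" using q0 by (rule mult_left_mono)
      then show ?thesis using cr True by (simp add: mult.commute)
    next
      case False
      then obtain j k where jk: "(j, k) \<in> I" "v = vtx j k" using v by (auto simp: V)
      then have j: "j < m" "k < l j" by (auto simp: I_def)
      have "?g j \<le> (\<Sum>j<m. ?g j)" using j g0 by (intro member_le_sum) auto
      then have "?g j \<le> ?q" using q d by (smt (verit) mult_nonneg_nonneg zero_le_power2)
      then have "(?y j k)\<^sup>2 / 4 ^ l j \<le> ?q + ?q / d" using arm_form_coercive[OF j(2), of "?y j" "x r"] cr by linarith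
      then have "(?y j k)\<^sup>2 \<le> 4 ^ l j * (?q + ?q / d)" by (simp add: field_simps)
      also have "\<dots> \<le> 4 ^ L * (?q + ?q / d)"
        using q0 d j member_le_sum[of j "{..<m}" l] unfolding L_def
        by (intro mult_right_mono power_increasing) auto
      also have "\<dots> = c * ?q" by (simp add: c_def algebra_simps)
      finally show ?thesis using jk by simp
    qed
  qed
  moreover have "0 < c" unfolding c_def using d by (intro mult_pos_pos) (auto intro: add_pos_pos)
  ultimately show ?thesis unfolding coercive_def by (intro exI[of _ c]) (simp add: simple_graph_def)
qed

lemma coercive_star_graph:
  assumes "(\<Sum>j<length ls. real (ls ! j) / (2 * (real (ls ! j) + 1))) < (1::real)"
  shows "coercive (star_graph ls)"
  unfolding star_graph_def
proof (rule coercive_star_shaped[of Arm "length ls" "\<lambda>j. ls ! j" Centre])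
  let ?I = "SIGMA j:{..<length ls}. {..<ls ! j}"
  let ?e = "\<lambda>(j, k). {case k of 0 \<Rightarrow> Centre | Suc k' \<Rightarrow> Arm j k', Arm j k}"
  show "{{Centre, Arm j 0} | j. j < length ls \<and> 0 < ls ! j} \<union>
      {{Arm j k, Arm j (Suc k)} | j k. j < length ls \<and> Suc k < ls ! j} = ?e ` ?I" (is "?A \<union> ?B = _")
  proof (intro equalityI subsetI)
    fix e assume "e \<in> ?e ` ?I"
    then obtain j k where "j < length ls" "k < ls ! j" "e = ?e (j, k)" by auto
    then show "e \<in> ?A \<union> ?B" by (cases k) auto
  next
    fix e assume "e \<in> ?A \<union> ?B"
    then consider j where "j < length ls" "0 < ls ! j" "e = ?e (j, 0)"
      | j k where "j < length ls" "Suc k < ls ! j" "e = ?e (j, Suc k)" by auto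
    then show "e \<in> ?e ` ?I" by cases (rule image_eqI, assumption, simp)+
  qed
qed (use assms in \<open>auto simp: inj_on_def algebra_simps\<close>)

lemma coercive_path_graph:
  assumes "n \<ge> 1"
  shows "coercive (path_graph n)"
  unfolding path_graph_def
proof (rule coercive_star_shaped[of "\<lambda>j k. k + 2" 1 "\<lambda>j. n - 1" 1])
  let ?I = "SIGMA j:{..<1::nat}. {..<n - 1}"
  show "{1..n} = insert 1 ((\<lambda>(j, k). k + 2) ` ?I)"
  proof (intro equalityI subsetI)
    fix i assume "i \<in> {1..n}"
    then show "i \<in> insert 1 ((\<lambda>(j, k). k + 2) ` ?I)"
      by (cases "i = 1") (auto intro!: image_eqI[of _ _ "(0, i - 2)"])
  qed (use assms in auto)
  show "{{i, Suc i} | i. 1 \<le> i \<and> i < n} =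
      (\<lambda>(j, k). {case k of 0 \<Rightarrow> 1 | Suc k' \<Rightarrow> k' + 2, k + 2}) ` ?I"
  proof (intro equalityI subsetI)
    fix e assume "e \<in> {{i, Suc i} | i. 1 \<le> i \<and> i < n}"
    then obtain i where "1 \<le> i" "i < n" "e = {i, Suc i}" by auto
    then show "e \<in> (\<lambda>(j, k). {case k of 0 \<Rightarrow> 1 | Suc k' \<Rightarrow> k' + 2, k + 2}) ` ?I"
      by (intro image_eqI[of _ _ "(0, i - 1)"]) (auto split: nat.splits)
  next
    fix e assume "e \<in> (\<lambda>(j, k). {case k of 0 \<Rightarrow> 1 | Suc k' \<Rightarrow> k' + 2, k + 2}) ` ?I"
    then obtain k where "k < n - 1" "e = {case k of 0 \<Rightarrow> 1 | Suc k' \<Rightarrow> k' + 2, k + 2}" by auto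
    then have "e = {k + 1, Suc (k + 1)} \<and> k + 1 < n" by (auto split: nat.splits)
    then show "e \<in> {{i, Suc i} | i. 1 \<le> i \<and> i < n}" by (intro CollectI exI[of _ "k + 1"]) auto
  qed
qed (auto simp: inj_on_def field_simps)

theorem coercive_dynkin:
  assumes "dynkin_diagram G"
  shows "coercive G"
proof -
  have "coercive (star_graph [1, 1, n - 3])" if "n \<ge> 4" for n
    using that by (intro coercive_star_graph) (simp add: numeral_3_eq_3 field_simps)
  moreover have "coercive (star_graph [1, 2, m])" if "m \<in> {2, 3, 4}" for m
    using that by (intro coercive_star_graph) (auto simp: numeral_3_eq_3)
  ultimately show ?thesis
    using assms coercive_path_graph coercive_isomorphic unfolding dynkin_diagram_def by metis
qed

section \<open>Change of orientation and simple reflections\<close>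

text \<open>Only arcs are touched, so that reversing every arc twice gives back the same record.\<close>

definition flip :: "'a \<Rightarrow> ('a, 'b) pre_digraph \<Rightarrow> ('a, 'b) pre_digraph" where
  "flip v Q = Q\<lparr>
     tail := (\<lambda>a. if a \<in> arcs Q \<and> v \<in> {tail Q a, head Q a} then head Q a else tail Q a),
     head := (\<lambda>a. if a \<in> arcs Q \<and> v \<in> {tail Q a, head Q a} then tail Q a else head Q a)\<rparr>"

lemma flip_simps [simp]:
  "verts (flip v Q) = verts Q" "arcs (flip v Q) = arcs Q"
  "tail (flip v Q) a = (if a \<in> arcs Q \<and> v \<in> {tail Q a, head Q a} then head Q a else tail Q a)"
  "head (flip v Q) a = (if a \<in> arcs Q \<and> v \<in> {tail Q a, head Q a} then tail Q a else head Q a)"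
  by (auto simp: flip_def)

definition sink :: "('a, 'b) pre_digraph \<Rightarrow> 'a \<Rightarrow> bool" where
  "sink Q v \<longleftrightarrow> v \<in> verts Q \<and> (\<forall>a\<in>arcs Q. tail Q a \<noteq> v)"

lemma fin_digraph_flip:
  assumes "fin_digraph Q"
  shows "fin_digraph (flip v Q)"
proof -
  interpret fin_digraph Q by fact
  show ?thesis by unfold_locales (auto simp: wellformed)
qed

lemma tits_form_flip [simp]: "tits_form (flip v Q) = tits_form Q"
  unfolding tits_form_def by (auto simp: fun_eq_iff intro!: sum.cong)

definition neighbour_sum :: "('a, 'b) pre_digraph \<Rightarrow> 'a \<Rightarrow> ('a \<Rightarrow> int) \<Rightarrow> int" where
  "neighbour_sum Q v x = (\<Sum>a\<in>arcs Q. (if tail Q a = v then x (head Q a) else 0) +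
     (if head Q a = v then x (tail Q a) else 0))"

text \<open>The simple reflection $s_v$ of the quadratic form, if there is no loop at \<open>v\<close>.\<close>

definition reflection :: "('a, 'b) pre_digraph \<Rightarrow> 'a \<Rightarrow> ('a \<Rightarrow> int) \<Rightarrow> 'a \<Rightarrow> int" where
  "reflection Q v x = x(v := neighbour_sum Q v x - x v)"

lemma reflection_flip [simp]: "reflection (flip w Q) = reflection Q"
  unfolding reflection_def neighbour_sum_def
  by (auto simp: fun_eq_iff intro!: sum.cong)

lemma neighbour_sum_sink:
  assumes "fin_digraph Q" "sink Q v"
  shows "neighbour_sum Q v x = (\<Sum>a | a \<in> arcs Q \<and> head Q a = v. x (tail Q a))"
proof -
  interpret fin_digraph Q by fact
  have "neighbour_sum Q v x = (\<Sum>a\<in>arcs Q. if head Q a = v then x (tail Q a) else 0)"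
    using assms(2) unfolding neighbour_sum_def sink_def by (intro sum.cong) auto
  then show ?thesis by (simp add: sum.inter_filter)
qed

fun admissible :: "('a, 'b) pre_digraph \<Rightarrow> 'a list \<Rightarrow> bool" where
  "admissible Q [] = True"
| "admissible Q (v # vs) = (sink Q v \<and> admissible (flip v Q) vs)"

lemma admissible_append:
  "admissible Q (vs @ ws) \<longleftrightarrow> admissible Q vs \<and> admissible (fold flip vs Q) ws"
  by (induction vs arbitrary: Q) auto

lemma fold_flip_simps [simp]:
  "verts (fold flip vs Q) = verts Q" "arcs (fold flip vs Q) = arcs Q"
  by (induction vs arbitrary: Q) auto

lemma fold_flip_not_arc:
  "a \<notin> arcs Q \<Longrightarrow> tail (fold flip vs Q) a = tail Q a \<and> head (fold flip vs Q) a = head Q a"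
  by (induction vs arbitrary: Q) auto

lemma fold_flip_arc:
  assumes "a \<in> arcs Q" "{tail Q a, head Q a} = E"
  shows "tail (fold flip vs Q) a =
      (if even (length (filter (\<lambda>v. v \<in> E) vs)) then tail Q a else head Q a) \<and>
    head (fold flip vs Q) a =
      (if even (length (filter (\<lambda>v. v \<in> E) vs)) then head Q a else tail Q a)"
  using assms
proof (induction vs arbitrary: Q)
  case (Cons v vs)
  have "{tail (flip v Q) a, head (flip v Q) a} = E" using Cons.prems by auto
  from Cons.IH[OF _ this] show ?case using Cons.prems by auto
qed simp

section \<open>Quivers with positive definite form\<close>

locale tits_quiver = fin_digraph Q for Q :: "('a, 'b) pre_digraph" +
  assumes coercive: "\<exists>c::real. 0 < c \<and> (\<forall>x. \<forall>v\<in>verts Q. (real_of_int (x v))\<^sup>2 \<le> c * tits_form Q x)"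
begin

lemma tits_quiver_flip: "tits_quiver (flip v Q)"
  using coercive fin_digraph_axioms
  by (simp add: tits_quiver_def tits_quiver_axioms_def fin_digraph_flip)

lemma tits_form_pos:
  assumes "v \<in> verts Q" "x v \<noteq> 0"
  shows "0 < tits_form Q x"
proof -
  obtain c :: real where c: "0 < c" "\<And>x v. v \<in> verts Q \<Longrightarrow> (real_of_int (x v))\<^sup>2 \<le> c * tits_form Q x"
    using coercive by auto
  have "0 < (real_of_int (x v))\<^sup>2" using assms by simp
  also have "\<dots> \<le> c * tits_form Q x" using c assms by auto
  finally show ?thesis using c(1) by (simp add: zero_less_mult_iff)
qed

lemma tits_form_zero:
  assumes "\<And>v. v \<in> verts Q \<Longrightarrow> x v = 0"
  shows "tits_form Q x = 0"
  using assms by (simp add: tits_form_def tail_in_verts)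

lemma finite_tits_form_le: "finite {x \<in> verts Q \<rightarrow>\<^sub>E UNIV. tits_form Q x \<le> N}"
proof -
  obtain c :: real where c: "0 < c" "\<And>x v. v \<in> verts Q \<Longrightarrow> (real_of_int (x v))\<^sup>2 \<le> c * tits_form Q x"
    using coercive by auto
  have "x v \<in> {- \<lceil>c * N\<rceil>..\<lceil>c * N\<rceil>}" if "tits_form Q x \<le> N" "v \<in> verts Q" for x v
  proof -
    have "(real_of_int (x v))\<^sup>2 \<le> c * tits_form Q x" using c that by auto
    also have "\<dots> \<le> c * N" using c(1) that by simp
    also have "\<dots> \<le> real_of_int \<lceil>c * N\<rceil>" by simp
    finally have "(x v)\<^sup>2 \<le> \<lceil>c * N\<rceil>" by (metis of_int_le_iff of_int_power)
    moreover have "\<bar>x v\<bar> \<le> (x v)\<^sup>2"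
      using self_le_power[of "\<bar>x v\<bar>" 2] by (cases "x v = 0") auto
    ultimately show ?thesis by auto
  qed
  then have "{x \<in> verts Q \<rightarrow>\<^sub>E UNIV. tits_form Q x \<le> N} \<subseteq> (\<Pi>\<^sub>E v\<in>verts Q. {- \<lceil>c * N\<rceil>..\<lceil>c * N\<rceil>})"
    by (auto simp: PiE_iff extensional_def)
  then show ?thesis by (rule finite_subset) (auto intro: finite_PiE)
qed

text \<open>If every vertex of \<open>S\<close> had an arc into \<open>S\<close>, then there would be at least as many arcs inside \<open>S\<close>
as vertices, and the form would not be positive at the indicator function of \<open>S\<close>.\<close>

lemma relative_sink:
  assumes "S \<subseteq> verts Q" "S \<noteq> {}"
  obtains v where "v \<in> S" "\<And>a. \<lbrakk>a \<in> arcs Q; tail Q a = v\<rbrakk> \<Longrightarrow> head Q a \<notin> S"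
proof (rule ccontr)
  assume "\<not> thesis"
  then have "\<forall>v\<in>S. \<exists>a\<in>arcs Q. tail Q a = v \<and> head Q a \<in> S" using that by blast
  then obtain f where f: "\<And>v. v \<in> S \<Longrightarrow> f v \<in> arcs Q \<and> tail Q (f v) = v \<and> head Q (f v) \<in> S" by metis
  let ?x = "\<lambda>v. if v \<in> S then 1 else 0 :: int"
  let ?B = "{a \<in> arcs Q. tail Q a \<in> S \<and> head Q a \<in> S}"
  have "inj_on f S" using f by (metis inj_onI)
  moreover have "f ` S \<subseteq> ?B" using f by auto
  ultimately have "card S \<le> card ?B" by (intro card_inj_on_le[of f]) auto
  moreover have "(\<Sum>v\<in>verts Q. (?x v)\<^sup>2) = int (card S)"
    using assms(1) by (simp add: if_distrib[of "\<lambda>t. t\<^sup>2"] sum.If_cases Int_absorb1 cong: if_cong)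
  moreover have "(\<Sum>a\<in>arcs Q. ?x (tail Q a) * ?x (head Q a)) = int (card ?B)"
  proof -
    have "(\<Sum>a\<in>arcs Q. ?x (tail Q a) * ?x (head Q a)) = (\<Sum>a\<in>arcs Q. if a \<in> ?B then 1 else 0)"
      by (intro sum.cong) auto
    also have "\<dots> = int (card ?B)" by (subst sum.If_cases) (auto intro!: arg_cong[of _ _ card])
    finally show ?thesis .
  qed
  ultimately have "tits_form Q ?x \<le> 0" by (simp add: tits_form_def)
  moreover obtain v where "v \<in> S" using assms(2) by auto
  ultimately show False using tits_form_pos[of v ?x] assms(1) by auto
qed

lemma no_loops: "a \<in> arcs Q \<Longrightarrow> tail Q a \<noteq> head Q a"
  using relative_sink[of "{tail Q a}"] by (metis empty_not_insert empty_subsetI insert_subset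
      singletonD singletonI tail_in_verts)

text \<open>Relative sinks of the set \<open>S\<close> of vertices that are still to come are true sinks as long as no arc
leaves \<open>S\<close>. Reversing the arrows at such a vertex \<open>v\<close> turns it into a source, so that no arc leaves
\<open>S - {v}\<close> either.\<close>

lemma exists_complete_admissible:
  "\<exists>vs. distinct vs \<and> set vs = verts Q \<and> admissible Q vs"
proof -
  have "\<exists>vs. distinct vs \<and> set vs = S \<and> admissible R vs"
    if "finite S" "S \<subseteq> verts R" "tits_quiver R"
      "\<And>a. \<lbrakk>a \<in> arcs R; tail R a \<in> S\<rbrakk> \<Longrightarrow> head R a \<in> S" for S and R :: "('a, 'b) pre_digraph"
    using that
  proof (induction "card S" arbitrary: S R)
    case 0
    then show ?case by auto
  next
    case (Suc n)
    interpret R: tits_quiver R by fact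
    have "S \<noteq> {}" using Suc.hyps(2) by auto
    then obtain v where v: "v \<in> S" "\<And>a. \<lbrakk>a \<in> arcs R; tail R a = v\<rbrakk> \<Longrightarrow> head R a \<notin> S"
      using R.relative_sink[OF Suc.prems(2)] by metis
    then have s: "sink R v" using Suc.prems by (auto simp: sink_def)
    have "\<exists>vs. distinct vs \<and> set vs = S - {v} \<and> admissible (flip v R) vs"
    proof (rule Suc.hyps(1))
      show "n = card (S - {v})" using Suc.hyps(2) v(1) Suc.prems(1) by simp
      show "tits_quiver (flip v R)" by (rule R.tits_quiver_flip)
      fix a assume "a \<in> arcs (flip v R)" "tail (flip v R) a \<in> S - {v}"
      then show "head (flip v R) a \<in> S - {v}"
        using s Suc.prems(4)[of a] by (auto simp: sink_def split: if_splits)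
    qed (use Suc.prems in auto)
    then obtain vs where "distinct vs" "set vs = S - {v}" "admissible (flip v R) vs" by auto
    then show ?case using v(1) s by (intro exI[of _ "v # vs"]) auto
  qed
  from this[of "verts Q" Q] show ?thesis using tits_quiver_axioms by (auto simp: head_in_verts)
qed

text \<open>Every arc is reversed twice, once for each of its two end points.\<close>

lemma fold_flip_complete:
  assumes "distinct vs" "set vs = verts Q"
  shows "fold flip vs Q = Q"
proof -
  have "length (filter (\<lambda>v. v \<in> {tail Q a, head Q a}) vs) = 2" if "a \<in> arcs Q" for a
  proof -
    have "length (filter (\<lambda>v. v \<in> {tail Q a, head Q a}) vs) = card {v \<in> set vs. v \<in> {tail Q a, head Q a}}"
      using assms(1) by (metis distinct_card distinct_filter set_filter)
    also have "{v \<in> set vs. v \<in> {tail Q a, head Q a}} = {tail Q a, head Q a}"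
      using tail_in_verts[OF that] head_in_verts[OF that] assms(2) by blast
    finally show ?thesis using no_loops[OF that] by simp
  qed
  then have "tail (fold flip vs Q) a = tail Q a" "head (fold flip vs Q) a = head Q a" for a
    using fold_flip_arc[of a Q _ vs] fold_flip_not_arc[of a Q vs] by (cases "a \<in> arcs Q"; simp)+
  then show ?thesis
    by (intro pre_digraph.equality) auto
qed

text \<open>As a polynomial in one coordinate, the form is monic of degree two; a reflection exchanges the two
points at which such a polynomial takes the same value.\<close>

lemma tits_form_update:
  assumes "v \<in> verts Q"
  shows "tits_form Q (x(v := t)) = t\<^sup>2 - t * neighbour_sum Q v x + tits_form Q (x(v := 0))"
proof -
  have "(\<Sum>u\<in>verts Q. ((x(v := s)) u)\<^sup>2) = s\<^sup>2 + (\<Sum>u\<in>verts Q - {v}. (x u)\<^sup>2)" for s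
    using assms by (simp add: sum.remove[of _ v])
  moreover have "(\<Sum>a\<in>arcs Q. (x(v := t)) (tail Q a) * (x(v := t)) (head Q a)) =
      t * neighbour_sum Q v x + (\<Sum>a\<in>arcs Q. (x(v := 0)) (tail Q a) * (x(v := 0)) (head Q a))"
    unfolding neighbour_sum_def sum_distrib_left sum.distrib[symmetric]
  proof (rule sum.cong[OF refl])
    fix a assume "a \<in> arcs Q"
    then have "tail Q a \<noteq> head Q a" by (rule no_loops)
    then show "(x(v := t)) (tail Q a) * (x(v := t)) (head Q a) =
        t * ((if tail Q a = v then x (head Q a) else 0) + (if head Q a = v then x (tail Q a) else 0)) +
        (x(v := 0)) (tail Q a) * (x(v := 0)) (head Q a)" by auto
  qed
  ultimately show ?thesis by (simp add: tits_form_def)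
qed

lemma tits_form_reflection:
  assumes "v \<in> verts Q"
  shows "tits_form Q (reflection Q v x) = tits_form Q x"
  using tits_form_update[OF assms, of x "x v"] tits_form_update[OF assms, of x "neighbour_sum Q v x - x v"]
  by (simp add: reflection_def power2_eq_square algebra_simps)

lemma tits_form_reflections:
  "set vs \<subseteq> verts Q \<Longrightarrow> tits_form Q (fold (reflection Q) vs x) = tits_form Q x"
  by (induction vs arbitrary: x) (auto simp: tits_form_reflection)

lemma reflection_sum:
  "reflection Q v (\<lambda>u. \<Sum>t\<in>T. f t u) = (\<lambda>u. \<Sum>t\<in>T. reflection Q v (f t) u)"
proof -
  have "neighbour_sum Q v (\<lambda>u. \<Sum>t\<in>T. f t u) = (\<Sum>t\<in>T. neighbour_sum Q v (f t))"
    unfolding neighbour_sum_def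
    by (subst sum.swap, rule sum.cong[OF refl]) (auto simp: sum.distrib)
  then show ?thesis by (auto simp: reflection_def sum_subtractf)
qed

lemma reflections_sum:
  "fold (reflection Q) vs (\<lambda>u. \<Sum>t\<in>T. f t u) = (\<lambda>u. \<Sum>t\<in>T. fold (reflection Q) vs (f t) u)"
  by (induction vs arbitrary: f) (auto simp: reflection_sum)

lemma reflections_unchanged: "v \<notin> set vs \<Longrightarrow> fold (reflection Q) vs x v = x v"
  by (induction vs arbitrary: x) (auto simp: reflection_def)

text \<open>Reflections at distinct vertices change distinct coordinates, and none of them can undo what
another one has done.\<close>

lemma reflections_fixed:
  "\<lbrakk>distinct vs; fold (reflection Q) vs x = x; v \<in> set vs\<rbrakk> \<Longrightarrow> reflection Q v x = x"
proof (induction vs)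
  case (Cons w vs)
  have "reflection Q w x w = x w"
    using Cons.prems(1,2) reflections_unchanged[of w vs "reflection Q w x"] by simp
  then have "reflection Q w x = x" by (auto simp: reflection_def)
  then show ?case using Cons by auto
qed simp

text \<open>Twice the form at \<open>x\<close> is the sum of \<open>x v * (2 * x v - neighbour_sum Q v x)\<close>, and every summand
vanishes at a fixed vector.\<close>

lemma fixed_imp_zero:
  assumes "\<And>v. v \<in> verts Q \<Longrightarrow> reflection Q v x = x" "v \<in> verts Q"
  shows "x v = 0"
proof -
  have N: "neighbour_sum Q v x = 2 * x v" if "v \<in> verts Q" for v
    using fun_cong[OF assms(1)[OF that], of v] by (simp add: reflection_def)
  have "(\<Sum>v\<in>verts Q. x v * neighbour_sum Q v x) =
      (\<Sum>a\<in>arcs Q. \<Sum>v\<in>verts Q. x v * ((if tail Q a = v then x (head Q a) else 0) +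
        (if head Q a = v then x (tail Q a) else 0)))"
    unfolding neighbour_sum_def sum_distrib_left by (rule sum.swap)
  also have "\<dots> = (\<Sum>a\<in>arcs Q. 2 * (x (tail Q a) * x (head Q a)))"
    by (intro sum.cong refl) (simp add: distrib_left sum.distrib if_distrib[of "\<lambda>t. _ * t"] tail_in_verts head_in_verts cong: if_cong)
  finally have "2 * tits_form Q x = 0"
    by (simp add: N tits_form_def sum_distrib_left power2_eq_square algebra_simps)
  then show ?thesis using tits_form_pos[of v x] assms(2) by fastforce
qed

text \<open>The orbit of \<open>x\<close> under the Coxeter transformation is finite, because the form is constant on it. The
sum over one period is a fixed vector, hence zero; this is impossible if the orbit is
non-negative.\<close>

lemma exists_admissible_negative:
  assumes x: "x \<in> verts Q \<rightarrow>\<^sub>E UNIV" and u: "u \<in> verts Q" "x u \<noteq> 0"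
  obtains vs v where "admissible Q vs" "v \<in> verts Q" "fold (reflection Q) vs x v < 0"
proof (rule ccontr)
  assume no: "\<not> thesis"
  note * = that
  have nonneg: "0 \<le> fold (reflection Q) vs x v" if "admissible Q vs" "v \<in> verts Q" for vs v
    using *[OF that] no by force
  obtain ws where ws: "distinct ws" "set ws = verts Q" "admissible Q ws"
    using exists_complete_admissible by auto
  define c where "c = fold (reflection Q) ws"
  have adm: "admissible Q (concat (replicate t ws)) \<and> fold (reflection Q) (concat (replicate t ws)) = c ^^ t" for t
    by (induction t) (simp_all add: admissible_append ws fold_flip_complete c_def funpow_swap1 fun_eq_iff)
  have pos: "0 \<le> (c ^^ t) x v" if "v \<in> verts Q" for t v using nonneg[OF _ that] adm by metis
  have form: "tits_form Q ((c ^^ t) x) = tits_form Q x" for t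
    by (induction t) (simp_all add: c_def tits_form_reflections ws)
  have ext: "(c ^^ t) x \<in> verts Q \<rightarrow>\<^sub>E UNIV" for t
  proof -
    have "(c ^^ t) x v = x v" if "v \<notin> verts Q" for v
      by (induction t) (use that in \<open>simp_all add: c_def reflections_unchanged ws\<close>)
    then show ?thesis using x by (auto simp: PiE_iff extensional_def)
  qed
  have "range (\<lambda>t. (c ^^ t) x) \<subseteq> {y \<in> verts Q \<rightarrow>\<^sub>E UNIV. tits_form Q y \<le> tits_form Q x}"
    using form ext by (simp add: image_subset_iff)
  then have "finite (range (\<lambda>t. (c ^^ t) x))" using finite_tits_form_le by (rule finite_subset)
  then have "\<not> inj (\<lambda>t. (c ^^ t) x)" using range_inj_infinite by blast
  then obtain k l where kl: "k \<noteq> l" "(c ^^ k) x = (c ^^ l) x" by (auto simp: inj_on_def)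
  obtain m n where mn: "m < n" "(c ^^ m) x = (c ^^ n) x"
  proof (cases "k < l")
    case True
    then show thesis using that kl(2) by blast
  next
    case False
    then show thesis using that[of l k] kl by simp
  qed
  define z where "z = (c ^^ m) x"
  define p where "p = n - m"
  have "(c ^^ (p + m)) x = (c ^^ n) x" using mn(1) by (simp add: p_def)
  then have "(c ^^ p) z = z" by (simp only: funpow_add o_apply z_def mn(2))
  moreover have "p > 0" using mn(1) by (simp add: p_def)
  ultimately have p: "p > 0" "(c ^^ p) z = z" by auto
  define y where "y = (\<lambda>v. \<Sum>t<p. (c ^^ t) z v)"
  have "c y = (\<lambda>v. \<Sum>t<p. (c ^^ Suc t) z v)" unfolding y_def c_def reflections_sum by simp
  also have "\<dots> = y"
  proof
    fix v
    have "(\<Sum>t<p. (c ^^ Suc t) z v) + z v = (\<Sum>t<Suc p. (c ^^ t) z v)"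
      by (simp add: sum.lessThan_Suc_shift del: sum.lessThan_Suc)
    also have "\<dots> = y v + z v" using p(2) by (simp add: y_def)
    finally show "(\<Sum>t<p. (c ^^ Suc t) z v) = y v" by simp
  qed
  finally have "reflection Q v y = y" if "v \<in> verts Q" for v
    using reflections_fixed[of ws y v] ws that by (simp add: c_def)
  then have y0: "y v = 0" if "v \<in> verts Q" for v using fixed_imp_zero that by blast
  have "z v = 0" if v: "v \<in> verts Q" for v
  proof -
    have "0 \<le> (c ^^ t) z v" for t
      using pos[OF v, of "t + m"] by (simp add: z_def funpow_add)
    then have "(c ^^ 0) z v \<le> y v" unfolding y_def using p(1) by (intro member_le_sum) auto
    moreover have "0 \<le> z v" using pos[OF v] by (simp add: z_def)
    ultimately show ?thesis using y0[OF v] by simp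
  qed
  then have "tits_form Q z = 0" by (rule tits_form_zero)
  then show False using form[of m] tits_form_pos[of u x] u by (simp add: z_def)
qed

end

section \<open>Morphisms and idempotents\<close>

abbreviation vectors :: "('a, 'b, 'k, 'v) quiver_rep \<Rightarrow> 'a \<Rightarrow> 'v set" where
  "vectors X i \<equiv> carrier (rep_space X i)"

lemma rep_morphismD:
  assumes "rep_morphism K Q X Y \<phi>"
  shows "i \<in> verts Q \<Longrightarrow> linear_map K (rep_space X i) (rep_space Y i) (\<phi> i)"
    and "\<lbrakk>a \<in> arcs Q; v \<in> vectors X (tail Q a)\<rbrakk> \<Longrightarrow>
      rep_map Y a (\<phi> (tail Q a) v) = \<phi> (head Q a) (rep_map X a v)"
    and "\<lbrakk>i \<in> verts Q; v \<in> vectors X i\<rbrakk> \<Longrightarrow> \<phi> i v \<in> vectors Y i"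
  using assms by (auto simp: rep_morphism_def dest: linear_mapD(3))

lemma representationD:
  assumes "representation K Q X"
  shows "i \<in> verts Q \<Longrightarrow> vectorspace K (rep_space X i)"
    and "a \<in> arcs Q \<Longrightarrow> linear_map K (rep_space X (tail Q a)) (rep_space X (head Q a)) (rep_map X a)"
    and "\<lbrakk>a \<in> arcs Q; v \<in> vectors X (tail Q a)\<rbrakk> \<Longrightarrow>
      rep_map X a v \<in> vectors X (head Q a)"
  using assms by (auto simp: representation_def dest: linear_mapD(3))

lemma rep_morphism_comp:
  assumes "wf_digraph Q" "rep_morphism K Q X Y \<phi>" "rep_morphism K Q Y Z \<psi>"
  shows "rep_morphism K Q X Z (\<lambda>i v. \<psi> i (\<phi> i v))"
proof -
  interpret wf_digraph Q by fact
  show ?thesis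
    unfolding rep_morphism_def
    using linear_map_comp[OF rep_morphismD(1)[OF assms(2)] rep_morphismD(1)[OF assms(3)]]
    by (auto simp: o_def rep_morphismD[OF assms(2)] rep_morphismD[OF assms(3)])
qed

lemma rep_morphism_id:
  "representation K Q X \<Longrightarrow> rep_morphism K Q X X (\<lambda>i v. v)"
  by (auto simp: rep_morphism_def representation_def intro: linear_map_id)

lemma rep_morphism_zero:
  assumes "wf_digraph Q" "representation K Q X" "representation K Q Y"
  shows "rep_morphism K Q X Y (\<lambda>i v. \<zero>\<^bsub>rep_space Y i\<^esub>)"
proof -
  interpret wf_digraph Q by fact
  show ?thesis
    unfolding rep_morphism_def
    using linear_map_zero[OF representationD(1)[OF assms(2)] representationD(1)[OF assms(3)]]
      linear_mapD(7)[OF representationD(2)[OF assms(3)]] by auto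
qed

lemma rep_isomorphic_inverse:
  assumes "wf_digraph Q" "representation K Q X" "rep_isomorphic K Q X Y"
  obtains \<phi> \<psi> where "rep_morphism K Q X Y \<phi>" "rep_morphism K Q Y X \<psi>"
    "\<And>i v. \<lbrakk>i \<in> verts Q; v \<in> vectors X i\<rbrakk> \<Longrightarrow> \<psi> i (\<phi> i v) = v"
    "\<And>i w. \<lbrakk>i \<in> verts Q; w \<in> vectors Y i\<rbrakk> \<Longrightarrow> \<phi> i (\<psi> i w) = w"
proof -
  interpret wf_digraph Q by fact
  obtain \<phi> where \<phi>: "rep_morphism K Q X Y \<phi>"
    and b: "\<And>i. i \<in> verts Q \<Longrightarrow> bij_betw (\<phi> i) (vectors X i) (vectors Y i)"
    using assms(3) by (auto simp: rep_isomorphic_def)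
  define \<psi> where "\<psi> i = inv_into (vectors X i) (\<phi> i)" for i
  have l: "\<psi> i (\<phi> i v) = v" if "i \<in> verts Q" "v \<in> vectors X i" for i v
    using b that by (simp add: \<psi>_def bij_betw_def)
  have r: "\<phi> i (\<psi> i w) = w" "\<psi> i w \<in> vectors X i"
    if "i \<in> verts Q" "w \<in> vectors Y i" for i w
    using b[OF that(1)] that(2) by (auto simp: \<psi>_def bij_betw_def f_inv_into_f inv_into_into)
  have "rep_morphism K Q Y X \<psi>"
    unfolding rep_morphism_def
  proof (intro conjI ballI)
    fix i assume "i \<in> verts Q"
    then show "linear_map K (rep_space Y i) (rep_space X i) (\<psi> i)"
      unfolding \<psi>_def using b rep_morphismD(1)[OF \<phi>] by (blast intro: linear_map_inv_into)
  next
    fix a w assume a: "a \<in> arcs Q" and w: "w \<in> vectors Y (tail Q a)"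
    define v where "v = \<psi> (tail Q a) w"
    have v: "v \<in> vectors X (tail Q a)" "w = \<phi> (tail Q a) v"
      using r[OF tail_in_verts[OF a] w] by (auto simp: v_def)
    show "rep_map X a (\<psi> (tail Q a) w) = \<psi> (head Q a) (rep_map Y a w)"
      unfolding v(2) using a v(1) representationD(3)[OF assms(2) a v(1)]
      by (simp add: l rep_morphismD(2)[OF \<phi>])
  qed
  with \<phi> l r that show thesis by blast
qed

lemma rep_isomorphicI:
  assumes "rep_morphism K Q X Y \<phi>" "rep_morphism K Q Y X \<psi>"
    "\<And>i v. \<lbrakk>i \<in> verts Q; v \<in> vectors X i\<rbrakk> \<Longrightarrow> \<psi> i (\<phi> i v) = v"
    "\<And>i w. \<lbrakk>i \<in> verts Q; w \<in> vectors Y i\<rbrakk> \<Longrightarrow> \<phi> i (\<psi> i w) = w"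
  shows "rep_isomorphic K Q X Y"
proof -
  have "bij_betw (\<phi> i) (vectors X i) (vectors Y i)" if "i \<in> verts Q" for i
    by (rule bij_betw_byWitness[of _ "\<psi> i"])
      (use that assms(3,4) rep_morphismD(3)[OF assms(1)] rep_morphismD(3)[OF assms(2)] in auto)
  then show ?thesis using assms(1) by (auto simp: rep_isomorphic_def)
qed

text \<open>Indecomposability in terms of endomorphisms, which unlike direct sum decompositions can be
carried along a correspondence of morphisms.\<close>

definition trivial_idempotents ::
  "('k, 'm) ring_scheme \<Rightarrow> ('a, 'b) pre_digraph \<Rightarrow> ('a, 'b, 'k, 'v) quiver_rep \<Rightarrow> bool" where
  "trivial_idempotents K Q X \<longleftrightarrow> \<not> rep_zero Q X \<and>
     (\<forall>e. rep_morphism K Q X X e \<longrightarrow>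
        (\<forall>i\<in>verts Q. \<forall>v\<in>vectors X i. e i (e i v) = e i v) \<longrightarrow>
        (\<forall>i\<in>verts Q. \<forall>v\<in>vectors X i. e i v = \<zero>\<^bsub>rep_space X i\<^esub>) \<or>
        (\<forall>i\<in>verts Q. \<forall>v\<in>vectors X i. e i v = v))"

lemma zero_in_rep_space:
  assumes "representation K Q X" "i \<in> verts Q"
  shows "\<zero>\<^bsub>rep_space X i\<^esub> \<in> vectors X i"
proof -
  interpret vectorspace K "rep_space X i" using representationD(1)[OF assms] .
  show ?thesis by (rule M.zero_closed)
qed

lemma rep_morphism_first_projection:
  assumes "wf_digraph Q" "representation K Q X" "representation K Q Y"
  shows "rep_morphism K Q (rep_sum X Y) (rep_sum X Y) (\<lambda>i p. (fst p, \<zero>\<^bsub>rep_space Y i\<^esub>))"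
proof -
  interpret wf_digraph Q by fact
  have "linear_map K (direct_sum (rep_space X i) (rep_space Y i))
      (direct_sum (rep_space X i) (rep_space Y i)) (\<lambda>p. (fst p, \<zero>\<^bsub>rep_space Y i\<^esub>))"
    if i: "i \<in> verts Q" for i
  proof -
    interpret X: vectorspace K "rep_space X i" using representationD(1)[OF assms(2) i] .
    interpret Y: vectorspace K "rep_space Y i" using representationD(1)[OF assms(3) i] .
    show ?thesis
      by (rule linear_mapI)
        (auto simp: direct_sum_def intro!: direct_sum_is_vs[unfolded direct_sum_def] X.vectorspace_axioms Y.vectorspace_axioms)
  qed
  then show ?thesis
    unfolding rep_morphism_def
    using linear_mapD(7)[OF representationD(2)[OF assms(3)]]
    by (auto simp: rep_sum_def)
qed

text \<open>The projection onto the first summand of a decomposition is an idempotent endomorphism.\<close>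

lemma trivial_idempotents_imp_indecomposable:
  fixes K :: "('k, 'm) ring_scheme" and Q :: "('a, 'b) pre_digraph"
    and X :: "('a, 'b, 'k, 'v) quiver_rep"
  assumes Q: "wf_digraph Q" and X: "representation K Q X" and t: "trivial_idempotents K Q X"
  shows "indecomposable K Q X"
  unfolding indecomposable_def
proof (intro conjI allI impI)
  show "\<not> rep_zero Q X" using t by (simp add: trivial_idempotents_def)
  fix X1 X2 :: "('a, 'b, 'k, 'v) quiver_rep"
  assume "representation K Q X1 \<and> representation K Q X2 \<and> rep_isomorphic K Q X (rep_sum X1 X2)"
  then have X12: "representation K Q X1" "representation K Q X2"
    and iso: "rep_isomorphic K Q X (rep_sum X1 X2)" by auto
  obtain \<phi> \<psi> where \<phi>: "rep_morphism K Q X (rep_sum X1 X2) \<phi>"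
    and \<psi>: "rep_morphism K Q (rep_sum X1 X2) X \<psi>"
    and l: "\<And>i v. \<lbrakk>i \<in> verts Q; v \<in> vectors X i\<rbrakk> \<Longrightarrow> \<psi> i (\<phi> i v) = v"
    and r: "\<And>i w. \<lbrakk>i \<in> verts Q; w \<in> vectors (rep_sum X1 X2) i\<rbrakk> \<Longrightarrow> \<phi> i (\<psi> i w) = w"
    using rep_isomorphic_inverse[OF Q X iso] by metis
  let ?p = "\<lambda>i w. (fst w, \<zero>\<^bsub>rep_space X2 i\<^esub>)"
  have p: "rep_morphism K Q (rep_sum X1 X2) (rep_sum X1 X2) ?p"
    by (rule rep_morphism_first_projection[OF Q X12])
  define e where "e i v = \<psi> i (?p i (\<phi> i v))" for i v
  have e: "rep_morphism K Q X X e"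
    unfolding e_def using rep_morphism_comp[OF Q rep_morphism_comp[OF Q \<phi> p] \<psi>] by simp
  have S: "(x, y) \<in> vectors (rep_sum X1 X2) i \<longleftrightarrow>
      x \<in> vectors X1 i \<and> y \<in> vectors X2 i" for i x y
    by (simp add: rep_sum_def direct_sum_def)
  have e\<psi>: "e i (\<psi> i (x, y)) = \<psi> i (x, \<zero>\<^bsub>rep_space X2 i\<^esub>)"
    if "i \<in> verts Q" "x \<in> vectors X1 i" "y \<in> vectors X2 i" for i x y
    using r[of i "(x, y)"] that S by (simp add: e_def)
  have surj: "\<exists>x y. v = \<psi> i (x, y) \<and> x \<in> vectors X1 i \<and> y \<in> vectors X2 i"
    if "i \<in> verts Q" "v \<in> vectors X i" for i v
    using l[OF that] rep_morphismD(3)[OF \<phi> that] S by (metis surj_pair)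
  have "e i (e i v) = e i v" if "i \<in> verts Q" "v \<in> vectors X i" for i v
    using surj[OF that] e\<psi> that(1) zero_in_rep_space[OF X12(2) that(1)] by auto
  then have "(\<forall>i\<in>verts Q. \<forall>v\<in>vectors X i. e i v = \<zero>\<^bsub>rep_space X i\<^esub>) \<or>
      (\<forall>i\<in>verts Q. \<forall>v\<in>vectors X i. e i v = v)"
    using t e by (simp add: trivial_idempotents_def)
  then show "rep_zero Q X1 \<or> rep_zero Q X2"
  proof
    assume z: "\<forall>i\<in>verts Q. \<forall>v\<in>vectors X i. e i v = \<zero>\<^bsub>rep_space X i\<^esub>"
    have "x = \<zero>\<^bsub>rep_space X1 i\<^esub>" if i: "i \<in> verts Q" and x: "x \<in> vectors X1 i" for i x
    proof -
      let ?w = "(x, \<zero>\<^bsub>rep_space X2 i\<^esub>)"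
      have w: "?w \<in> vectors (rep_sum X1 X2) i" using S x zero_in_rep_space[OF X12(2) i] by simp
      have "\<psi> i ?w = \<zero>\<^bsub>rep_space X i\<^esub>"
        using e\<psi>[OF i x zero_in_rep_space[OF X12(2) i]] z i rep_morphismD(3)[OF \<psi> i w] by simp
      then have "?w = \<zero>\<^bsub>rep_space (rep_sum X1 X2) i\<^esub>"
        using r[OF i w] linear_mapD(7)[OF rep_morphismD(1)[OF \<phi> i]] by simp
      then show ?thesis by (simp add: rep_sum_def direct_sum_def)
    qed
    then have "rep_zero Q X1" using zero_in_rep_space[OF X12(1)] by (auto simp: rep_zero_def)
    then show ?thesis ..
  next
    assume z: "\<forall>i\<in>verts Q. \<forall>v\<in>vectors X i. e i v = v"
    have "y = \<zero>\<^bsub>rep_space X2 i\<^esub>" if i: "i \<in> verts Q" and y: "y \<in> vectors X2 i" for i y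
    proof -
      let ?z = "\<zero>\<^bsub>rep_space X1 i\<^esub>"
      note 0 = zero_in_rep_space[OF X12(1) i] zero_in_rep_space[OF X12(2) i]
      have w: "(?z, y) \<in> vectors (rep_sum X1 X2) i" using S y 0 by simp
      have "\<psi> i (?z, y) = \<psi> i (?z, \<zero>\<^bsub>rep_space X2 i\<^esub>)"
        using e\<psi>[OF i 0(1) y] z i rep_morphismD(3)[OF \<psi> i w] by simp
      then have "(?z, y) = (?z, \<zero>\<^bsub>rep_space X2 i\<^esub>)" using r[OF i w] r[OF i, of "(?z, \<zero>\<^bsub>rep_space X2 i\<^esub>)"] S 0 by metis
      then show ?thesis by simp
    qed
    then have "rep_zero Q X2" using zero_in_rep_space[OF X12(2)] by (auto simp: rep_zero_def)
    then show ?thesis ..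
  qed
qed

text \<open>An idempotent \<open>e\<close> decomposes \<open>X\<close> into its image and its kernel, by \<open>v \<mapsto> (e v, v - e v)\<close>.\<close>

lemma indecomposable_imp_trivial_idempotents:
  assumes Q: "wf_digraph Q" and X: "representation K Q X" and ind: "indecomposable K Q X"
  shows "trivial_idempotents K Q X"
  unfolding trivial_idempotents_def
proof (intro conjI allI impI)
  show "\<not> rep_zero Q X" using ind by (simp add: indecomposable_def)
  fix e assume e: "rep_morphism K Q X X e"
    and idem: "\<forall>i\<in>verts Q. \<forall>v\<in>vectors X i. e i (e i v) = e i v"
  interpret wf_digraph Q by fact
  let ?im = "\<lambda>i. e i ` vectors X i"
  let ?ker = "\<lambda>i. {v \<in> vectors X i. e i v = \<zero>\<^bsub>rep_space X i\<^esub>}"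
  define X1 where "X1 = \<lparr>rep_space = (\<lambda>i. (rep_space X i)\<lparr>carrier := ?im i\<rparr>), rep_map = rep_map X\<rparr>"
  define X2 where "X2 = \<lparr>rep_space = (\<lambda>i. (rep_space X i)\<lparr>carrier := ?ker i\<rparr>), rep_map = rep_map X\<rparr>"
  have im: "submodule K (?im i) (rep_space X i)" and ker: "submodule K (?ker i) (rep_space X i)"
    if "i \<in> verts Q" for i
  proof -
    interpret linear_map K "rep_space X i" "rep_space X i" "e i" by (rule rep_morphismD(1)[OF e that])
    show "submodule K (?im i) (rep_space X i)" using im_is_submodule by (simp add: im_def)
    show "submodule K (?ker i) (rep_space X i)" using ker_is_submodule by (simp add: ker_def)
  qed
  have vs: "vectorspace K ((rep_space X i)\<lparr>carrier := N\<rparr>)" if "i \<in> verts Q" "submodule K N (rep_space X i)" for i N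
    using linear_mapD(1)[OF linear_map_from_subspace[OF linear_map_id[OF representationD(1)[OF X that(1)]] that(2)]] .
  have X1: "representation K Q X1"
    unfolding representation_def
  proof (intro conjI ballI)
    fix a assume a: "a \<in> arcs Q"
    have "rep_map X a v \<in> ?im (head Q a)" if "v \<in> ?im (tail Q a)" for v
      using that by (auto simp: rep_morphismD(2)[OF e a] representationD(3)[OF X a])
    with linear_map_to_subspace[OF linear_map_from_subspace[OF representationD(2)[OF X a]
      im[OF tail_in_verts[OF a]]] im[OF head_in_verts[OF a]]]
    show "linear_map K (rep_space X1 (tail Q a)) (rep_space X1 (head Q a)) (rep_map X1 a)"
      by (simp add: X1_def)
  qed (use vs im in \<open>auto simp: X1_def\<close>)
  have X2: "representation K Q X2"
    unfolding representation_def
  proof (intro conjI ballI)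
    fix a assume a: "a \<in> arcs Q"
    have "rep_map X a v \<in> ?ker (head Q a)" if "v \<in> ?ker (tail Q a)" for v
      using that rep_morphismD(2)[OF e a, of v] representationD(3)[OF X a, of v]
        linear_mapD(7)[OF representationD(2)[OF X a]] by simp
    with linear_map_to_subspace[OF linear_map_from_subspace[OF representationD(2)[OF X a]
      ker[OF tail_in_verts[OF a]]] ker[OF head_in_verts[OF a]]]
    show "linear_map K (rep_space X2 (tail Q a)) (rep_space X2 (head Q a)) (rep_map X2 a)"
      by (simp add: X2_def)
  qed (use vs ker in \<open>auto simp: X2_def\<close>)
  define \<phi> where "\<phi> i v = (e i v, v \<ominus>\<^bsub>rep_space X i\<^esub> e i v)" for i v
  have S: "rep_space (rep_sum X1 X2) i = direct_sum ((rep_space X i)\<lparr>carrier := ?im i\<rparr>) ((rep_space X i)\<lparr>carrier := ?ker i\<rparr>)" for i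
    by (simp add: rep_sum_def X1_def X2_def)
  have lin: "linear_map K (rep_space X i) (rep_space (rep_sum X1 X2) i) (\<phi> i)"
    and bij: "bij_betw (\<phi> i) (vectors X i) (vectors (rep_sum X1 X2) i)"
    if i: "i \<in> verts Q" for i
  proof -
    interpret E: linear_map K "rep_space X i" "rep_space X i" "e i" by (rule rep_morphismD(1)[OF e i])
    note d = linear_mapD[OF linear_map_id_minus[OF E.linear_map_axioms]]
    have idem': "e i (e i v) = e i v" if "v \<in> vectors X i" for v using idem i that by auto
    have k: "v \<ominus>\<^bsub>rep_space X i\<^esub> e i v \<in> ?ker i" if "v \<in> vectors X i" for v
      using that idem'[OF that] by (simp add: E.V.module.M.minus_eq E.V.module.M.r_neg)
    show "linear_map K (rep_space X i) (rep_space (rep_sum X1 X2) i) (\<phi> i)"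
    proof (rule linear_mapI)
      show "vectorspace K (rep_space X i)" by unfold_locales
      show "vectorspace K (rep_space (rep_sum X1 X2) i)"
        unfolding S by (rule direct_sum_is_vs[OF vs[OF i im[OF i]] vs[OF i ker[OF i]]])
    qed (use k d(4,5) in \<open>auto simp: S direct_sum_def \<phi>_def\<close>)
    show "bij_betw (\<phi> i) (vectors X i) (vectors (rep_sum X1 X2) i)"
    proof (rule bij_betw_byWitness[of _ "\<lambda>p. fst p \<oplus>\<^bsub>rep_space X i\<^esub> snd p"])
      show "\<forall>v\<in>vectors X i. fst (\<phi> i v) \<oplus>\<^bsub>rep_space X i\<^esub> snd (\<phi> i v) = v"
        by (auto simp: \<phi>_def E.V.module.M.minus_eq E.V.module.M.add.m_lcomm[of "e i _"] E.V.module.M.r_neg)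
      show "\<forall>p\<in>vectors (rep_sum X1 X2) i. \<phi> i (fst p \<oplus>\<^bsub>rep_space X i\<^esub> snd p) = p"
      proof
        fix p assume "p \<in> vectors (rep_sum X1 X2) i"
        then obtain v w where p: "p = (e i v, w)" "v \<in> vectors X i" "w \<in> vectors X i"
          "e i w = \<zero>\<^bsub>rep_space X i\<^esub>" by (auto simp: S direct_sum_def)
        have "e i v \<oplus>\<^bsub>rep_space X i\<^esub> w \<ominus>\<^bsub>rep_space X i\<^esub> e i v = w"
          using p(2,3) by (simp add: E.V.module.M.minus_eq E.V.module.M.add.m_comm[of "e i v" w] E.V.module.M.add.m_assoc E.V.module.M.r_neg)
        then show "\<phi> i (fst p \<oplus>\<^bsub>rep_space X i\<^esub> snd p) = p"
          using p idem'[OF p(2)] by (simp add: \<phi>_def)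
      qed
    qed (use k in \<open>auto simp: S direct_sum_def \<phi>_def\<close>)
  qed
  have "rep_morphism K Q X (rep_sum X1 X2) \<phi>"
    unfolding rep_morphism_def
  proof (intro conjI ballI lin)
    fix a v assume a: "a \<in> arcs Q" and v: "v \<in> vectors X (tail Q a)"
    show "rep_map (rep_sum X1 X2) a (\<phi> (tail Q a) v) = \<phi> (head Q a) (rep_map X a v)"
      using linear_mapD(6)[OF representationD(2)[OF X a] v rep_morphismD(3)[OF e tail_in_verts[OF a] v]]
      by (simp add: rep_sum_def X1_def X2_def \<phi>_def rep_morphismD(2)[OF e a v])
  qed
  then have "rep_isomorphic K Q X (rep_sum X1 X2)" using bij by (auto simp: rep_isomorphic_def)
  then have "rep_zero Q X1 \<or> rep_zero Q X2" using ind X1 X2 by (auto simp: indecomposable_def)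
  then show "(\<forall>i\<in>verts Q. \<forall>v\<in>vectors X i. e i v = \<zero>\<^bsub>rep_space X i\<^esub>) \<or>
        (\<forall>i\<in>verts Q. \<forall>v\<in>vectors X i. e i v = v)"
  proof
    assume "rep_zero Q X1"
    then show ?thesis by (auto simp: rep_zero_def X1_def)
  next
    assume z: "rep_zero Q X2"
    have "e i v = v" if i: "i \<in> verts Q" and v: "v \<in> vectors X i" for i v
    proof -
      interpret E: linear_map K "rep_space X i" "rep_space X i" "e i" by (rule rep_morphismD(1)[OF e i])
      have "v \<ominus>\<^bsub>rep_space X i\<^esub> e i v \<in> ?ker i"
        using v idem i by (simp add: E.V.module.M.minus_eq E.V.module.M.r_neg)
      then have "v \<ominus>\<^bsub>rep_space X i\<^esub> e i v = \<zero>\<^bsub>rep_space X i\<^esub>"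
        using z i by (auto simp: rep_zero_def X2_def)
      then show ?thesis using v by (simp add: E.V.module.M.minus_other_side)
    qed
    then show ?thesis by blast
  qed
qed

section \<open>Morphisms determined away from one vertex\<close>

text \<open>The next three notions isolate what a reflection at \<open>i\<close> does to morphisms, without reference to the
orientation: a morphism is determined by its components at the vertices other than \<open>i\<close>, and these
components extend to a morphism on the other side.\<close>

definition agree_off ::
  "('a, 'b) pre_digraph \<Rightarrow> 'a \<Rightarrow> ('a, 'b, 'k, 'v) quiver_rep \<Rightarrow> ('a \<Rightarrow> 'v \<Rightarrow> 'w) \<Rightarrow> ('a \<Rightarrow> 'v \<Rightarrow> 'w) \<Rightarrow> bool" where
  "agree_off Q i X \<phi> \<psi> \<longleftrightarrow> (\<forall>j\<in>verts Q - {i}. \<forall>v\<in>vectors X j. \<phi> j v = \<psi> j v)"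

definition determined_off ::
  "('k, 'm) ring_scheme \<Rightarrow> ('a, 'b) pre_digraph \<Rightarrow> 'a \<Rightarrow> ('a, 'b, 'k, 'v) quiver_rep \<Rightarrow>
   ('a, 'b, 'k, 'w) quiver_rep \<Rightarrow> bool" where
  "determined_off K Q i X Y \<longleftrightarrow> (\<forall>\<phi> \<psi>. rep_morphism K Q X Y \<phi> \<longrightarrow> rep_morphism K Q X Y \<psi> \<longrightarrow>
     agree_off Q i X \<phi> \<psi> \<longrightarrow> (\<forall>j\<in>verts Q. \<forall>v\<in>vectors X j. \<phi> j v = \<psi> j v))"

definition morphisms_extend ::
  "('k, 'm) ring_scheme \<Rightarrow> 'a \<Rightarrow>
   ('a, 'b) pre_digraph \<Rightarrow> ('a, 'b, 'k, 'v) quiver_rep \<Rightarrow> ('a, 'b, 'k, 'v) quiver_rep \<Rightarrow>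
   ('a, 'b) pre_digraph \<Rightarrow> ('a, 'b, 'k, 'v) quiver_rep \<Rightarrow> ('a, 'b, 'k, 'v) quiver_rep \<Rightarrow> bool" where
  "morphisms_extend K i Q X X' R Y Y' \<longleftrightarrow>
     (\<forall>\<phi>. rep_morphism K Q X X' \<phi> \<longrightarrow> (\<exists>\<psi>. rep_morphism K R Y Y' \<psi> \<and> (\<forall>j\<in>verts Q - {i}. \<psi> j = \<phi> j)))"

text \<open>Extend the isomorphism and its inverse. The composites of the extensions agree with the identity
away from \<open>i\<close>, hence everywhere.\<close>

lemma isomorphism_transfer:
  assumes Q: "wf_digraph Q" and R: "wf_digraph R" and verts: "verts R = verts Q"
    and X: "representation K Q X" and Y: "representation K R Y" and Y': "representation K R Y'"
    and XY: "\<And>j. j \<in> verts Q - {i} \<Longrightarrow> rep_space Y j = rep_space X j"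
    and XY': "\<And>j. j \<in> verts Q - {i} \<Longrightarrow> rep_space Y' j = rep_space X' j"
    and ext: "morphisms_extend K i Q X X' R Y Y'" "morphisms_extend K i Q X' X R Y' Y"
    and det: "determined_off K R i Y Y" "determined_off K R i Y' Y'"
    and iso: "rep_isomorphic K Q X X'"
  shows "rep_isomorphic K R Y Y'"
proof -
  obtain \<phi> \<phi>' where \<phi>: "rep_morphism K Q X X' \<phi>" and \<phi>': "rep_morphism K Q X' X \<phi>'"
    and l: "\<And>j v. \<lbrakk>j \<in> verts Q; v \<in> vectors X j\<rbrakk> \<Longrightarrow> \<phi>' j (\<phi> j v) = v"
    and r: "\<And>j w. \<lbrakk>j \<in> verts Q; w \<in> vectors X' j\<rbrakk> \<Longrightarrow> \<phi> j (\<phi>' j w) = w"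
    using rep_isomorphic_inverse[OF Q X iso] by metis
  obtain \<psi> where \<psi>: "rep_morphism K R Y Y' \<psi>" "\<And>j. j \<in> verts Q - {i} \<Longrightarrow> \<psi> j = \<phi> j"
    using ext(1) \<phi> unfolding morphisms_extend_def by blast
  obtain \<psi>' where \<psi>': "rep_morphism K R Y' Y \<psi>'" "\<And>j. j \<in> verts Q - {i} \<Longrightarrow> \<psi>' j = \<phi>' j"
    using ext(2) \<phi>' unfolding morphisms_extend_def by blast
  show ?thesis
  proof (rule rep_isomorphicI[OF \<psi>(1) \<psi>'(1)])
    have "agree_off R i Y (\<lambda>j v. \<psi>' j (\<psi> j v)) (\<lambda>j v. v)"
      using l by (auto simp: agree_off_def verts \<psi>(2) \<psi>'(2) XY)
    then show "\<psi>' j (\<psi> j v) = v" if "j \<in> verts R" "v \<in> vectors Y j" for j v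
      using det(1) rep_morphism_comp[OF R \<psi>(1) \<psi>'(1)] rep_morphism_id[OF Y] that
      unfolding determined_off_def by blast
    have "agree_off R i Y' (\<lambda>j v. \<psi> j (\<psi>' j v)) (\<lambda>j v. v)"
      using r by (auto simp: agree_off_def verts \<psi>(2) \<psi>'(2) XY')
    then show "\<psi> j (\<psi>' j v) = v" if "j \<in> verts R" "v \<in> vectors Y' j" for j v
      using det(2) rep_morphism_comp[OF R \<psi>'(1) \<psi>(1)] rep_morphism_id[OF Y'] that
      unfolding determined_off_def by blast
  qed
qed

text \<open>An idempotent \<open>e\<close> of \<open>Y\<close> has the same components away from \<open>i\<close> as some endomorphism \<open>d\<close> of \<open>X\<close>.
There \<open>d \<circ> d\<close> agrees with \<open>d\<close>, so \<open>d\<close> is idempotent, hence 0 or 1; then \<open>e\<close> agrees with 0 or 1 away from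
\<open>i\<close>, hence everywhere.\<close>

lemma trivial_idempotents_transfer:
  assumes Q: "wf_digraph Q" and R: "wf_digraph R" and verts: "verts R = verts Q"
    and X: "representation K Q X" and Y: "representation K R Y"
    and XY: "\<And>j. j \<in> verts Q - {i} \<Longrightarrow> rep_space Y j = rep_space X j"
    and ext: "morphisms_extend K i R Y Y Q X X"
    and det: "determined_off K Q i X X" "determined_off K R i Y Y"
    and t: "trivial_idempotents K Q X"
  shows "trivial_idempotents K R Y"
  unfolding trivial_idempotents_def
proof (intro conjI allI impI notI)
  assume z: "rep_zero R Y"
  have "agree_off Q i X (\<lambda>j v. v) (\<lambda>j v. \<zero>\<^bsub>rep_space X j\<^esub>)"
    unfolding agree_off_def
  proof (intro ballI)
    fix j v assume "j \<in> verts Q - {i}" "v \<in> vectors X j"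
    then show "v = \<zero>\<^bsub>rep_space X j\<^esub>" using z XY[of j] by (auto simp: rep_zero_def verts)
  qed
  then have "v = \<zero>\<^bsub>rep_space X j\<^esub>" if "j \<in> verts Q" "v \<in> vectors X j" for j v
    using det(1) rep_morphism_id[OF X] rep_morphism_zero[OF Q X X] that
    unfolding determined_off_def by blast
  then have "rep_zero Q X" using zero_in_rep_space[OF X] by (auto simp: rep_zero_def)
  then show False using t by (simp add: trivial_idempotents_def)
next
  fix e assume e: "rep_morphism K R Y Y e"
    and idem: "\<forall>j\<in>verts R. \<forall>v\<in>vectors Y j. e j (e j v) = e j v"
  obtain d where d: "rep_morphism K Q X X d" "\<And>j. j \<in> verts Q - {i} \<Longrightarrow> d j = e j"
    using ext e unfolding morphisms_extend_def verts by blast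
  have "agree_off Q i X (\<lambda>j v. d j (d j v)) d"
    unfolding agree_off_def
  proof (intro ballI)
    fix j v assume "j \<in> verts Q - {i}" "v \<in> vectors X j"
    then show "d j (d j v) = d j v" using idem XY[of j] d(2)[of j] by (simp add: verts)
  qed
  then have "d j (d j v) = d j v" if "j \<in> verts Q" "v \<in> vectors X j" for j v
    using det(1) rep_morphism_comp[OF Q d(1) d(1)] d(1) that
    unfolding determined_off_def by blast
  then consider "\<forall>j\<in>verts Q. \<forall>v\<in>vectors X j. d j v = \<zero>\<^bsub>rep_space X j\<^esub>"
    | "\<forall>j\<in>verts Q. \<forall>v\<in>vectors X j. d j v = v"
    using t d(1) unfolding trivial_idempotents_def by blast
  then show "(\<forall>j\<in>verts R. \<forall>v\<in>vectors Y j. e j v = \<zero>\<^bsub>rep_space Y j\<^esub>) \<or>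
        (\<forall>j\<in>verts R. \<forall>v\<in>vectors Y j. e j v = v)"
  proof cases
    case 1
    have "agree_off R i Y e (\<lambda>j v. \<zero>\<^bsub>rep_space Y j\<^esub>)"
      unfolding agree_off_def
    proof (intro ballI)
      fix j v assume "j \<in> verts R - {i}" "v \<in> vectors Y j"
      then show "e j v = \<zero>\<^bsub>rep_space Y j\<^esub>" using 1 XY[of j] d(2)[of j, symmetric] by (simp add: verts)
    qed
    then show ?thesis
      using det(2) e rep_morphism_zero[OF R Y Y] unfolding determined_off_def by blast
  next
    case 2
    have "agree_off R i Y e (\<lambda>j v. v)"
      unfolding agree_off_def
    proof (intro ballI)
      fix j v assume "j \<in> verts R - {i}" "v \<in> vectors Y j"
      then show "e j v = v" using 2 XY[of j] d(2)[of j, symmetric] by (simp add: verts)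
    qed
    then show ?thesis
      using det(2) e rep_morphism_id[OF Y] unfolding determined_off_def by blast
  qed
qed

section \<open>Reflection at a sink\<close>

text \<open>In the rest of this section \<open>Q\<close> is always the orientation for which \<open>i\<close> is a sink. Accordingly,
\<open>outgoing_map Q Y i\<close> is for representations \<open>Y\<close> of \<open>flip i Q\<close>: it is indexed by the arcs of \<open>Q\<close> that
end in \<open>i\<close>, which in \<open>flip i Q\<close> start there.\<close>

definition incoming_space ::
  "('a, 'b) pre_digraph \<Rightarrow> ('a, 'b, 'k, 'v) quiver_rep \<Rightarrow> 'a \<Rightarrow> ('k, 'b \<Rightarrow> 'v) module" where
  "incoming_space Q X i = prod_space (in_arcs Q i) (\<lambda>a. rep_space X (tail Q a))"

definition incoming_map ::
  "('a, 'b) pre_digraph \<Rightarrow> ('a, 'b, 'k, 'v) quiver_rep \<Rightarrow> 'a \<Rightarrow> ('b \<Rightarrow> 'v) \<Rightarrow> 'v" where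
  "incoming_map Q X i f = finsum (rep_space X i) (\<lambda>a. rep_map X a (f a)) (in_arcs Q i)"

definition outgoing_map ::
  "('a, 'b) pre_digraph \<Rightarrow> ('a, 'b, 'k, 'v) quiver_rep \<Rightarrow> 'a \<Rightarrow> 'v \<Rightarrow> 'b \<Rightarrow> 'v" where
  "outgoing_map Q Y i y = (\<lambda>a\<in>in_arcs Q i. rep_map Y a y)"

definition tuple_map :: "('a, 'b) pre_digraph \<Rightarrow> 'a \<Rightarrow> ('a \<Rightarrow> 'v \<Rightarrow> 'w) \<Rightarrow> ('b \<Rightarrow> 'v) \<Rightarrow> 'b \<Rightarrow> 'w" where
  "tuple_map Q i \<phi> f = (\<lambda>a\<in>in_arcs Q i. \<phi> (tail Q a) (f a))"

text \<open>The reflection functors at a sink and at a source in the form of one relation. It does not choose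
kernels or cokernels, and so it can be read in both directions. The spaces at the other vertices
are required to be equal rather than isomorphic, which makes it meaningful to say that a morphism
of \<open>X\<close> and one of \<open>Y\<close> have the same components there.\<close>

definition reflected ::
  "('k, 'm) ring_scheme \<Rightarrow> ('a, 'b) pre_digraph \<Rightarrow> 'a \<Rightarrow>
   ('a, 'b, 'k, 'v) quiver_rep \<Rightarrow> ('a, 'b, 'k, 'v) quiver_rep \<Rightarrow> bool" where
  "reflected K Q i X Y \<longleftrightarrow>
     representation K Q X \<and> finite_dimensional K Q X \<and>
     representation K (flip i Q) Y \<and> finite_dimensional K (flip i Q) Y \<and>
     (\<forall>j\<in>verts Q - {i}. rep_space Y j = rep_space X j) \<and>
     (\<forall>a\<in>arcs Q - in_arcs Q i. rep_map Y a = rep_map X a) \<and>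
     incoming_map Q X i ` carrier (incoming_space Q X i) = vectors X i \<and>
     inj_on (outgoing_map Q Y i) (vectors Y i) \<and>
     (\<forall>f\<in>carrier (incoming_space Q X i). incoming_map Q X i f = \<zero>\<^bsub>rep_space X i\<^esub> \<longleftrightarrow>
        f \<in> outgoing_map Q Y i ` vectors Y i)"

locale sink_quiver = fin_digraph Q for Q :: "('a, 'b) pre_digraph" +
  fixes i :: 'a
  assumes sink: "sink Q i"
begin

abbreviation "A \<equiv> in_arcs Q i"

lemma i_in_verts: "i \<in> verts Q" using sink by (simp add: sink_def)

lemma fin_A: "finite A" by (rule finite_in_arcs)

lemma A_facts:
  assumes "a \<in> A"
  shows "a \<in> arcs Q" "head Q a = i" "tail Q a \<in> verts Q" "tail Q a \<noteq> i"
    "tail (flip i Q) a = i" "head (flip i Q) a = tail Q a"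
  using assms sink by (auto simp: sink_def tail_in_verts)

lemma not_A_facts:
  assumes "a \<in> arcs Q" "a \<notin> A"
  shows "tail Q a \<noteq> i" "head Q a \<noteq> i" "tail (flip i Q) a = tail Q a" "head (flip i Q) a = head Q a"
  using assms sink by (auto simp: sink_def)

lemma wf_flip: "wf_digraph (flip i Q)"
  using fin_digraph_flip[OF fin_digraph_axioms] by (simp add: fin_digraph_def)

lemma rep_field: "representation K Q X \<Longrightarrow> field K"
  using i_in_verts by (auto simp: representation_def vectorspace_def)

lemma rep_field_flip: "representation K (flip i Q) X \<Longrightarrow> field K"
  using i_in_verts by (auto simp: representation_def vectorspace_def)

lemma linear_incoming_map:
  assumes X: "representation K Q X"
  shows "linear_map K (incoming_space Q X i) (rep_space X i) (incoming_map Q X i)"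
proof -
  have "linear_map K (rep_space X (tail Q a)) (rep_space X i) (rep_map X a)" if "a \<in> A" for a
    using representationD(2)[OF X A_facts(1)[OF that]] A_facts(2)[OF that] by simp
  then show ?thesis
    unfolding incoming_space_def incoming_map_def
    by (rule linear_map_sum_prod_space[OF representationD(1)[OF X i_in_verts] fin_A])
qed

lemma linear_outgoing_map:
  assumes Y: "representation K (flip i Q) Y"
  shows "linear_map K (rep_space Y i) (incoming_space Q Y i) (outgoing_map Q Y i)"
proof -
  have "linear_map K (rep_space Y i) (rep_space Y (tail Q a)) (rep_map Y a)" if "a \<in> A" for a
    using representationD(2)[OF Y, of a] A_facts[OF that] by (simp del: flip_simps(3,4))
  then show ?thesis
    unfolding incoming_space_def outgoing_map_def
    using representationD(1)[OF Y] i_in_verts by (intro linear_map_into_prod_space) auto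
qed

lemma linear_tuple_map:
  assumes "field K" "\<And>j. j \<in> verts Q - {i} \<Longrightarrow> linear_map K (rep_space X j) (rep_space X' j) (\<phi> j)"
  shows "linear_map K (incoming_space Q X i) (incoming_space Q X' i) (tuple_map Q i \<phi>)"
  unfolding incoming_space_def tuple_map_def using assms A_facts
  by (intro linear_map_prod_space) auto

lemma incoming_space_cong:
  assumes "\<And>j. j \<in> verts Q - {i} \<Longrightarrow> rep_space Y j = rep_space X j"
  shows "incoming_space Q Y i = incoming_space Q X i"
  unfolding incoming_space_def using assms A_facts by (intro prod_space_cong) auto

lemma tuple_map_cong:
  assumes "\<And>j v. \<lbrakk>j \<in> verts Q - {i}; v \<in> vectors X j\<rbrakk> \<Longrightarrow> \<phi> j v = \<psi> j v"
    and "f \<in> carrier (incoming_space Q X i)"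
  shows "tuple_map Q i \<phi> f = tuple_map Q i \<psi> f"
  unfolding tuple_map_def
proof (rule restrict_ext)
  fix a assume a: "a \<in> A"
  then have "f a \<in> vectors X (tail Q a)"
    using assms(2) unfolding incoming_space_def prod_space_simps(1) by (rule PiE_mem[rotated])
  then show "\<phi> (tail Q a) (f a) = \<psi> (tail Q a) (f a)" using assms(1) A_facts(3,4)[OF a] by simp
qed

lemma incoming_map_natural:
  assumes X: "representation K Q X" and \<phi>: "rep_morphism K Q X X' \<phi>"
    and f: "f \<in> carrier (incoming_space Q X i)"
  shows "incoming_map Q X' i (tuple_map Q i \<phi> f) = \<phi> i (incoming_map Q X i f)"
proof -
  have fa: "f a \<in> vectors X (tail Q a)" if "a \<in> A" for a
    using f that by (auto simp: incoming_space_def PiE_iff)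
  have Xf: "rep_map X a (f a) \<in> vectors X i" if "a \<in> A" for a
    using representationD(3)[OF X A_facts(1)[OF that] fa[OF that]] A_facts[OF that] by simp
  interpret linear_map K "rep_space X i" "rep_space X' i" "\<phi> i"
    by (rule rep_morphismD(1)[OF \<phi> i_in_verts])
  have "\<phi> i (incoming_map Q X i f) = finsum (rep_space X' i) (\<lambda>a. \<phi> i (rep_map X a (f a))) A"
    unfolding incoming_map_def
    by (rule linear_map_finsum[OF linear_map_axioms fin_A]) (use Xf in auto)
  also have "\<dots> = incoming_map Q X' i (tuple_map Q i \<phi> f)"
    unfolding incoming_map_def
  proof (rule W.module.M.finsum_cong'[OF refl])
    show eq: "\<phi> i (rep_map X a (f a)) = rep_map X' a (tuple_map Q i \<phi> f a)" if a: "a \<in> A" for a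
      using rep_morphismD(2)[OF \<phi> A_facts(1)[OF a] fa[OF a]] a A_facts[OF a] by (simp add: tuple_map_def)
    show "(\<lambda>a. rep_map X' a (tuple_map Q i \<phi> f a)) \<in> A \<rightarrow> vectors X' i"
    proof
      fix a assume a: "a \<in> A"
      show "rep_map X' a (tuple_map Q i \<phi> f a) \<in> vectors X' i"
        unfolding eq[OF a, symmetric] by (rule T_im[OF Xf[OF a]])
    qed
  qed
  finally show ?thesis ..
qed

lemma outgoing_map_natural:
  assumes \<psi>: "rep_morphism K (flip i Q) Y Y' \<psi>" and y: "y \<in> vectors Y i"
  shows "outgoing_map Q Y' i (\<psi> i y) = tuple_map Q i \<psi> (outgoing_map Q Y i y)"
proof -
  have "rep_map Y' a (\<psi> i y) = \<psi> (tail Q a) (rep_map Y a y)" if "a \<in> A" for a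
    using rep_morphismD(2)[OF \<psi>, of a y] y A_facts[OF that] by (simp del: flip_simps(3,4))
  then show ?thesis by (auto simp: outgoing_map_def tuple_map_def intro!: restrict_ext)
qed

definition single :: "('a, 'b, 'k, 'v) quiver_rep \<Rightarrow> 'b \<Rightarrow> 'v \<Rightarrow> 'b \<Rightarrow> 'v" where
  "single X a v = (\<lambda>b\<in>A. if b = a then v else \<zero>\<^bsub>rep_space X (tail Q b)\<^esub>)"

lemma single_in_incoming_space:
  assumes "\<And>j. j \<in> verts Q - {i} \<Longrightarrow> vectorspace K (rep_space X j)"
    and "a \<in> A" "v \<in> vectors X (tail Q a)"
  shows "single X a v \<in> carrier (incoming_space Q X i)"
proof -
  have "\<zero>\<^bsub>rep_space X (tail Q b)\<^esub> \<in> vectors X (tail Q b)" if "b \<in> A" for b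
  proof -
    interpret vectorspace K "rep_space X (tail Q b)" using assms(1) A_facts[OF that] by auto
    show ?thesis by (rule M.zero_closed)
  qed
  then show ?thesis using assms(2,3) by (auto simp: single_def incoming_space_def)
qed

lemma incoming_map_single:
  assumes X: "representation K Q X" and a: "a \<in> A" and v: "v \<in> vectors X (tail Q a)"
  shows "incoming_map Q X i (single X a v) = rep_map X a v"
proof -
  interpret vectorspace K "rep_space X i" by (rule representationD(1)[OF X i_in_verts])
  have c: "rep_map X a v \<in> vectors X i"
    using representationD(3)[OF X A_facts(1)[OF a] v] A_facts[OF a] by simp
  have "rep_map X b (single X a v b) = (if a = b then rep_map X a v else \<zero>\<^bsub>rep_space X i\<^esub>)" if "b \<in> A" for b
    using linear_mapD(7)[OF representationD(2)[OF X A_facts(1)[OF that]]] that A_facts[OF that]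
    by (auto simp: single_def)
  then have "incoming_map Q X i (single X a v) =
      finsum (rep_space X i) (\<lambda>b. if a = b then rep_map X a v else \<zero>\<^bsub>rep_space X i\<^esub>) A"
    unfolding incoming_map_def using c by (intro M.finsum_cong') auto
  also have "\<dots> = rep_map X a v" using a c by (intro M.add.finprod_singleton[of a A "\<lambda>_. rep_map X a v"]) auto
  finally show ?thesis .
qed

lemma tuple_map_single:
  assumes "\<And>j. j \<in> verts Q - {i} \<Longrightarrow> linear_map K (rep_space X j) (rep_space X' j) (\<phi> j)"
    and "a \<in> A"
  shows "tuple_map Q i \<phi> (single X a v) = single X' a (\<phi> (tail Q a) v)"
  unfolding tuple_map_def single_def[of X']
proof (rule restrict_ext)
  fix b assume b: "b \<in> A"
  have "\<phi> (tail Q b) \<zero>\<^bsub>rep_space X (tail Q b)\<^esub> = \<zero>\<^bsub>rep_space X' (tail Q b)\<^esub>"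
    using linear_mapD(7)[OF assms(1)] A_facts(3,4)[OF b] by simp
  then show "\<phi> (tail Q b) (single X a v b) =
      (if b = a then \<phi> (tail Q a) v else \<zero>\<^bsub>rep_space X' (tail Q b)\<^esub>)"
    using b by (simp add: single_def)
qed

text \<open>Every vector at the sink is a sum of images of vectors at other vertices.\<close>

lemma determined_off_sink:
  assumes X: "representation K Q X"
    and surj: "incoming_map Q X i ` carrier (incoming_space Q X i) = vectors X i"
  shows "determined_off K Q i X X'"
  unfolding determined_off_def
proof (intro allI impI ballI)
  fix \<phi> \<psi> j v assume \<phi>: "rep_morphism K Q X X' \<phi>" and \<psi>: "rep_morphism K Q X X' \<psi>"
    and ag: "agree_off Q i X \<phi> \<psi>" and j: "j \<in> verts Q" and v: "v \<in> vectors X j"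
  show "\<phi> j v = \<psi> j v"
  proof (cases "j = i")
    case True
    then obtain f where f: "f \<in> carrier (incoming_space Q X i)" "v = incoming_map Q X i f" using v surj by blast
    have "tuple_map Q i \<phi> f = tuple_map Q i \<psi> f"
      by (rule tuple_map_cong[OF _ f(1)]) (use ag in \<open>auto simp: agree_off_def\<close>)
    then show ?thesis
      using incoming_map_natural[OF X \<phi> f(1)] incoming_map_natural[OF X \<psi> f(1)] True f(2) by simp
  qed (use ag j v in \<open>auto simp: agree_off_def\<close>)
qed

text \<open>A vector at the source is determined by its images at other vertices.\<close>

lemma determined_off_source:
  assumes Y: "representation K (flip i Q) Y"
    and inj: "inj_on (outgoing_map Q Y' i) (vectors Y' i)"
  shows "determined_off K (flip i Q) i Y Y'"
  unfolding determined_off_def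
proof (intro allI impI ballI)
  fix \<phi> \<psi> j v assume \<phi>: "rep_morphism K (flip i Q) Y Y' \<phi>" and \<psi>: "rep_morphism K (flip i Q) Y Y' \<psi>"
    and ag: "agree_off (flip i Q) i Y \<phi> \<psi>" and j: "j \<in> verts (flip i Q)" and v: "v \<in> vectors Y j"
  show "\<phi> j v = \<psi> j v"
  proof (cases "j = i")
    case True
    have y: "v \<in> vectors Y i" using v True by simp
    have "tuple_map Q i \<phi> (outgoing_map Q Y i v) = tuple_map Q i \<psi> (outgoing_map Q Y i v)"
      by (rule tuple_map_cong[OF _ linear_mapD(3)[OF linear_outgoing_map[OF Y] y]])
        (use ag in \<open>auto simp: agree_off_def\<close>)
    then have "outgoing_map Q Y' i (\<phi> i v) = outgoing_map Q Y' i (\<psi> i v)"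
      using outgoing_map_natural[OF \<phi> y] outgoing_map_natural[OF \<psi> y] by simp
    then show ?thesis
      using inj_onD[OF inj] rep_morphismD(3)[OF \<phi> _ y] rep_morphismD(3)[OF \<psi> _ y] i_in_verts True by simp
  qed (use ag j v in \<open>auto simp: agree_off_def\<close>)
qed

lemma reflectedD:
  assumes "reflected K Q i X Y"
  shows "representation K Q X" "finite_dimensional K Q X"
    "representation K (flip i Q) Y" "finite_dimensional K (flip i Q) Y"
    "\<And>j. j \<in> verts Q - {i} \<Longrightarrow> rep_space Y j = rep_space X j"
    "\<And>a. \<lbrakk>a \<in> arcs Q; a \<notin> A\<rbrakk> \<Longrightarrow> rep_map Y a = rep_map X a"
    "incoming_map Q X i ` carrier (incoming_space Q X i) = vectors X i"
    "inj_on (outgoing_map Q Y i) (vectors Y i)"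
    "\<And>f. f \<in> carrier (incoming_space Q X i) \<Longrightarrow> incoming_map Q X i f = \<zero>\<^bsub>rep_space X i\<^esub> \<longleftrightarrow>
        f \<in> outgoing_map Q Y i ` vectors Y i"
    "incoming_space Q Y i = incoming_space Q X i"
    "linear_map K (incoming_space Q X i) (rep_space X i) (incoming_map Q X i)"
    "linear_map K (rep_space Y i) (incoming_space Q X i) (outgoing_map Q Y i)"
  using assms linear_incoming_map[of K X] linear_outgoing_map[of K Y] incoming_space_cong[of Y X]
  unfolding reflected_def by auto

text \<open>The components away from \<open>i\<close> map the kernel of \<open>incoming_map Q X i\<close> to that of
\<open>incoming_map Q X' i\<close>, and the outgoing maps identify \<open>Y\<close> and \<open>Y'\<close> at \<open>i\<close> with
these kernels.\<close>

lemma morphisms_extend_to_source: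
  assumes XY: "reflected K Q i X Y" and XY': "reflected K Q i X' Y'"
  shows "morphisms_extend K i Q X X' (flip i Q) Y Y'"
  unfolding morphisms_extend_def
proof (intro allI impI)
  note D = reflectedD[OF XY] and D' = reflectedD[OF XY']
  fix \<phi> assume \<phi>: "rep_morphism K Q X X' \<phi>"
  have tup: "linear_map K (incoming_space Q X i) (incoming_space Q X' i) (tuple_map Q i \<phi>)"
    by (rule linear_tuple_map[OF rep_field[OF D(1)]]) (use rep_morphismD(1)[OF \<phi>] in auto)
  have im: "(tuple_map Q i \<phi> \<circ> outgoing_map Q Y i) ` vectors Y i \<subseteq> outgoing_map Q Y' i ` vectors Y' i"
  proof clarify
    fix y assume y: "y \<in> vectors Y i"
    have o: "outgoing_map Q Y i y \<in> carrier (incoming_space Q X i)" by (rule linear_mapD(3)[OF D(12) y])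
    have "incoming_map Q X' i (tuple_map Q i \<phi> (outgoing_map Q Y i y)) = \<zero>\<^bsub>rep_space X' i\<^esub>"
      using incoming_map_natural[OF D(1) \<phi> o] D(9)[OF o] y linear_mapD(7)[OF rep_morphismD(1)[OF \<phi> i_in_verts]] by simp
    then show "(tuple_map Q i \<phi> \<circ> outgoing_map Q Y i) y \<in> outgoing_map Q Y' i ` vectors Y' i"
      using D'(9)[OF linear_mapD(3)[OF tup o]] by simp
  qed
  obtain h where h: "linear_map K (rep_space Y i) (rep_space Y' i) h"
    "\<And>y. y \<in> vectors Y i \<Longrightarrow> outgoing_map Q Y' i (h y) = tuple_map Q i \<phi> (outgoing_map Q Y i y)"
    using factor_through_injection[OF D'(12) linear_map_comp[OF D(12) tup] D'(8) im] by auto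
  have "rep_morphism K (flip i Q) Y Y' (\<phi>(i := h))"
    unfolding rep_morphism_def
  proof (intro conjI ballI)
    fix j assume "j \<in> verts (flip i Q)"
    then show "linear_map K (rep_space Y j) (rep_space Y' j) ((\<phi>(i := h)) j)"
      using h(1) rep_morphismD(1)[OF \<phi>, of j] D(5)[of j] D'(5)[of j] by auto
  next
    fix a v assume a: "a \<in> arcs (flip i Q)" and v: "v \<in> vectors Y (tail (flip i Q) a)"
    show "rep_map Y' a ((\<phi>(i := h)) (tail (flip i Q) a) v) = (\<phi>(i := h)) (head (flip i Q) a) (rep_map Y a v)"
    proof (cases "a \<in> A")
      case True
      note F = A_facts[OF True]
      have "rep_map Y' a (h v) = \<phi> (tail Q a) (rep_map Y a v)"
        using fun_cong[OF h(2)[of v], of a] v True F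
        by (simp add: outgoing_map_def tuple_map_def del: flip_simps(3,4))
      then show ?thesis using F by (simp del: flip_simps(3,4))
    next
      case False
      note aQ = a[unfolded flip_simps]
      note F = not_A_facts[OF aQ False]
      show ?thesis
        using rep_morphismD(2)[OF \<phi> aQ, of v] v F D(6)[OF aQ False] D'(6)[OF aQ False] D(5)[of "tail Q a"] tail_in_verts[OF aQ]
        by (simp del: flip_simps(3,4))
    qed
  qed
  then show "\<exists>\<psi>. rep_morphism K (flip i Q) Y Y' \<psi> \<and> (\<forall>j\<in>verts Q - {i}. \<psi> j = \<phi> j)"
    by (intro exI[of _ "\<phi>(i := h)"]) auto
qed

text \<open>Dually, the components away from \<open>i\<close> map the image of \<open>outgoing_map Q Y i\<close> to that of
\<open>outgoing_map Q Y' i\<close>, and the incoming maps identify the quotients by these images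
with \<open>X\<close> and \<open>X'\<close> at \<open>i\<close>.\<close>

lemma morphisms_extend_to_sink:
  assumes XY: "reflected K Q i X Y" and XY': "reflected K Q i X' Y'"
  shows "morphisms_extend K i (flip i Q) Y Y' Q X X'"
  unfolding morphisms_extend_def
proof (intro allI impI)
  note D = reflectedD[OF XY] and D' = reflectedD[OF XY']
  fix \<psi> assume \<psi>: "rep_morphism K (flip i Q) Y Y' \<psi>"
  have lin: "linear_map K (rep_space X j) (rep_space X' j) (\<psi> j)" if "j \<in> verts Q - {i}" for j
    using rep_morphismD(1)[OF \<psi>, of j] D(5)[OF that] D'(5)[OF that] that by simp
  have tup: "linear_map K (incoming_space Q X i) (incoming_space Q X' i) (tuple_map Q i \<psi>)"
    by (rule linear_tuple_map[OF rep_field[OF D(1)] lin])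
  have ker: "(incoming_map Q X' i \<circ> tuple_map Q i \<psi>) f = \<zero>\<^bsub>rep_space X' i\<^esub>"
    if f: "f \<in> carrier (incoming_space Q X i)" and z: "incoming_map Q X i f = \<zero>\<^bsub>rep_space X i\<^esub>" for f
  proof -
    obtain y where y: "y \<in> vectors Y i" "f = outgoing_map Q Y i y" using D(9)[OF f] z by auto
    have "tuple_map Q i \<psi> f = outgoing_map Q Y' i (\<psi> i y)" using outgoing_map_natural[OF \<psi> y(1)] y(2) by simp
    moreover have "\<psi> i y \<in> vectors Y' i" using rep_morphismD(3)[OF \<psi> _ y(1)] i_in_verts by simp
    ultimately show ?thesis using D'(9)[OF linear_mapD(3)[OF tup f]] by auto
  qed
  obtain h where h: "linear_map K (rep_space X i) (rep_space X' i) h"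
    "\<And>f. f \<in> carrier (incoming_space Q X i) \<Longrightarrow> h (incoming_map Q X i f) = incoming_map Q X' i (tuple_map Q i \<psi> f)"
    using factor_through_surjection[OF D(11) linear_map_comp[OF tup D'(11)] D(7) ker] by auto
  have "rep_morphism K Q X X' (\<psi>(i := h))"
    unfolding rep_morphism_def
  proof (intro conjI ballI)
    fix j assume "j \<in> verts Q"
    then show "linear_map K (rep_space X j) (rep_space X' j) ((\<psi>(i := h)) j)"
      using h(1) lin[of j] by auto
  next
    fix a v assume a: "a \<in> arcs Q" and v: "v \<in> vectors X (tail Q a)"
    show "rep_map X' a ((\<psi>(i := h)) (tail Q a) v) = (\<psi>(i := h)) (head Q a) (rep_map X a v)"
    proof (cases "a \<in> A")
      case True
      note F = A_facts[OF True]
      have s: "single X a v \<in> carrier (incoming_space Q X i)"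
        by (rule single_in_incoming_space[OF _ True v]) (use representationD(1)[OF D(1)] in auto)
      have v': "\<psi> (tail Q a) v \<in> vectors X' (tail Q a)"
        using linear_mapD(3)[OF lin v] F by simp
      have "h (rep_map X a v) = rep_map X' a (\<psi> (tail Q a) v)"
        using h(2)[OF s] tuple_map_single[OF lin True, of v] incoming_map_single[OF D(1) True v]
          incoming_map_single[OF D'(1) True v'] by simp
      then show ?thesis using F by simp
    next
      case False
      note F = not_A_facts[OF a False]
      show ?thesis
        using rep_morphismD(2)[OF \<psi>, of a v] a v F D(6)[OF a False] D'(6)[OF a False] D(5)[of "tail Q a"] tail_in_verts[OF a]
        by (simp del: flip_simps(3,4))
    qed
  qed
  then show "\<exists>\<phi>. rep_morphism K Q X X' \<phi> \<and> (\<forall>j\<in>verts (flip i Q) - {i}. \<phi> j = \<psi> j)"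
    by (intro exI[of _ "\<psi>(i := h)"]) auto
qed

lemma reflected_isomorphic_iff:
  fixes X X' Y Y' :: "('a, 'b, 'k, 'v) quiver_rep"
  assumes XY: "reflected K Q i X Y" and XY': "reflected K Q i X' Y'"
  shows "rep_isomorphic K Q X X' \<longleftrightarrow> rep_isomorphic K (flip i Q) Y Y'"
proof
  note D = reflectedD[OF XY] and D' = reflectedD[OF XY']
  have Q: "wf_digraph Q" by unfold_locales
  show "rep_isomorphic K (flip i Q) Y Y'" if "rep_isomorphic K Q X X'"
    by (rule isomorphism_transfer[OF Q wf_flip _ D(1) D(3) D'(3) D(5) D'(5) morphisms_extend_to_source[OF XY XY']
      morphisms_extend_to_source[OF XY' XY] determined_off_source[OF D(3) D(8)] determined_off_source[OF D'(3) D'(8)] that])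
      simp_all
  show "rep_isomorphic K Q X X'" if "rep_isomorphic K (flip i Q) Y Y'"
    by (rule isomorphism_transfer[OF wf_flip Q _ D(3) D(1) D'(1) _ _ morphisms_extend_to_sink[OF XY XY']
      morphisms_extend_to_sink[OF XY' XY] determined_off_sink[OF D(1) D(7)] determined_off_sink[OF D'(1) D'(7)] that])
      (simp_all add: D(5) D'(5))
qed

lemma reflected_trivial_idempotents_iff:
  assumes XY: "reflected K Q i X Y"
  shows "trivial_idempotents K Q X \<longleftrightarrow> trivial_idempotents K (flip i Q) Y"
proof
  note D = reflectedD[OF XY]
  have Q: "wf_digraph Q" by unfold_locales
  show "trivial_idempotents K (flip i Q) Y" if "trivial_idempotents K Q X"
    by (rule trivial_idempotents_transfer[OF Q wf_flip _ D(1) D(3) D(5) morphisms_extend_to_sink[OF XY XY]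
      determined_off_sink[OF D(1) D(7)] determined_off_source[OF D(3) D(8)] that]) simp_all
  show "trivial_idempotents K Q X" if "trivial_idempotents K (flip i Q) Y"
    by (rule trivial_idempotents_transfer[OF wf_flip Q _ D(3) D(1) _ morphisms_extend_to_source[OF XY XY]
      determined_off_source[OF D(3) D(8)] determined_off_sink[OF D(1) D(7)] that]) (simp_all add: D(5))
qed

text \<open>The dimension formula for the exact sequence. Both equations hold because a simple reflection is
an involution.\<close>

lemma reflected_dim_vector:
  assumes XY: "reflected K Q i X Y"
  shows "dim_vector K (flip i Q) Y = reflection Q i (dim_vector K Q X)"
    and "dim_vector K Q X = reflection Q i (dim_vector K (flip i Q) Y)"
proof -
  note D = reflectedD[OF XY]
  have fin: "vectorspace.fin_dim K (rep_space X j)" if "j \<in> verts Q" for j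
    using D(2) that by (simp add: finite_dimensional_def)
  have finY: "vectorspace.fin_dim K (rep_space Y i)"
    using D(4) i_in_verts by (simp add: finite_dimensional_def)
  have P: "vectorspace.fin_dim K (incoming_space Q X i) \<and>
      vectorspace.dim K (incoming_space Q X i) = (\<Sum>a\<in>A. vectorspace.dim K (rep_space X (tail Q a)))"
    unfolding incoming_space_def using A_facts fin
    by (intro prod_space_fin_dim_dim[OF rep_field[OF D(1)]]) (auto intro: representationD(1)[OF D(1)])
  have eq: "(\<Sum>a\<in>A. int (vectorspace.dim K (rep_space X (tail Q a)))) =
      int (vectorspace.dim K (rep_space Y i)) + int (vectorspace.dim K (rep_space X i))"
    using exact_sequence_dim[OF D(12) D(11) D(8) D(7) D(9) finY] P by (simp flip: of_nat_sum)
  have N: "neighbour_sum Q i x = (\<Sum>a\<in>A. x (tail Q a))" for x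
    using neighbour_sum_sink[OF fin_digraph_axioms sink] by (simp add: in_arcs_def)
  have dY: "dim_vector K (flip i Q) Y j = dim_vector K Q X j" if "j \<noteq> i" for j
    using D(5)[of j] that by (auto simp: dim_vector_def)
  have NX: "neighbour_sum Q i (dim_vector K Q X) = dim_vector K (flip i Q) Y i + dim_vector K Q X i"
    unfolding N using A_facts i_in_verts by (simp add: dim_vector_def flip: eq)
  have NY: "neighbour_sum Q i (dim_vector K (flip i Q) Y) = neighbour_sum Q i (dim_vector K Q X)"
    unfolding N using A_facts by (intro sum.cong) (auto simp: dY)
  show "dim_vector K (flip i Q) Y = reflection Q i (dim_vector K Q X)"
    unfolding reflection_def NX by (auto simp: fun_eq_iff dY)
  show "dim_vector K Q X = reflection Q i (dim_vector K (flip i Q) Y)"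
    unfolding reflection_def NY NX by (auto simp: fun_eq_iff dY)
qed

end

section \<open>Simple representations\<close>

definition simple_at ::
  "('k, 'm) ring_scheme \<Rightarrow> ('a, 'b) pre_digraph \<Rightarrow> 'a \<Rightarrow> ('a, 'b, 'k, 'v) quiver_rep \<Rightarrow> bool" where
  "simple_at K Q i X \<longleftrightarrow>
     (\<forall>j\<in>verts Q - {i}. vectors X j = {\<zero>\<^bsub>rep_space X j\<^esub>}) \<and>
     (\<exists>v\<in>vectors X i. v \<noteq> \<zero>\<^bsub>rep_space X i\<^esub> \<and>
        vectors X i = {r \<odot>\<^bsub>rep_space X i\<^esub> v | r. r \<in> carrier K})"

lemma (in vectorspace) smult_cancel_right:
  assumes "v \<in> carrier V" "v \<noteq> \<zero>\<^bsub>V\<^esub>" "r \<in> carrier K" "s \<in> carrier K" "r \<odot>\<^bsub>V\<^esub> v = s \<odot>\<^bsub>V\<^esub> v"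
  shows "r = s"
proof (rule ccontr)
  assume "r \<noteq> s"
  then have ne: "r \<ominus>\<^bsub>K\<^esub> s \<noteq> \<zero>\<^bsub>K\<^esub>" using assms(3,4) by (simp add: R.minus_other_side)
  have "(r \<ominus>\<^bsub>K\<^esub> s) \<odot>\<^bsub>V\<^esub> v = \<zero>\<^bsub>V\<^esub>"
    using assms by (simp add: R.minus_eq smult_l_distr smult_l_minus M.r_neg)
  then have "v = inv\<^bsub>K\<^esub> (r \<ominus>\<^bsub>K\<^esub> s) \<odot>\<^bsub>V\<^esub> \<zero>\<^bsub>V\<^esub>"
    using mult_inverse[OF _ assms(1) _ ne] assms(3,4) by simp
  moreover have "inv\<^bsub>K\<^esub> (r \<ominus>\<^bsub>K\<^esub> s) \<in> carrier K" using ne assms(3,4) by (simp add: field_Units)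
  ultimately show False using assms(2) by (simp add: smult_r_null)
qed

lemma line_isomorphism:
  assumes V: "vectorspace K V" "v \<in> carrier V" "v \<noteq> \<zero>\<^bsub>V\<^esub>" "carrier V = {r \<odot>\<^bsub>V\<^esub> v | r. r \<in> carrier K}"
    and W: "vectorspace K W" "w \<in> carrier W" "w \<noteq> \<zero>\<^bsub>W\<^esub>" "carrier W = {r \<odot>\<^bsub>W\<^esub> w | r. r \<in> carrier K}"
  obtains f where "linear_map K V W f" "bij_betw f (carrier V) (carrier W)"
proof -
  interpret V: vectorspace K V by fact
  interpret W: vectorspace K W by fact
  have "\<forall>x\<in>carrier V. \<exists>r. r \<in> carrier K \<and> x = r \<odot>\<^bsub>V\<^esub> v" using V(4) by auto
  then obtain c where c: "\<And>x. x \<in> carrier V \<Longrightarrow> c x \<in> carrier K \<and> x = c x \<odot>\<^bsub>V\<^esub> v" by metis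
  have cv: "c (r \<odot>\<^bsub>V\<^esub> v) = r" if "r \<in> carrier K" for r
    using V.smult_cancel_right[OF V(2,3)] c[of "r \<odot>\<^bsub>V\<^esub> v"] that V(2) by (metis V.smult_closed)
  define f where "f x = c x \<odot>\<^bsub>W\<^esub> w" for x
  have fv: "f (r \<odot>\<^bsub>V\<^esub> v) = r \<odot>\<^bsub>W\<^esub> w" if "r \<in> carrier K" for r by (simp add: f_def cv that)
  have "linear_map K V W f"
  proof (rule linear_mapI)
    show "vectorspace K V" "vectorspace K W" by fact+
    show "f x \<in> carrier W" if "x \<in> carrier V" for x using c[OF that] W(2) by (simp add: f_def)
    fix x y assume "x \<in> carrier V" "y \<in> carrier V"
    then obtain r s where "r \<in> carrier K" "x = r \<odot>\<^bsub>V\<^esub> v" "s \<in> carrier K" "y = s \<odot>\<^bsub>V\<^esub> v" using c by blast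
    then show "f (x \<oplus>\<^bsub>V\<^esub> y) = f x \<oplus>\<^bsub>W\<^esub> f y"
      using fv[of "r \<oplus>\<^bsub>K\<^esub> s"] V(2) W(2) by (simp add: fv V.smult_l_distr W.smult_l_distr)
  next
    fix t x assume "t \<in> carrier K" "x \<in> carrier V"
    moreover then obtain r where "r \<in> carrier K" "x = r \<odot>\<^bsub>V\<^esub> v" using c by blast
    ultimately show "f (t \<odot>\<^bsub>V\<^esub> x) = t \<odot>\<^bsub>W\<^esub> f x"
      using fv[of "t \<otimes>\<^bsub>K\<^esub> r"] V(2) W(2) by (simp add: fv V.smult_assoc1 W.smult_assoc1)
  qed
  moreover have "bij_betw f (carrier V) (carrier W)"
    unfolding bij_betw_def
  proof
    show "inj_on f (carrier V)"
    proof (rule inj_onI)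
      fix x y assume "x \<in> carrier V" "y \<in> carrier V" "f x = f y"
      moreover then have "c x = c y"
        using W.smult_cancel_right[OF W(2,3), of "c x" "c y"] c by (simp add: f_def)
      ultimately show "x = y" using c by metis
    qed
    show "f ` carrier V = carrier W"
    proof (intro equalityI subsetI)
      fix y assume "y \<in> carrier W"
      then obtain r where "r \<in> carrier K" "y = r \<odot>\<^bsub>W\<^esub> w" using W(4) by auto
      then show "y \<in> f ` carrier V" using fv V(2) by (metis V.smult_closed imageI)
    qed (use c W(2) in \<open>auto simp: f_def\<close>)
  qed
  ultimately show thesis using that by blast
qed

lemma simple_at_isomorphic:
  assumes Q: "wf_digraph Q" and loops: "\<And>a. a \<in> arcs Q \<Longrightarrow> \<not> (tail Q a = i \<and> head Q a = i)"
    and i: "i \<in> verts Q"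
    and X: "representation K Q X" "simple_at K Q i X" and Y: "representation K Q Y" "simple_at K Q i Y"
  shows "rep_isomorphic K Q X Y"
proof -
  interpret wf_digraph Q by fact
  obtain v where v: "v \<in> vectors X i" "v \<noteq> \<zero>\<^bsub>rep_space X i\<^esub>"
    "vectors X i = {r \<odot>\<^bsub>rep_space X i\<^esub> v | r. r \<in> carrier K}"
    using X(2) by (auto simp: simple_at_def)
  obtain w where w: "w \<in> vectors Y i" "w \<noteq> \<zero>\<^bsub>rep_space Y i\<^esub>"
    "vectors Y i = {r \<odot>\<^bsub>rep_space Y i\<^esub> w | r. r \<in> carrier K}"
    using Y(2) by (auto simp: simple_at_def)
  have zX: "x = \<zero>\<^bsub>rep_space X j\<^esub>" if "j \<in> verts Q" "j \<noteq> i" "x \<in> vectors X j" for j x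
    using X(2) that by (auto simp: simple_at_def)
  have zY: "vectors Y j = {\<zero>\<^bsub>rep_space Y j\<^esub>}" if "j \<in> verts Q" "j \<noteq> i" for j
    using Y(2) that by (auto simp: simple_at_def)
  have zX': "vectors X j = {\<zero>\<^bsub>rep_space X j\<^esub>}" if "j \<in> verts Q" "j \<noteq> i" for j
    using X(2) that by (auto simp: simple_at_def)
  obtain f where f: "linear_map K (rep_space X i) (rep_space Y i) f"
    "bij_betw f (vectors X i) (vectors Y i)"
    using line_isomorphism[OF representationD(1)[OF X(1) i] v representationD(1)[OF Y(1) i] w] .
  define \<phi> where "\<phi> j = (if j = i then f else (\<lambda>v. \<zero>\<^bsub>rep_space Y j\<^esub>))" for j
  have lin: "linear_map K (rep_space X j) (rep_space Y j) (\<phi> j)" if "j \<in> verts Q" for j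
    using f(1) linear_map_zero[OF representationD(1)[OF X(1) that] representationD(1)[OF Y(1) that]]
    by (simp add: \<phi>_def)
  have "rep_morphism K Q X Y \<phi>"
    unfolding rep_morphism_def
  proof (intro conjI ballI lin)
    fix a x assume a: "a \<in> arcs Q" and x: "x \<in> vectors X (tail Q a)"
    note t = tail_in_verts[OF a] and h = head_in_verts[OF a]
    note Xa = linear_mapD[OF representationD(2)[OF X(1) a]] and Ya = linear_mapD[OF representationD(2)[OF Y(1) a]]
    show "rep_map Y a (\<phi> (tail Q a) x) = \<phi> (head Q a) (rep_map X a x)"
    proof (cases "tail Q a = i")
      case True
      then have "head Q a \<noteq> i" using loops[OF a] by blast
      moreover have "rep_map Y a (\<phi> (tail Q a) x) \<in> vectors Y (head Q a)"
        by (rule Ya(3)[OF linear_mapD(3)[OF lin[OF t] x]])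
      ultimately show ?thesis using zY[OF h] by (simp add: \<phi>_def)
    next
      case False
      then have "x = \<zero>\<^bsub>rep_space X (tail Q a)\<^esub>" using zX[OF t _ x] by simp
      then show ?thesis using Xa(7) Ya(7) linear_mapD(7)[OF lin[OF h]] linear_mapD(7)[OF lin[OF t]] by simp
    qed
  qed
  moreover have "bij_betw (\<phi> j) (vectors X j) (vectors Y j)" if "j \<in> verts Q" for j
    using f(2) zX'[OF that] zY[OF that] by (cases "j = i") (auto simp: \<phi>_def bij_betw_def)
  ultimately show ?thesis by (auto simp: rep_isomorphic_def)
qed

lemma (in vectorspace) dim_line:
  assumes "v \<in> carrier V" "v \<noteq> \<zero>\<^bsub>V\<^esub>" "carrier V = {r \<odot>\<^bsub>V\<^esub> v | r. r \<in> carrier K}"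
  shows "dim = 1" "fin_dim"
proof -
  have sub: "{v} \<subseteq> carrier V" using assms(1) by simp
  interpret S: submodule K "span {v}" V by (rule span_is_submodule[OF sub])
  have "v \<in> span {v}" using in_own_span[OF sub] by simp
  then have "carrier V \<subseteq> span {v}" unfolding assms(3) by auto
  then have g: "gen_set {v}" using S.subset by blast
  then show "dim = 1" using assms by (intro dim1I) auto
  show "fin_dim" unfolding fin_dim_def using g sub by blast
qed

lemma simple_at_dim_vector:
  assumes "representation K Q X" "simple_at K Q i X" "i \<in> verts Q"
  shows "dim_vector K Q X = (\<lambda>j\<in>verts Q. if j = i then 1 else 0)" "finite_dimensional K Q X"
proof -
  have off: "vectorspace.dim K (rep_space X j) = 0 \<and> vectorspace.fin_dim K (rep_space X j)"
    if "j \<in> verts Q" "j \<noteq> i" for j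
  proof -
    interpret vectorspace K "rep_space X j" by (rule representationD(1)[OF assms(1) that(1)])
    show ?thesis using dim_trivial assms(2) that by (simp add: simple_at_def)
  qed
  have at: "vectorspace.dim K (rep_space X i) = 1 \<and> vectorspace.fin_dim K (rep_space X i)"
  proof -
    interpret vectorspace K "rep_space X i" by (rule representationD(1)[OF assms(1,3)])
    show ?thesis using dim_line assms(2) by (auto simp: simple_at_def)
  qed
  show "dim_vector K Q X = (\<lambda>j\<in>verts Q. if j = i then 1 else 0)"
    using off at by (auto simp: dim_vector_def intro!: restrict_ext)
  show "finite_dimensional K Q X" using off at by (auto simp: finite_dimensional_def)
qed

text \<open>On a line an endomorphism is a scalar, and the idempotent scalars are 0 and 1.\<close>

lemma simple_at_trivial_idempotents:
  assumes Q: "wf_digraph Q" and X: "representation K Q X" "simple_at K Q i X" and i: "i \<in> verts Q"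
  shows "trivial_idempotents K Q X"
  unfolding trivial_idempotents_def
proof (intro conjI allI impI)
  obtain v where v: "v \<in> vectors X i" "v \<noteq> \<zero>\<^bsub>rep_space X i\<^esub>"
    "vectors X i = {r \<odot>\<^bsub>rep_space X i\<^esub> v | r. r \<in> carrier K}"
    using X(2) by (auto simp: simple_at_def)
  show "\<not> rep_zero Q X" using v(1,2) i by (auto simp: rep_zero_def)
  fix e assume e: "rep_morphism K Q X X e"
    and idem: "\<forall>j\<in>verts Q. \<forall>v\<in>vectors X j. e j (e j v) = e j v"
  interpret linear_map K "rep_space X i" "rep_space X i" "e i" by (rule rep_morphismD(1)[OF e i])
  obtain r where r: "r \<in> carrier K" "e i v = r \<odot>\<^bsub>rep_space X i\<^esub> v"
    using rep_morphismD(3)[OF e i v(1)] v(3) by auto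
  have "(r \<otimes>\<^bsub>K\<^esub> r) \<odot>\<^bsub>rep_space X i\<^esub> v = r \<odot>\<^bsub>rep_space X i\<^esub> v"
    using bspec[OF bspec[OF idem i] v(1)] r v(1) by (simp add: V.module.smult_assoc1)
  then have "r \<otimes>\<^bsub>K\<^esub> r = r \<otimes>\<^bsub>K\<^esub> \<one>\<^bsub>K\<^esub>"
    using V.smult_cancel_right[OF v(1,2), of "r \<otimes>\<^bsub>K\<^esub> r" r] r(1) by simp
  moreover have dom: "domain K"
    using representationD(1)[OF X(1) i] by (simp add: vectorspace_def field_def)
  ultimately have rr: "r = \<zero>\<^bsub>K\<^esub> \<or> r = \<one>\<^bsub>K\<^esub>"
    using domain.m_lcancel[OF dom, of r r "\<one>\<^bsub>K\<^esub>"] r(1) by auto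
  have off: "e j x = \<zero>\<^bsub>rep_space X j\<^esub> \<and> e j x = x" if "j \<in> verts Q" "j \<noteq> i" "x \<in> vectors X j" for j x
    using X(2) that rep_morphismD(3)[OF e that(1,3)] by (auto simp: simple_at_def)
  have at: "\<exists>s\<in>carrier K. x = s \<odot>\<^bsub>rep_space X i\<^esub> v \<and> e i x = s \<odot>\<^bsub>rep_space X i\<^esub> (r \<odot>\<^bsub>rep_space X i\<^esub> v)"
    if x: "x \<in> vectors X i" for x
  proof -
    obtain s where s: "s \<in> carrier K" "x = s \<odot>\<^bsub>rep_space X i\<^esub> v" using x v(3) by blast
    then show ?thesis using T_smult[OF s(1) v(1)] r(2) by auto
  qed
  from rr show "(\<forall>j\<in>verts Q. \<forall>v\<in>vectors X j. e j v = \<zero>\<^bsub>rep_space X j\<^esub>) \<or>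
        (\<forall>j\<in>verts Q. \<forall>v\<in>vectors X j. e j v = v)"
  proof
    assume "r = \<zero>\<^bsub>K\<^esub>"
    then have "e i x = \<zero>\<^bsub>rep_space X i\<^esub>" if "x \<in> vectors X i" for x
      using at[OF that] v(1) by (auto simp: V.module.lmult_0 V.module.rmult_0)
    then show ?thesis using off by metis
  next
    assume "r = \<one>\<^bsub>K\<^esub>"
    then have "e i x = x" if "x \<in> vectors X i" for x
      using at[OF that] v(1) by auto
    then show ?thesis using off by metis
  qed
qed

lemma exists_simple_at:
  fixes K :: "('k, 'm) ring_scheme" and Q :: "('a, 'b) pre_digraph"
  assumes K: "field K" and coord: "contains_coordinate_spaces TYPE('v) K" and i: "i \<in> verts Q"
    and Q: "wf_digraph Q" and loops: "\<And>a. a \<in> arcs Q \<Longrightarrow> \<not> (tail Q a = i \<and> head Q a = i)"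
  obtains X :: "('a, 'b, 'k, 'v) quiver_rep" where "representation K Q X" "simple_at K Q i X"
proof -
  interpret wf_digraph Q by fact
  interpret K: field K by fact
  define L :: "('k, 'k) module" where "L = \<lparr>carrier = carrier K, mult = mult K, one = one K,
    zero = zero K, add = add K, smult = mult K\<rparr>"
  have L: "vectorspace K L"
  proof (rule vs_criteria)
    show "\<forall>v\<in>carrier L. \<exists>w\<in>carrier L. v \<oplus>\<^bsub>L\<^esub> w = \<zero>\<^bsub>L\<^esub>"
      by (auto simp: L_def intro!: bexI[of _ "\<ominus>\<^bsub>K\<^esub> _"] K.r_neg)
  qed (use K in \<open>auto simp: L_def K.m_assoc K.l_distr K.r_distr K.a_ac\<close>)
  interpret L: vectorspace K L by fact
  have one: "\<one>\<^bsub>K\<^esub> \<in> carrier L" "\<one>\<^bsub>K\<^esub> \<noteq> \<zero>\<^bsub>L\<^esub>" by (simp_all add: L_def)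
  have "r \<odot>\<^bsub>L\<^esub> \<one>\<^bsub>K\<^esub> = r" if "r \<in> carrier K" for r using that by (simp add: L_def)
  moreover have "carrier L = carrier K" by (simp add: L_def)
  ultimately have cL: "carrier L = {r \<odot>\<^bsub>L\<^esub> \<one>\<^bsub>K\<^esub> | r. r \<in> carrier K}" by force
  obtain V :: "('k, 'v) module" and g where g: "linear_map K L V g" "bij_betw g (carrier L) (carrier V)"
    using transport_fin_dim[OF L L.dim_line(2)[OF one cL] coord] .
  interpret g: linear_map K L V g by (rule g(1))
  have gv: "g \<one>\<^bsub>K\<^esub> \<in> carrier V" using one by auto
  have gv0: "g \<one>\<^bsub>K\<^esub> \<noteq> \<zero>\<^bsub>V\<^esub>"
    using linear_inj_iff[OF g(1)] g(2) one by (auto simp: bij_betw_def)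
  have cV: "carrier V = {r \<odot>\<^bsub>V\<^esub> g \<one>\<^bsub>K\<^esub> | r. r \<in> carrier K}"
  proof -
    have "carrier V = g ` carrier L" using g(2) by (simp add: bij_betw_def)
    also have "\<dots> = {g (r \<odot>\<^bsub>L\<^esub> \<one>\<^bsub>K\<^esub>) | r. r \<in> carrier K}" by (subst cL) auto
    also have "\<dots> = {r \<odot>\<^bsub>V\<^esub> g \<one>\<^bsub>K\<^esub> | r. r \<in> carrier K}"
      using g.T_smult[OF _ one(1)] by metis
    finally show ?thesis .
  qed
  define Z where "Z = V\<lparr>carrier := {\<zero>\<^bsub>V\<^esub>}\<rparr>"
  have "submodule K {\<zero>\<^bsub>V\<^esub>} V"
    by (rule submodule.intro) (auto intro: g.W.module.module_axioms)
  then have Z: "vectorspace K Z"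
    unfolding Z_def using linear_mapD(1)[OF linear_map_from_subspace[OF linear_map_id[OF linear_mapD(2)[OF g(1)]]]] by blast
  define X :: "('a, 'b, 'k, 'v) quiver_rep" where
    "X = \<lparr>rep_space = (\<lambda>j. if j = i then V else Z), rep_map = (\<lambda>a v. \<zero>\<^bsub>V\<^esub>)\<rparr>"
  have [simp]: "\<zero>\<^bsub>Z\<^esub> = \<zero>\<^bsub>V\<^esub>" by (simp add: Z_def)
  have vs: "vectorspace K (rep_space X j)" for j using Z linear_mapD(2)[OF g(1)] by (simp add: X_def)
  have z: "\<zero>\<^bsub>rep_space X j\<^esub> = \<zero>\<^bsub>V\<^esub>" for j by (simp add: X_def)
  have "representation K Q X"
    unfolding representation_def
    using vs linear_map_zero[OF vs vs] z by (auto simp: X_def split: if_splits)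
  moreover have "simple_at K Q i X"
    unfolding simple_at_def using gv gv0 cV by (auto simp: X_def Z_def)
  ultimately show thesis using that by blast
qed

section \<open>Existence of reflections\<close>

lemma rep_endomorphism_id_off:
  assumes X: "representation K Q X" and p: "linear_map K (rep_space X i) (rep_space X i) p"
    and head: "\<And>a v. \<lbrakk>a \<in> arcs Q; head Q a = i; v \<in> vectors X (tail Q a)\<rbrakk> \<Longrightarrow>
      tail Q a \<noteq> i \<and> p (rep_map X a v) = rep_map X a v"
    and tail: "\<And>a v. \<lbrakk>a \<in> arcs Q; tail Q a = i; v \<in> vectors X (tail Q a)\<rbrakk> \<Longrightarrow>
      head Q a \<noteq> i \<and> rep_map X a (p v) = rep_map X a v"
  shows "rep_morphism K Q X X (\<lambda>j. if j = i then p else (\<lambda>v. v))"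
  unfolding rep_morphism_def
  using p linear_map_id[OF representationD(1)[OF X]] head tail by auto

text \<open>The projection onto a line at \<open>i\<close> commutes with the structure maps, as these all vanish. It is not
zero, so it has to be the identity.\<close>

lemma concentrated_imp_simple_at:
  assumes Q: "wf_digraph Q" and X: "representation K Q X" "finite_dimensional K Q X" "trivial_idempotents K Q X"
    and i: "i \<in> verts Q" and loops: "\<And>a. a \<in> arcs Q \<Longrightarrow> \<not> (tail Q a = i \<and> head Q a = i)"
    and conc: "\<And>j v. \<lbrakk>j \<in> verts Q - {i}; v \<in> vectors X j\<rbrakk> \<Longrightarrow> v = \<zero>\<^bsub>rep_space X j\<^esub>"
  shows "simple_at K Q i X"
proof -
  interpret wf_digraph Q by fact
  interpret V: vectorspace K "rep_space X i" by (rule representationD(1)[OF X(1) i])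
  have c: "vectors X j = {\<zero>\<^bsub>rep_space X j\<^esub>}" if "j \<in> verts Q - {i}" for j
    using conc[OF that] zero_in_rep_space[OF X(1), of j] that by blast
  have "\<exists>v\<in>vectors X i. v \<noteq> \<zero>\<^bsub>rep_space X i\<^esub>"
  proof (rule ccontr)
    assume "\<not> ?thesis"
    then have "vectors X i = {\<zero>\<^bsub>rep_space X i\<^esub>}" using zero_in_rep_space[OF X(1) i] by auto
    then have "rep_zero Q X" using c by (auto simp: rep_zero_def)
    then show False using X(3) by (simp add: trivial_idempotents_def)
  qed
  then obtain v where v: "v \<in> vectors X i" "v \<noteq> \<zero>\<^bsub>rep_space X i\<^esub>" by blast
  let ?N = "{r \<odot>\<^bsub>rep_space X i\<^esub> v | r. r \<in> carrier K}"
  have N: "submodule K ?N (rep_space X i)"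
  proof (rule submodule.intro)
    show "module K (rep_space X i)" by unfold_locales
    show "?N \<subseteq> vectors X i" using v(1) by auto
    show "\<zero>\<^bsub>rep_space X i\<^esub> \<in> ?N" using v(1) by (auto simp: V.lmult_0 intro!: exI[of _ "\<zero>\<^bsub>K\<^esub>"])
    fix x y assume "x \<in> ?N" "y \<in> ?N"
    then obtain r s where "x = r \<odot>\<^bsub>rep_space X i\<^esub> v" "y = s \<odot>\<^bsub>rep_space X i\<^esub> v" "r \<in> carrier K" "s \<in> carrier K" by auto
    then show "x \<oplus>\<^bsub>rep_space X i\<^esub> y \<in> ?N"
      using v(1) by (auto simp flip: V.smult_l_distr intro!: exI[of _ "r \<oplus>\<^bsub>K\<^esub> s"])
  next
    fix t x assume "t \<in> carrier K" "x \<in> ?N"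
    then obtain r where "x = r \<odot>\<^bsub>rep_space X i\<^esub> v" "r \<in> carrier K" by auto
    then show "t \<odot>\<^bsub>rep_space X i\<^esub> x \<in> ?N"
      using v(1) \<open>t \<in> carrier K\<close> by (auto simp flip: V.smult_assoc1 intro!: exI[of _ "t \<otimes>\<^bsub>K\<^esub> r"])
  qed
  obtain p where p: "linear_map K (rep_space X i) (rep_space X i) p"
    "\<And>x. x \<in> vectors X i \<Longrightarrow> p x \<in> ?N" "\<And>n. n \<in> ?N \<Longrightarrow> p n = n"
    using V.projection_onto_subspace[OF _ N] X(2) i unfolding finite_dimensional_def by blast
  let ?e = "\<lambda>j. if j = i then p else (\<lambda>v. v)"
  have e: "rep_morphism K Q X X ?e"
  proof (rule rep_endomorphism_id_off[OF X(1) p(1)])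
    fix a x assume a: "a \<in> arcs Q" "head Q a = i" and x: "x \<in> vectors X (tail Q a)"
    have "tail Q a \<noteq> i" using loops a by blast
    moreover then have "x = \<zero>\<^bsub>rep_space X (tail Q a)\<^esub>" using conc[OF _ x] tail_in_verts[OF a(1)] by simp
    ultimately show "tail Q a \<noteq> i \<and> p (rep_map X a x) = rep_map X a x"
      using linear_mapD(7)[OF representationD(2)[OF X(1) a(1)]] linear_mapD(7)[OF p(1)] a(2) by simp
  next
    fix a x assume a: "a \<in> arcs Q" "tail Q a = i" and x: "x \<in> vectors X (tail Q a)"
    have h: "head Q a \<noteq> i" using loops a by blast
    have "rep_map X a y = \<zero>\<^bsub>rep_space X (head Q a)\<^esub>" if "y \<in> vectors X i" for y
      using conc[of "head Q a" "rep_map X a y"] representationD(3)[OF X(1) a(1), of y] that h a(2) head_in_verts[OF a(1)] by simp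
    then show "head Q a \<noteq> i \<and> rep_map X a (p x) = rep_map X a x"
      using h x a(2) linear_mapD(3)[OF p(1)] by simp
  qed
  have "?e j (?e j x) = ?e j x" if "x \<in> vectors X j" for j x
    using p(2,3) that by (cases "j = i") auto
  then consider "\<forall>j\<in>verts Q. \<forall>v\<in>vectors X j. ?e j v = \<zero>\<^bsub>rep_space X j\<^esub>"
    | "\<forall>j\<in>verts Q. \<forall>v\<in>vectors X j. ?e j v = v"
    using X(3) e unfolding trivial_idempotents_def by blast
  then have "vectors X i = ?N"
  proof cases
    case 1
    have "v \<in> ?N" using v(1) by (auto intro!: exI[of _ "\<one>\<^bsub>K\<^esub>"])
    then have "p v = v" by (rule p(3))
    moreover have "p v = \<zero>\<^bsub>rep_space X i\<^esub>" using 1 i v(1) by (auto dest: bspec[of _ _ i])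
    ultimately show ?thesis using v(2) by simp
  next
    case 2
    then have "p x = x" if "x \<in> vectors X i" for x using that i by (auto dest: bspec[of _ _ i])
    then show ?thesis using p(2) submodule.subset[OF N] by (metis (no_types, lifting) subsetI subset_antisym)
  qed
  then show ?thesis unfolding simple_at_def using c v by blast
qed

context sink_quiver
begin

lemma incoming_space_fin_dim:
  assumes "field K" "\<And>j. j \<in> verts Q - {i} \<Longrightarrow> vectorspace K (rep_space X j)"
    "\<And>j. j \<in> verts Q - {i} \<Longrightarrow> vectorspace.fin_dim K (rep_space X j)"
  shows "vectorspace.fin_dim K (incoming_space Q X i)"
proof -
  have "tail Q a \<in> verts Q - {i}" if "a \<in> A" for a using A_facts[OF that] by simp
  then show ?thesis
    unfolding incoming_space_def using assms
    by (intro prod_space_fin_dim_dim[THEN conjunct1]) (auto simp del: in_in_arcs_conv)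
qed

text \<open>If the sum of the incoming maps is not onto, a projection onto its image extends by the identity
to an idempotent of \<open>X\<close> other than 1. So it is 0, and \<open>X\<close> is concentrated at \<open>i\<close>. If the sum is onto,
its kernel is the space of the reflection at \<open>i\<close>.\<close>

lemma exists_reflected_of_sink:
  fixes X :: "('a, 'b, 'k, 'v) quiver_rep"
  assumes coord: "contains_coordinate_spaces TYPE('v) K"
    and X: "representation K Q X" "finite_dimensional K Q X" "trivial_idempotents K Q X"
  shows "simple_at K Q i X \<or> (\<exists>Y :: ('a, 'b, 'k, 'v) quiver_rep. reflected K Q i X Y)"
proof -
  let ?P = "incoming_space Q X i" and ?s = "incoming_map Q X i"
  note lin = linear_incoming_map[OF X(1)]
  interpret s: linear_map K ?P "rep_space X i" ?s by (rule lin)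
  have wf: "wf_digraph Q" by unfold_locales
  have loops: "\<not> (tail Q a = i \<and> head Q a = i)" if "a \<in> arcs Q" for a
    using that sink by (auto simp: sink_def)
  have fin: "vectorspace.fin_dim K (rep_space X j)" if "j \<in> verts Q" for j
    using X(2) that by (simp add: finite_dimensional_def)
  have finP: "vectorspace.fin_dim K ?P"
    by (rule incoming_space_fin_dim[OF rep_field[OF X(1)]]) (use representationD(1)[OF X(1)] fin in auto)
  show ?thesis
  proof (cases "?s ` carrier ?P = vectors X i")
    case False
    have N: "submodule K (?s ` carrier ?P) (rep_space X i)" using s.im_is_submodule by (simp add: s.im_def)
    obtain p where p: "linear_map K (rep_space X i) (rep_space X i) p"
      "\<And>x. x \<in> vectors X i \<Longrightarrow> p x \<in> ?s ` carrier ?P" "\<And>n. n \<in> ?s ` carrier ?P \<Longrightarrow> p n = n"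
      using s.W.projection_onto_subspace[OF fin[OF i_in_verts] N] by blast
    let ?e = "\<lambda>j. if j = i then p else (\<lambda>v. v)"
    have e: "rep_morphism K Q X X ?e"
    proof (rule rep_endomorphism_id_off[OF X(1) p(1)])
      fix a v assume a: "a \<in> arcs Q" "head Q a = i" and v: "v \<in> vectors X (tail Q a)"
      have A: "a \<in> A" using a by simp
      have "single X a v \<in> carrier ?P"
        by (rule single_in_incoming_space[OF _ A v]) (use representationD(1)[OF X(1)] in auto)
      then have "rep_map X a v \<in> ?s ` carrier ?P" using incoming_map_single[OF X(1) A v] by (metis imageI)
      then show "tail Q a \<noteq> i \<and> p (rep_map X a v) = rep_map X a v" using p(3) A_facts(4)[OF A] by blast
    qed (use sink in \<open>auto simp: sink_def\<close>)
    have "?e j (?e j x) = ?e j x" if "x \<in> vectors X j" for j x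
      using p(2,3) that by (cases "j = i") auto
    then consider "\<forall>j\<in>verts Q. \<forall>v\<in>vectors X j. ?e j v = \<zero>\<^bsub>rep_space X j\<^esub>"
      | "\<forall>j\<in>verts Q. \<forall>v\<in>vectors X j. ?e j v = v"
      using X(3) e unfolding trivial_idempotents_def by blast
    then have "simple_at K Q i X"
    proof cases
      case 1
      have "v = \<zero>\<^bsub>rep_space X j\<^esub>" if "j \<in> verts Q - {i}" "v \<in> vectors X j" for j v
        using bspec[OF bspec[OF 1] that(2)] that(1) by simp
      with loops show ?thesis by (rule concentrated_imp_simple_at[OF wf X i_in_verts])
    next
      case 2
      have "p v = v" if "v \<in> vectors X i" for v
        using bspec[OF bspec[OF 2 i_in_verts] that] by simp
      then have "vectors X i \<subseteq> ?s ` carrier ?P" using p(2) by (metis subsetI)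
      then show ?thesis using False submodule.subset[OF N] by blast
    qed
    then show ?thesis ..
  next
    case True
    let ?k = "?P\<lparr>carrier := s.kerT\<rparr>"
    have inc: "linear_map K ?k ?P (\<lambda>f. f)"
      by (rule linear_map_from_subspace[OF linear_map_id[OF linear_mapD(1)[OF lin]] s.ker_is_submodule])
    have kP: "s.kerT \<subseteq> carrier ?P" by (auto simp: s.ker_def)
    have fink: "vectorspace.fin_dim K ?k"
      by (rule exact_sequence_kernel_fin_dim[OF inc _ finP]) simp
    obtain Z :: "('k, 'v) module" and g where g: "linear_map K ?k Z g" "bij_betw g (carrier ?k) (carrier Z)"
      using transport_fin_dim[OF linear_mapD(1)[OF inc] fink coord] .
    define h where "h = inv_into (carrier ?k) g"
    have h: "linear_map K Z ?k h" unfolding h_def by (rule linear_map_inv_into[OF g])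
    have hb: "bij_betw h (carrier Z) (carrier ?k)" unfolding h_def by (rule bij_betw_inv_into[OF g(2)])
    have hP: "linear_map K Z ?P h" using linear_map_comp[OF h inc] by (simp add: o_def)
    have finZ: "vectorspace.fin_dim K Z"
      by (rule linear_map.surj_fin_dim[OF g(1) fink]) (use g(2) in \<open>simp add: bij_betw_def\<close>)
    define Y where "Y = \<lparr>rep_space = (rep_space X)(i := Z),
      rep_map = (\<lambda>a. if a \<in> A then (\<lambda>z. h z a) else rep_map X a)\<rparr>"
    have Yi: "rep_space Y i = Z" and Yj: "\<And>j. j \<noteq> i \<Longrightarrow> rep_space Y j = rep_space X j"
      and YA: "\<And>a. a \<in> A \<Longrightarrow> rep_map Y a = (\<lambda>z. h z a)" and YnA: "\<And>a. a \<notin> A \<Longrightarrow> rep_map Y a = rep_map X a"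
      unfolding Y_def by (simp_all del: in_in_arcs_conv)
    have Yrep: "representation K (flip i Q) Y"
      unfolding representation_def
    proof (intro conjI ballI)
      fix j assume "j \<in> verts (flip i Q)"
      then show "vectorspace K (rep_space Y j)"
        using linear_mapD(2)[OF g(1)] representationD(1)[OF X(1), of j] Yi Yj by (cases "j = i") auto
    next
      fix a assume "a \<in> arcs (flip i Q)"
      then have a: "a \<in> arcs Q" by simp
      show "linear_map K (rep_space Y (tail (flip i Q) a)) (rep_space Y (head (flip i Q) a)) (rep_map Y a)"
      proof (cases "a \<in> A")
        case True
        note F = A_facts[OF True]
        have "linear_map K ?P (rep_space X (tail Q a)) (\<lambda>f. f a)"
          unfolding incoming_space_def
          by (rule linear_map_eval[OF rep_field[OF X(1)] representationD(1)[OF X(1) A_facts(3)] True])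
        from linear_map_comp[OF hP this] show ?thesis
          unfolding F(5,6) YA[OF True] Yi Yj[OF F(4)] by (simp add: o_def)
      next
        case False
        note F = not_A_facts[OF a False]
        show ?thesis
          unfolding F(3,4) YnA[OF False] Yj[OF F(1)] Yj[OF F(2)] by (rule representationD(2)[OF X(1) a])
      qed
    qed
    have Yfin: "finite_dimensional K (flip i Q) Y"
      using fin finZ Yi Yj by (auto simp: finite_dimensional_def) (metis)
    have out: "outgoing_map Q Y i z = h z" if z: "z \<in> carrier Z" for z
    proof -
      have "h z \<in> carrier ?P" by (rule linear_mapD(3)[OF hP z])
      then have "h z \<in> extensional A" unfolding incoming_space_def by (simp add: PiE_def)
      then have "restrict (h z) A = h z" by (rule extensional_restrict)
      moreover have "outgoing_map Q Y i z = restrict (h z) A"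
        unfolding outgoing_map_def by (rule restrict_ext) (simp add: YA del: in_in_arcs_conv)
      ultimately show ?thesis by simp
    qed
    have "inj_on (outgoing_map Q Y i) (carrier Z)"
      using hb inj_on_cong[of "carrier Z" "outgoing_map Q Y i" h] out by (simp add: bij_betw_def)
    moreover have "outgoing_map Q Y i ` carrier Z = s.kerT"
      using hb out by (auto simp: bij_betw_def image_iff)
    ultimately have "reflected K Q i X Y"
      unfolding reflected_def using X(1,2) Yrep Yfin Yj YnA True
      by (auto simp: Yi s.ker_def)
    then show ?thesis by blast
  qed
qed

lemma linear_map_single:
  assumes "field K" "\<And>j. j \<in> verts Q - {i} \<Longrightarrow> vectorspace K (rep_space X j)" "a \<in> A"
  shows "linear_map K (rep_space X (tail Q a)) (incoming_space Q X i) (single X a)"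
proof -
  have vs: "vectorspace K (rep_space X (tail Q b))" if "b \<in> A" for b using assms(2) A_facts[OF that] by simp
  have "linear_map K (rep_space X (tail Q a)) (rep_space X (tail Q b))
      (\<lambda>v. if b = a then v else \<zero>\<^bsub>rep_space X (tail Q b)\<^esub>)" if "b \<in> A" for b
    using linear_map_id[OF vs[OF assms(3)]] linear_map_zero[OF vs[OF assms(3)] vs[OF that]] by (cases "b = a") auto
  then show ?thesis
    unfolding incoming_space_def single_def[abs_def] by (rule linear_map_into_prod_space[OF vs[OF assms(3)]])
qed

lemma finsum_single:
  assumes "field K" "\<And>j. j \<in> verts Q - {i} \<Longrightarrow> vectorspace K (rep_space X j)"
    and f: "f \<in> carrier (incoming_space Q X i)"
  shows "finsum (incoming_space Q X i) (\<lambda>a. single X a (f a)) A = f"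
proof -
  let ?P = "incoming_space Q X i"
  have vs: "vectorspace K (rep_space X (tail Q b))" if "b \<in> A" for b using assms(2) A_facts[OF that] by simp
  have P: "vectorspace K ?P"
    unfolding incoming_space_def by (rule vectorspace_prod_space[OF assms(1) vs])
  interpret P: vectorspace K ?P by (rule P)
  have fb: "f b \<in> vectors X (tail Q b)" if "b \<in> A" for b
    using PiE_mem[OF _ that] f unfolding incoming_space_def prod_space_simps(1) by blast
  have s: "(\<lambda>a. single X a (f a)) \<in> A \<rightarrow> carrier ?P"
    by (rule Pi_I, rule single_in_incoming_space[OF assms(2) _ fb])
  have "finsum ?P (\<lambda>a. single X a (f a)) A b = f b" if b: "b \<in> A" for b
  proof -
    interpret vectorspace K "rep_space X (tail Q b)" by (rule vs[OF b])
    have ev: "linear_map K ?P (rep_space X (tail Q b)) (\<lambda>f. f b)"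
      unfolding incoming_space_def by (rule linear_map_eval[OF assms(1) vs b])
    have "finsum ?P (\<lambda>a. single X a (f a)) A b = finsum (rep_space X (tail Q b)) (\<lambda>a. single X a (f a) b) A"
      by (rule linear_map_finsum[OF ev fin_A s])
    also have "\<dots> = finsum (rep_space X (tail Q b)) (\<lambda>a. if b = a then f b else \<zero>\<^bsub>rep_space X (tail Q b)\<^esub>) A"
      by (rule M.finsum_cong'[OF refl]) (use b fb in \<open>auto simp: single_def\<close>)
    also have "\<dots> = f b" using b fb[OF b] fin_A by (intro M.add.finprod_singleton[of b A "\<lambda>_. f b"]) auto
    finally show ?thesis .
  qed
  moreover have "finsum ?P (\<lambda>a. single X a (f a)) A \<in> carrier ?P" by (rule P.M.finsum_closed[OF s])
  ultimately show ?thesis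
    using f unfolding incoming_space_def prod_space_simps(1) by (intro PiE_ext) auto
qed

text \<open>If the tuple of the outgoing maps is not injective, a projection onto its kernel extends by zero to
an idempotent of \<open>Y\<close> other than 0. So it is 1, and \<open>Y\<close> is concentrated at \<open>i\<close>. If the tuple is
injective, a complement of its image, that is, the image of \<open>id - p\<close> for a projection \<open>p\<close> onto it, is
the space of the reflection at \<open>i\<close>.\<close>

lemma exists_reflected_of_source:
  fixes Y :: "('a, 'b, 'k, 'v) quiver_rep"
  assumes coord: "contains_coordinate_spaces TYPE('v) K"
    and Y: "representation K (flip i Q) Y" "finite_dimensional K (flip i Q) Y" "trivial_idempotents K (flip i Q) Y"
  shows "simple_at K (flip i Q) i Y \<or> (\<exists>X :: ('a, 'b, 'k, 'v) quiver_rep. reflected K Q i X Y)"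
proof -
  let ?P = "incoming_space Q Y i" and ?o = "outgoing_map Q Y i"
  note lin = linear_outgoing_map[OF Y(1)]
  interpret o: linear_map K "rep_space Y i" ?P ?o by (rule lin)
  have i: "i \<in> verts (flip i Q)" using i_in_verts by simp
  have loops: "\<not> (tail (flip i Q) a = i \<and> head (flip i Q) a = i)" if "a \<in> arcs (flip i Q)" for a
    using that sink by (auto simp: sink_def)
  have vsY: "vectorspace K (rep_space Y j)" if "j \<in> verts Q" for j
    using representationD(1)[OF Y(1)] that by simp
  have fin: "vectorspace.fin_dim K (rep_space Y j)" if "j \<in> verts Q" for j
    using Y(2) that by (simp add: finite_dimensional_def)
  note K = rep_field_flip[OF Y(1)]
  have finP: "vectorspace.fin_dim K ?P"
    by (rule incoming_space_fin_dim[OF K]) (use vsY fin in auto)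
  show ?thesis
  proof (cases "inj_on ?o (vectors Y i)")
    case False
    obtain p where p: "linear_map K (rep_space Y i) (rep_space Y i) p"
      "\<And>x. x \<in> vectors Y i \<Longrightarrow> p x \<in> o.kerT" "\<And>n. n \<in> o.kerT \<Longrightarrow> p n = n"
      using o.V.projection_onto_subspace[OF fin[OF i_in_verts] o.ker_is_submodule] by blast
    let ?e = "\<lambda>j. if j = i then p else (\<lambda>v. \<zero>\<^bsub>rep_space Y j\<^esub>)"
    have e: "rep_morphism K (flip i Q) Y Y ?e"
      unfolding rep_morphism_def
    proof (intro conjI ballI)
      fix j assume "j \<in> verts (flip i Q)"
      then show "linear_map K (rep_space Y j) (rep_space Y j) (?e j)"
        using p(1) linear_map_zero[OF vsY vsY, of j j] by simp
    next
      fix a v assume "a \<in> arcs (flip i Q)" and v: "v \<in> vectors Y (tail (flip i Q) a)"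
      then have a: "a \<in> arcs Q" by simp
      note Ya = representationD(2)[OF Y(1), of a]
      show "rep_map Y a (?e (tail (flip i Q) a) v) = ?e (head (flip i Q) a) (rep_map Y a v)"
      proof (cases "a \<in> A")
        case True
        note F = A_facts[OF True]
        have z: "?o (p v) = \<zero>\<^bsub>?P\<^esub>" using p(2)[of v] v F by (simp add: o.ker_def del: flip_simps(3,4))
        have "rep_map Y a (p v) = \<zero>\<^bsub>rep_space Y (tail Q a)\<^esub>"
          using fun_cong[OF z, of a] True
          by (simp add: outgoing_map_def incoming_space_def del: in_in_arcs_conv)
        then show ?thesis using F by (simp del: flip_simps(3,4))
      next
        case False
        note F = not_A_facts[OF a False]
        show ?thesis using linear_mapD(7)[OF Ya] F a by (simp del: flip_simps(3,4))
      qed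
    qed
    have "?e j (?e j x) = ?e j x" if "x \<in> vectors Y j" for j x
      using p(2,3) that by (cases "j = i") auto
    then consider "\<forall>j\<in>verts (flip i Q). \<forall>v\<in>vectors Y j. ?e j v = \<zero>\<^bsub>rep_space Y j\<^esub>"
      | "\<forall>j\<in>verts (flip i Q). \<forall>v\<in>vectors Y j. ?e j v = v"
      using Y(3) e unfolding trivial_idempotents_def by blast
    then have "simple_at K (flip i Q) i Y"
    proof cases
      case 1
      have "v = \<zero>\<^bsub>rep_space Y i\<^esub>" if "v \<in> vectors Y i" "?o v = \<zero>\<^bsub>?P\<^esub>" for v
        using bspec[OF bspec[OF 1 i] that(1)] p(3)[of v] that by (simp add: o.ker_def)
      then have "inj_on ?o (vectors Y i)" using linear_inj_iff[OF lin] by blast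
      then show ?thesis using False by blast
    next
      case 2
      have "v = \<zero>\<^bsub>rep_space Y j\<^esub>" if "j \<in> verts (flip i Q) - {i}" "v \<in> vectors Y j" for j v
        using bspec[OF bspec[OF 2] that(2)] that(1) by simp
      with loops show ?thesis by (rule concentrated_imp_simple_at[OF wf_flip Y i])
    qed
    then show ?thesis ..
  next
    case True
    have N: "submodule K (?o ` vectors Y i) ?P" using o.im_is_submodule by (simp add: o.im_def)
    obtain p where p: "linear_map K ?P ?P p" "\<And>x. x \<in> carrier ?P \<Longrightarrow> p x \<in> ?o ` vectors Y i"
      "\<And>n. n \<in> ?o ` vectors Y i \<Longrightarrow> p n = n"
      using o.W.projection_onto_subspace[OF finP N] by blast
    \<comment> \<open>The image of \<open>q\<close> is a complement that serves as the quotient by the image of \<open>Y\<close> at \<open>i\<close>.\<close>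
    define q where "q f = f \<ominus>\<^bsub>?P\<^esub> p f" for f
    have q: "linear_map K ?P ?P q" unfolding q_def by (rule linear_map_id_minus[OF p(1)])
    interpret q: linear_map K ?P ?P q by (rule q)
    have q0: "q f = \<zero>\<^bsub>?P\<^esub> \<longleftrightarrow> f \<in> ?o ` vectors Y i" if f: "f \<in> carrier ?P" for f
    proof -
      have pf: "p f \<in> carrier ?P" by (rule linear_mapD(3)[OF p(1) f])
      have "q f = \<zero>\<^bsub>?P\<^esub> \<longleftrightarrow> f = p f"
      proof
        assume "q f = \<zero>\<^bsub>?P\<^esub>"
        then show "f = p f" using f pf unfolding q_def by (simp add: o.W.module.M.minus_other_side del: prod_space_simps)
      next
        assume "f = p f"
        then have "q f = f \<ominus>\<^bsub>?P\<^esub> f" by (simp add: q_def)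
        then show "q f = \<zero>\<^bsub>?P\<^esub>" using f by (simp add: o.W.module.M.minus_eq o.W.module.M.r_neg)
      qed
      then show ?thesis using p(2)[OF f] p(3)[of f] by metis
    qed
    let ?C = "?P\<lparr>carrier := q.imT\<rparr>"
    have qC: "linear_map K ?P ?C q"
      by (rule linear_map_to_subspace[OF q q.im_is_submodule]) (auto simp: q.im_def)
    have finC: "vectorspace.fin_dim K ?C"
      by (rule linear_map.surj_fin_dim[OF qC finP]) (simp add: q.im_def)
    obtain Z :: "('k, 'v) module" and g where g: "linear_map K ?C Z g" "bij_betw g (carrier ?C) (carrier Z)"
      using transport_fin_dim[OF linear_mapD(2)[OF qC] finC coord] .
    have finZ: "vectorspace.fin_dim K Z"
      by (rule linear_map.surj_fin_dim[OF g(1) finC]) (use g(2) in \<open>simp add: bij_betw_def\<close>)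
    have gq: "linear_map K ?P Z (g \<circ> q)" by (rule linear_map_comp[OF qC g(1)])
    define X where "X = \<lparr>rep_space = (rep_space Y)(i := Z),
      rep_map = (\<lambda>a. if a \<in> A then (g \<circ> q) \<circ> single Y a else rep_map Y a)\<rparr>"
    have Xi: "rep_space X i = Z" and Xj: "\<And>j. j \<noteq> i \<Longrightarrow> rep_space X j = rep_space Y j"
      and XA: "\<And>a. a \<in> A \<Longrightarrow> rep_map X a = (g \<circ> q) \<circ> single Y a" and XnA: "\<And>a. a \<notin> A \<Longrightarrow> rep_map X a = rep_map Y a"
      unfolding X_def by (simp_all del: in_in_arcs_conv)
    have XP: "incoming_space Q X i = ?P" by (rule incoming_space_cong) (simp add: Xj)
    have sing: "linear_map K (rep_space Y (tail Q a)) ?P (single Y a)" if "a \<in> A" for a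
      by (rule linear_map_single[OF K _ that]) (simp add: vsY)
    have Xrep: "representation K Q X"
      unfolding representation_def
    proof (intro conjI ballI)
      fix j assume "j \<in> verts Q"
      then show "vectorspace K (rep_space X j)"
        using linear_mapD(2)[OF g(1)] vsY[of j] Xi Xj by (cases "j = i") auto
    next
      fix a assume a: "a \<in> arcs Q"
      show "linear_map K (rep_space X (tail Q a)) (rep_space X (head Q a)) (rep_map X a)"
      proof (cases "a \<in> A")
        case True
        note F = A_facts[OF True]
        show ?thesis unfolding F(2) XA[OF True] Xi Xj[OF F(4)] by (rule linear_map_comp[OF sing[OF True] gq])
      next
        case False
        note F = not_A_facts[OF a False]
        show ?thesis
          using representationD(2)[OF Y(1), of a] a unfolding F(3,4) XnA[OF False] Xj[OF F(1)] Xj[OF F(2)] by simp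
      qed
    qed
    have Xfin: "finite_dimensional K Q X"
      using fin finZ Xi Xj by (auto simp: finite_dimensional_def) (metis)
    have inc: "incoming_map Q X i f = g (q f)" if f: "f \<in> carrier ?P" for f
    proof -
      have fb: "f b \<in> vectors Y (tail Q b)" if "b \<in> A" for b
        using PiE_mem[OF _ that] f unfolding incoming_space_def prod_space_simps(1) by blast
      have s: "(\<lambda>a. single Y a (f a)) \<in> A \<rightarrow> carrier ?P"
        by (rule Pi_I, rule linear_mapD(3)[OF sing fb])
      interpret Z: vectorspace K Z by (rule linear_mapD(2)[OF g(1)])
      have "incoming_map Q X i f = finsum Z (\<lambda>a. (g \<circ> q) (single Y a (f a))) A"
        unfolding incoming_map_def Xi
        by (rule Z.M.finsum_cong'[OF refl])
          (use linear_mapD(3)[OF gq] s in \<open>auto simp: XA Pi_iff simp del: in_in_arcs_conv\<close>)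
      also have "\<dots> = (g \<circ> q) (finsum ?P (\<lambda>a. single Y a (f a)) A)"
        by (rule linear_map_finsum[OF gq fin_A s, symmetric])
      also have "finsum ?P (\<lambda>a. single Y a (f a)) A = f"
        by (rule finsum_single[OF K _ f]) (simp add: vsY)
      finally show ?thesis by simp
    qed
    have "incoming_map Q X i ` carrier ?P = carrier Z"
    proof -
      have "incoming_map Q X i ` carrier ?P = g ` q ` carrier ?P"
        unfolding image_image by (rule image_cong[OF refl inc])
      then show ?thesis using g(2) by (simp add: bij_betw_def q.im_def)
    qed
    moreover have "incoming_map Q X i f = \<zero>\<^bsub>Z\<^esub> \<longleftrightarrow> f \<in> ?o ` vectors Y i" if f: "f \<in> carrier ?P" for f
    proof -
      have qf: "q f \<in> carrier ?C" by (rule linear_mapD(3)[OF qC f])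
      have z: "\<zero>\<^bsub>?C\<^esub> \<in> carrier ?C" using submodule.zero_closed[OF q.im_is_submodule] by simp
      have "g (q f) = \<zero>\<^bsub>Z\<^esub> \<longleftrightarrow> q f = \<zero>\<^bsub>?C\<^esub>"
        using inj_onD[OF bij_betw_imp_inj_on[OF g(2)] _ qf z] linear_mapD(7)[OF g(1)] by metis
      then show ?thesis using q0[OF f] inc[OF f] by simp
    qed
    ultimately have "reflected K Q i X Y"
      unfolding reflected_def using Y(1,2) Xrep Xfin Xj XnA True
      by (auto simp: Xi XP simp del: in_in_arcs_conv)
    then show ?thesis by blast
  qed
qed

end

section \<open>Classification by induction along an admissible sequence\<close>

definition indecomposables_of_dim ::
  "('k, 'm) ring_scheme \<Rightarrow> ('a, 'b) pre_digraph \<Rightarrow> ('a \<Rightarrow> int) \<Rightarrow> ('a, 'b, 'k, 'v) quiver_rep set" where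
  "indecomposables_of_dim K Q x =
     {X. representation K Q X \<and> finite_dimensional K Q X \<and> trivial_idempotents K Q X \<and> dim_vector K Q X = x}"

definition unit_vector :: "('a, 'b) pre_digraph \<Rightarrow> 'a \<Rightarrow> 'a \<Rightarrow> int" where
  "unit_vector Q i = (\<lambda>j\<in>verts Q. if j = i then 1 else 0)"

context sink_quiver
begin

lemma neighbour_sum_at: "neighbour_sum Q i x = (\<Sum>a\<in>A. x (tail Q a))"
  using neighbour_sum_sink[OF fin_digraph_axioms sink] by (simp add: in_arcs_def)

lemma neighbour_sum_upd: "neighbour_sum Q i (x(i := t)) = neighbour_sum Q i x"
  unfolding neighbour_sum_at using A_facts by (intro sum.cong) auto

lemma reflection_involution: "reflection Q i (reflection Q i x) = x"
  by (simp add: reflection_def neighbour_sum_upd)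

text \<open>This separates the simple representation at \<open>i\<close> from those that are considered in the case where
the reflected vector is non-negative.\<close>

lemma reflection_unit_vector: "reflection Q i (unit_vector Q i) i < 0"
proof -
  have "neighbour_sum Q i (unit_vector Q i) = 0"
    unfolding neighbour_sum_at using A_facts by (intro sum.neutral) (auto simp: unit_vector_def)
  then show ?thesis using i_in_verts by (simp add: reflection_def unit_vector_def)
qed

lemma no_loop_at: "a \<in> arcs Q \<Longrightarrow> \<not> (tail Q a = i \<and> head Q a = i)"
  using sink by (auto simp: sink_def)

lemma reflected_in_indecomposables_of_dim:
  assumes "reflected K Q i X Y"
  shows "X \<in> indecomposables_of_dim K Q x \<longleftrightarrow>
    Y \<in> indecomposables_of_dim K (flip i Q) (reflection Q i x)"
proof -
  have "dim_vector K Q X = x \<longleftrightarrow> dim_vector K (flip i Q) Y = reflection Q i x"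
    using reflected_dim_vector[OF assms] reflection_involution[of x] by auto
  then show ?thesis
    using reflectedD(1-4)[OF assms] reflected_trivial_idempotents_iff[OF assms]
    by (simp add: indecomposables_of_dim_def)
qed

end

lemma dim_vector_nonneg: "v \<in> verts Q \<Longrightarrow> 0 \<le> dim_vector K Q X v"
  by (simp add: dim_vector_def)

lemma dim_vector_extensional: "dim_vector K Q X \<in> verts Q \<rightarrow>\<^sub>E UNIV"
  by (simp add: dim_vector_def)

text \<open>Existence and uniqueness are proved together by induction along the sequence, for all orientations
at once. If $s_i x$ is non-negative, neither \<open>x\<close> nor $s_i x$ is the coordinate vector at \<open>i\<close>, so that
reflection at \<open>i\<close> sets up a correspondence between the indecomposable representations of these
dimensions, to which the induction hypothesis applies. Otherwise $s_i x$ is negative at \<open>i\<close>, no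
representation of dimension \<open>x\<close> has a reflection, and only the simple one remains.\<close>

theorem classification_along_admissible:
  fixes K :: "('k, 'm) ring_scheme" and Q :: "('a, 'b) pre_digraph"
  assumes K: "field K" and coord: "contains_coordinate_spaces TYPE('v) K"
    and "tits_quiver Q" "admissible Q vs"
    and "x \<in> verts Q \<rightarrow>\<^sub>E UNIV" "\<And>v. v \<in> verts Q \<Longrightarrow> 0 \<le> x v"
    and "u \<in> verts Q" "fold (reflection Q) vs x u < 0"
  defines "Ind \<equiv> \<lambda>Q x. indecomposables_of_dim K Q x :: ('a, 'b, 'k, 'v) quiver_rep set"
  shows "(Ind Q x \<noteq> {} \<longleftrightarrow> tits_form Q x \<le> 1) \<and>
    (\<forall>X\<in>Ind Q x. \<forall>Y\<in>Ind Q x. rep_isomorphic K Q X Y)"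
  using assms(3-8)
proof (induction vs arbitrary: Q x)
  case Nil
  then show ?case by fastforce
next
  case (Cons i vs)
  interpret tits_quiver Q by fact
  interpret sink_quiver Q i using Cons.prems(2) by unfold_locales simp
  have wf: "wf_digraph Q" by unfold_locales
  let ?y = "reflection Q i x"
  note x0 = Cons.prems(4)
  have yj: "?y v = x v" if "v \<noteq> i" for v using that by (simp add: reflection_def)
  have form: "tits_form Q ?y = tits_form Q x" by (rule tits_form_reflection[OF i_in_verts])
  have yext: "?y \<in> verts (flip i Q) \<rightarrow>\<^sub>E UNIV"
  proof -
    have "?y v = undefined" if "v \<notin> verts Q" for v
      using yj[of v] Cons.prems(3) i_in_verts that by (metis PiE_arb)
    then show ?thesis by (simp add: PiE_iff extensional_def)
  qed
  show ?case
  proof (cases "\<forall>v\<in>verts Q. 0 \<le> ?y v")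
    case True
    have IH: "(Ind (flip i Q) ?y \<noteq> {} \<longleftrightarrow> tits_form (flip i Q) ?y \<le> 1) \<and>
        (\<forall>X\<in>Ind (flip i Q) ?y. \<forall>Y\<in>Ind (flip i Q) ?y. rep_isomorphic K (flip i Q) X Y)"
      by (rule Cons.IH[OF tits_quiver_flip]) (use Cons.prems True yext in \<open>auto simp: reflection_flip\<close>)
    \<comment> \<open>Otherwise \<open>?y\<close> or \<open>x\<close> would be negative at \<open>i\<close>.\<close>
    have neq: "x \<noteq> unit_vector Q i" "?y \<noteq> unit_vector Q i"
      using reflection_unit_vector True x0 reflection_involution[of x] i_in_verts by force+
    have refl: "\<exists>Y. reflected K Q i X Y" if "X \<in> Ind Q x" for X
    proof -
      have X: "representation K Q X" "finite_dimensional K Q X" "trivial_idempotents K Q X" "dim_vector K Q X = x"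
        using that by (auto simp: Ind_def indecomposables_of_dim_def)
      have "\<not> simple_at K Q i X"
        using simple_at_dim_vector(1)[OF X(1) _ i_in_verts] neq(1) X(4) by (auto simp: unit_vector_def)
      then show ?thesis using exists_reflected_of_sink[OF coord X(1-3)] by blast
    qed
    have refl': "\<exists>X. reflected K Q i X Y" if "Y \<in> Ind (flip i Q) ?y" for Y
    proof -
      have Y: "representation K (flip i Q) Y" "finite_dimensional K (flip i Q) Y"
        "trivial_idempotents K (flip i Q) Y" "dim_vector K (flip i Q) Y = ?y"
        using that by (auto simp: Ind_def indecomposables_of_dim_def)
      have "\<not> simple_at K (flip i Q) i Y"
        using simple_at_dim_vector(1)[OF Y(1), of i] i_in_verts neq(2) Y(4) by (auto simp: unit_vector_def)
      then show ?thesis using exists_reflected_of_source[OF coord Y(1-3)] by blast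
    qed
    have "Ind Q x \<noteq> {} \<longleftrightarrow> Ind (flip i Q) ?y \<noteq> {}"
      using refl refl' reflected_in_indecomposables_of_dim unfolding Ind_def by blast
    moreover have "rep_isomorphic K Q X X'" if X: "X \<in> Ind Q x" "X' \<in> Ind Q x" for X X'
    proof -
      obtain Y Y' where Y: "reflected K Q i X Y" "reflected K Q i X' Y'" using refl X by blast
      then have "Y \<in> Ind (flip i Q) ?y" "Y' \<in> Ind (flip i Q) ?y"
        using X reflected_in_indecomposables_of_dim unfolding Ind_def by blast+
      then show ?thesis using IH reflected_isomorphic_iff[OF Y] by blast
    qed
    ultimately show ?thesis using IH form by (simp only: tits_form_flip) blast
  next
    case False
    then have yi: "?y i < 0" using x0 yj by (metis not_le)
    have simple: "simple_at K Q i X" if "X \<in> Ind Q x" for X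
    proof -
      have X: "representation K Q X" "finite_dimensional K Q X" "trivial_idempotents K Q X" "dim_vector K Q X = x"
        using that by (auto simp: Ind_def indecomposables_of_dim_def)
      have "\<not> reflected K Q i X Y" for Y
        using reflected_dim_vector(1)[of K X Y] yi X(4) dim_vector_nonneg[of i "flip i Q" K Y] i_in_verts by auto
      then show ?thesis using exists_reflected_of_sink[OF coord X(1-3)] by blast
    qed
    \<comment> \<open>With \<open>N = neighbour_sum Q i x\<close> the form is \<open>x i * (x i - N) + q (x(i := 0))\<close>, and the first term is at least 1.\<close>
    have unit: "x = unit_vector Q i" if q: "tits_form Q x \<le> 1"
    proof -
      let ?z = "x(i := 0)"
      have N: "0 \<le> neighbour_sum Q i x" unfolding neighbour_sum_at using x0 A_facts by (intro sum_nonneg) auto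
      have xi: "x i > neighbour_sum Q i x" using yi by (simp add: reflection_def)
      have "tits_form Q x = x i * (x i - neighbour_sum Q i x) + tits_form Q ?z"
        using tits_form_update[OF i_in_verts, of x "x i"] by (simp add: power2_eq_square algebra_simps)
      moreover have "1 * 1 \<le> x i * (x i - neighbour_sum Q i x)"
        using xi N by (intro mult_mono) auto
      ultimately have z: "tits_form Q ?z \<le> 0" and m: "x i * (x i - neighbour_sum Q i x) + tits_form Q ?z \<le> 1"
        using q by auto
      have off: "x v = 0" if "v \<in> verts Q" "v \<noteq> i" for v
      proof (rule ccontr)
        assume "x v \<noteq> 0"
        then have "0 < tits_form Q ?z" using that by (intro tits_form_pos[of v]) auto
        then show False using z by simp
      qed
      have "tits_form Q ?z = 0" by (rule tits_form_zero) (simp add: off)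
      moreover have "neighbour_sum Q i x = 0"
        unfolding neighbour_sum_at using A_facts off by (intro sum.neutral) auto
      ultimately have "x i * x i \<le> 1" "0 < x i" using m xi by auto
      then have "x i = 1" by (smt (verit) mult_less_cancel_left2)
      then show ?thesis
        using off Cons.prems(3) by (auto simp: unit_vector_def PiE_iff extensional_def fun_eq_iff)
    qed
    have unit_form: "tits_form Q (unit_vector Q i) \<le> 1"
    proof -
      let ?e = "unit_vector Q i"
      have "tits_form Q ?e = tits_form Q (?e(i := 1))" using i_in_verts by (simp add: unit_vector_def fun_upd_idem)
      also have "\<dots> = 1 - neighbour_sum Q i ?e + tits_form Q (?e(i := 0))"
        using tits_form_update[OF i_in_verts, of ?e 1] by simp
      also have "tits_form Q (?e(i := 0)) = 0" by (rule tits_form_zero) (simp add: unit_vector_def)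
      also have "0 \<le> neighbour_sum Q i ?e"
        unfolding neighbour_sum_at using A_facts by (intro sum_nonneg) (auto simp: unit_vector_def)
      finally show ?thesis by simp
    qed
    have "tits_form Q x \<le> 1" if "X \<in> Ind Q x" for X
    proof -
      have "x = unit_vector Q i"
        using that simple_at_dim_vector(1)[OF _ simple[OF that] i_in_verts]
        by (auto simp: Ind_def indecomposables_of_dim_def unit_vector_def)
      then show ?thesis using unit_form by simp
    qed
    moreover have "Ind Q x \<noteq> {}" if q: "tits_form Q x \<le> 1"
    proof -
      obtain X :: "('a, 'b, 'k, 'v) quiver_rep" where X: "representation K Q X" "simple_at K Q i X"
        using exists_simple_at[OF K coord i_in_verts wf no_loop_at] by blast
      then have "X \<in> Ind Q x"
        using simple_at_dim_vector[OF X i_in_verts] simple_at_trivial_idempotents[OF wf X i_in_verts] unit[OF q]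
        by (simp add: Ind_def indecomposables_of_dim_def unit_vector_def)
      then show ?thesis by blast
    qed
    moreover have "rep_isomorphic K Q X Y" if "X \<in> Ind Q x" "Y \<in> Ind Q x" for X Y
      using simple_at_isomorphic[OF wf no_loop_at i_in_verts] simple that
      by (auto simp: Ind_def indecomposables_of_dim_def)
    ultimately show ?thesis by blast
  qed
qed

section \<open>Gabriel's theorem\<close>

lemma tits_quiver_of_dynkin:
  assumes "fin_digraph Q" "dynkin_diagram (underlying_graph Q)"
  shows "tits_quiver Q"
proof -
  interpret fin_digraph Q by fact
  show ?thesis
    using coercive_dynkin[OF assms(2)] unfolding coercive_def quadratic_form_underlying_graph[OF assms(1)]
    by unfold_locales (simp add: underlying_graph_def)
qed

lemma (in vectorspace) dim_pos:
  assumes "fin_dim" "carrier V \<noteq> {\<zero>\<^bsub>V\<^esub>}"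
  shows "0 < dim"
proof (rule ccontr)
  assume "\<not> 0 < dim"
  obtain B where B: "finite B" "basis B" using finite_basis_exists[OF assms(1)] by auto
  then have "B = {}" using dim_basis[OF B] \<open>\<not> 0 < dim\<close> by simp
  then show False using B(2) assms(2) span_empty by (simp add: basis_def)
qed

lemma rep_isomorphic_dim_vector:
  assumes "finite_dimensional K Q X" "rep_isomorphic K Q X Y"
  shows "dim_vector K Q X = dim_vector K Q Y"
  unfolding dim_vector_def
proof (rule restrict_ext)
  fix i assume i: "i \<in> verts Q"
  obtain \<phi> where \<phi>: "linear_map K (rep_space X i) (rep_space Y i) (\<phi> i)"
    "bij_betw (\<phi> i) (vectors X i) (vectors Y i)"
    using assms(2) i by (auto simp: rep_isomorphic_def rep_morphism_def)
  interpret linear_map K "rep_space X i" "rep_space Y i" "\<phi> i" by (rule \<phi>(1))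
  have "vectorspace.dim K (rep_space X i) = vectorspace.dim K (rep_space Y i)"
    using \<phi>(2) assms(1) i by (intro dim_eq) (auto simp: bij_betw_def finite_dimensional_def)
  then show "int (vectorspace.dim K (rep_space X i)) = int (vectorspace.dim K (rep_space Y i))" by simp
qed

lemma indecomposables_eq:
  assumes "wf_digraph Q"
  shows "X \<in> indecomposables K Q \<longleftrightarrow> X \<in> indecomposables_of_dim K Q (dim_vector K Q X)"
  using trivial_idempotents_imp_indecomposable[OF assms] indecomposable_imp_trivial_idempotents[OF assms]
  unfolding indecomposables_def indecomposables_of_dim_def by blast

lemma dim_vector_nonzero:
  assumes "X \<in> indecomposables K Q"
  obtains u where "u \<in> verts Q" "dim_vector K Q X u \<noteq> 0"
proof -
  have X: "representation K Q X" "finite_dimensional K Q X" "\<not> rep_zero Q X"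
    using assms by (auto simp: indecomposables_def indecomposable_def)
  then obtain u where u: "u \<in> verts Q" "vectors X u \<noteq> {\<zero>\<^bsub>rep_space X u\<^esub>}"
    by (auto simp: rep_zero_def)
  interpret vectorspace K "rep_space X u" by (rule representationD(1)[OF X(1) u(1)])
  have "0 < dim" using dim_pos u X(2) by (auto simp: finite_dimensional_def)
  then show thesis using that[OF u(1)] u(1) by (simp add: dim_vector_def)
qed

text \<open>The admissible sequence, which depends on \<open>x\<close>, is supplied by the Coxeter transformation.\<close>

lemma (in tits_quiver) classification:
  fixes K :: "('k, 'm) ring_scheme"
  assumes K: "field K" and coord: "contains_coordinate_spaces TYPE('v) K"
    and x: "x \<in> verts Q \<rightarrow>\<^sub>E UNIV" "\<And>v. v \<in> verts Q \<Longrightarrow> 0 \<le> x v" "u \<in> verts Q" "x u \<noteq> 0"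
  shows "(\<exists>X :: ('a, 'b, 'k, 'v) quiver_rep. X \<in> indecomposables K Q \<and> dim_vector K Q X = x) \<longleftrightarrow> tits_form Q x \<le> 1"
    and "\<And>(X :: ('a, 'b, 'k, 'v) quiver_rep) (Y :: ('a, 'b, 'k, 'v) quiver_rep). \<lbrakk>X \<in> indecomposables K Q; Y \<in> indecomposables K Q;
      dim_vector K Q X = x; dim_vector K Q Y = x\<rbrakk> \<Longrightarrow> rep_isomorphic K Q X Y"
proof -
  obtain vs v where vs: "admissible Q vs" "v \<in> verts Q" "fold (reflection Q) vs x v < 0"
    using exists_admissible_negative[OF x(1,3,4)] .
  have c: "(indecomposables_of_dim K Q x \<noteq> ({} :: ('a, 'b, 'k, 'v) quiver_rep set) \<longleftrightarrow> tits_form Q x \<le> 1) \<and>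
      (\<forall>X\<in>indecomposables_of_dim K Q x. \<forall>Y\<in>indecomposables_of_dim K Q x.
        rep_isomorphic K Q (X :: ('a, 'b, 'k, 'v) quiver_rep) (Y :: ('a, 'b, 'k, 'v) quiver_rep))"
    by (rule classification_along_admissible[OF K coord tits_quiver_axioms vs(1) x(1) _ vs(2,3)]) (rule x(2))
  have wf: "wf_digraph Q" by unfold_locales
  have mem: "X \<in> indecomposables_of_dim K Q x \<longleftrightarrow> X \<in> indecomposables K Q \<and> dim_vector K Q X = x"
    for X :: "('a, 'b, 'k, 'v) quiver_rep"
    using indecomposables_eq[OF wf, of X K] by (auto simp: indecomposables_of_dim_def)
  show "(\<exists>X :: ('a, 'b, 'k, 'v) quiver_rep. X \<in> indecomposables K Q \<and> dim_vector K Q X = x) \<longleftrightarrow> tits_form Q x \<le> 1"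
    using c by (simp add: ex_in_conv[symmetric] mem del: ex_in_conv)
  fix X Y :: "('a, 'b, 'k, 'v) quiver_rep"
  assume "X \<in> indecomposables K Q" "Y \<in> indecomposables K Q" "dim_vector K Q X = x" "dim_vector K Q Y = x"
  then show "rep_isomorphic K Q X Y" using c mem[of X] mem[of Y] by blast
qed

theorem theorem5p1p1:
  fixes K :: "('k, 'm) ring_scheme" and Q :: "('a, 'b) pre_digraph"
  assumes "field K"
    and "fin_digraph Q"
    and "dynkin_diagram (underlying_graph Q)"
    and "contains_coordinate_spaces TYPE('v) K"
  shows "dim_vector K Q respects (iso_rel K Q :: ('a, 'b, 'k, 'v) quiver_rep rel) \<and>
    bij_betw (\<lambda>C :: ('a, 'b, 'k, 'v) quiver_rep set. the_elem (dim_vector K Q ` C))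
      (indecomposables K Q // iso_rel K Q) (positive_roots (underlying_graph Q)) \<and>
    finite (indecomposables K Q // iso_rel K Q :: ('a, 'b, 'k, 'v) quiver_rep set set)"
proof -
  interpret tits_quiver Q by (rule tits_quiver_of_dynkin[OF assms(2,3)])
  have wf: "wf_digraph Q" by unfold_locales
  let ?I = "indecomposables K Q :: ('a, 'b, 'k, 'v) quiver_rep set"
  let ?R = "iso_rel K Q :: ('a, 'b, 'k, 'v) quiver_rep rel"
  let ?d = "dim_vector K Q :: ('a, 'b, 'k, 'v) quiver_rep \<Rightarrow> 'a \<Rightarrow> int"
  let ?f = "\<lambda>C :: ('a, 'b, 'k, 'v) quiver_rep set. the_elem (?d ` C)"
  note cls = classification[OF assms(1,4)]
  have equiv: "equiv ?I ?R" by (rule equiv_iso_rel[OF wf])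
  have resp: "?d respects ?R"
    by (rule congruentI) (auto simp: iso_rel_def indecomposables_def intro: rep_isomorphic_dim_vector)
  have roots: "x \<in> positive_roots (underlying_graph Q) \<longleftrightarrow>
      x \<in> verts Q \<rightarrow>\<^sub>E UNIV \<and> (\<forall>v\<in>verts Q. 0 \<le> x v) \<and> (\<exists>u\<in>verts Q. x u \<noteq> 0) \<and> tits_form Q x \<le> 1" for x
  proof -
    have "x \<noteq> (\<lambda>i\<in>verts Q. 0) \<longleftrightarrow> (\<exists>u\<in>verts Q. x u \<noteq> 0)" if "x \<in> verts Q \<rightarrow>\<^sub>E UNIV"
      using that by (auto simp: fun_eq_iff PiE_iff extensional_def)
    moreover have "gverts (underlying_graph Q) = verts Q" by (simp add: underlying_graph_def)
    ultimately show ?thesis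
      by (auto simp: positive_roots_def roots_def quadratic_form_underlying_graph[OF assms(2)])
  qed
  have f: "?f (?R `` {X}) = ?d X" if "X \<in> ?I" for X
  proof -
    have "X \<in> ?R `` {X}" using equiv_class_self[OF equiv that] .
    then have "?d ` (?R `` {X}) = {?d X}" using resp by (auto simp: congruent_def)
    then show ?thesis by simp
  qed
  have root: "?d X \<in> positive_roots (underlying_graph Q)" if X: "X \<in> ?I" for X
  proof -
    obtain u where u: "u \<in> verts Q" "?d X u \<noteq> 0" using dim_vector_nonzero[OF X] .
    then show ?thesis
      using cls(1)[OF dim_vector_extensional dim_vector_nonneg u] X roots
        dim_vector_extensional[of K Q X] dim_vector_nonneg[of _ Q K X] by blast
  qed
  have bij: "bij_betw ?f (?I // ?R) (positive_roots (underlying_graph Q))"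
    unfolding bij_betw_def
  proof
    show "inj_on ?f (?I // ?R)"
    proof (rule inj_onI)
      fix C D assume "C \<in> ?I // ?R" "D \<in> ?I // ?R" and eq: "?f C = ?f D"
      then obtain X Y where X: "X \<in> ?I" "C = ?R `` {X}" and Y: "Y \<in> ?I" "D = ?R `` {Y}"
        by (auto elim!: quotientE)
      then have d: "?d Y = ?d X" using eq f by simp
      obtain u where u: "u \<in> verts Q" "?d X u \<noteq> 0" using dim_vector_nonzero[OF X(1)] .
      have "rep_isomorphic K Q X Y"
        by (rule cls(2)[OF dim_vector_extensional dim_vector_nonneg u X(1) Y(1) refl d])
      then have "(X, Y) \<in> ?R" using X Y by (simp add: iso_rel_def)
      then show "C = D" using equiv_class_eq[OF equiv] X Y by blast
    qed
    show "?f ` (?I // ?R) = positive_roots (underlying_graph Q)"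
    proof (intro equalityI subsetI)
      fix x assume "x \<in> ?f ` (?I // ?R)"
      then obtain X where "X \<in> ?I" "x = ?f (?R `` {X})" by (auto elim!: quotientE)
      then show "x \<in> positive_roots (underlying_graph Q)" using f root by simp
    next
      fix x assume "x \<in> positive_roots (underlying_graph Q)"
      then obtain u where x: "x \<in> verts Q \<rightarrow>\<^sub>E UNIV" "\<And>v. v \<in> verts Q \<Longrightarrow> 0 \<le> x v"
        and u: "u \<in> verts Q" "x u \<noteq> 0" and q: "tits_form Q x \<le> 1"
        unfolding roots by blast
      obtain X :: "('a, 'b, 'k, 'v) quiver_rep" where X: "X \<in> ?I" "?d X = x"
        using iffD2[OF cls(1)[OF x u] q] by blast
      then show "x \<in> ?f ` (?I // ?R)" using f[OF X(1)] quotientI[OF X(1), of ?R] by (metis imageI)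
    qed
  qed
  have "finite (positive_roots (underlying_graph Q))"
    by (rule finite_subset[OF _ finite_tits_form_le[of 1]]) (use roots in blast)
  then have "finite (?I // ?R)" using bij_betw_finite[OF bij] by simp
  with resp bij show ?thesis by blast
qed

end
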